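(* Let $\alpha>0$. Consider a family of densities $g(x;\theta)$ on $[1,\infty)$ belonging to the class $\mathcal{G}$, with $h(x)=\frac{\partial}{\partial\theta}g(x;\theta)\big|_{\theta=0}$ satisfying $\int_1^\infty x^{\alpha+1}h^2(x)\,dx<\infty$. Let $t_0=(\sqrt7-1)^{1/\alpha}$. Then the alternative densities $$g(x;\theta)=\frac{\alpha}{x^{\alpha+1}}+\theta\left(C\frac{\alpha\,\psi(x;t_0)}{x^{\alpha+1}}+D\frac{\alpha\ln x-1}{x^{\alpha+1}}\right),\quad x\ge 1,\ C>0,\ D\in\mathbb{R},$$ are, for small $\theta$, asymptotically optimal for the test based on $V_n$, i.e. the local asymptotic Bahadur efficiency $e_V=\lim_{\theta\to 0}\frac{c_V(\theta)}{2K(\theta)}$ equals $1$.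
   Context: Let $X_1,\dots,X_n$ be i.i.d. with a continuous distribution on $[1,\infty)$. $F_n(t)=\frac1n\sum_{i=1}^n I\{X_i\le t\}$ and $M_n(t)=\binom{n}{2}^{-1}\sum_{1\le i<j\le n} I\{\max(X_i/X_j,X_j/X_i)\le t\}$, $t\ge1$. The test statistic is $V_n=\sup_{t\ge1}|M_n(t)-F_n(t)|$, large values being significant. The null hypothesis is that the distribution is Pareto, $F(x)=1-x^{-\alpha}$, $x\ge1$, for some $\alpha>0$. $\mathcal{G}$ is a class of families of densities $g(x;\theta)$ on $[1,\infty)$, $\theta$ in a neighbourhood of $0$ (with $\theta\ge0$), such that $g(x;0)=\alpha x^{-\alpha-1}$ and differentiation in $\theta$ under the integral sign is permitted in all integrals appearing. Define, for $s,t\ge1$, $\psi(s;t)=\frac{t^\alpha}{s^\alpha}-\frac{1}{s^\alpha t^\alpha}-\frac12+\frac{1}{2t^\alpha}+I\{s\le t\}\left(\frac12-\frac{t^\alpha}{s^\alpha}\right)$. For a family in $\mathcal{G}$: $b_V(\theta)$ is the limit in probability of $V_n$ when the sample has density $g(\cdot;\theta)$; $G_n(t)=\inf_{\lambda>0}P_\lambda\{V_n<t\}$ where $P_\lambda$ is the Pareto law with parameter $\lambda$; $f(t)=-\lim_{n\to\infty}\frac1n\ln(1-G_n(t))$; the Bahadur exact slope is $c_V(\theta)=2f(b_V(\theta))$; and $K(\theta)=\inf_{\lambda>0}\int_1^\infty \ln\frac{g(x;\theta)}{\lambda x^{-\lambda-1}}\,g(x;\theta)\,dx$. *)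

theory Defs
  imports "HOL-Probability.Probability"
begin

text \<open>A sample of size n is a function x :: nat => real, of which x 0, ..., x (n-1) are used.\<close>

definition Fn :: "nat \<Rightarrow> (nat \<Rightarrow> real) \<Rightarrow> real \<Rightarrow> real" where
  "Fn n x t = (1 / real n) * real (card {i. i < n \<and> x i \<le> t})"

definition Mn :: "nat \<Rightarrow> (nat \<Rightarrow> real) \<Rightarrow> real \<Rightarrow> real" where
  "Mn n x t = (1 / real (n choose 2)) *
     real (card {(i, j). i < j \<and> j < n \<and> max (x i / x j) (x j / x i) \<le> t})"

definition Vn :: "nat \<Rightarrow> (nat \<Rightarrow> real) \<Rightarrow> real" where
  "Vn n x = (SUP t\<in>{1..}. \<bar>Mn n x t - Fn n x t\<bar>)"

definition sample :: "(real \<Rightarrow> real) \<Rightarrow> nat \<Rightarrow> (nat \<Rightarrow> real) measure" where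
  "sample g n = PiM {..<n} (\<lambda>_. density lborel (\<lambda>x. ennreal (g x)))"

definition pareto_dens :: "real \<Rightarrow> real \<Rightarrow> real" where
  "pareto_dens lam x = (if 1 \<le> x then lam * x powr (- lam - 1) else 0)"

definition Vn_conv_prob :: "(real \<Rightarrow> real) \<Rightarrow> real \<Rightarrow> bool" where
  "Vn_conv_prob g b \<longleftrightarrow> (\<forall>\<epsilon>>0.
     (\<lambda>n. measure (sample g n) {x \<in> space (sample g n). \<bar>Vn n x - b\<bar> > \<epsilon>}) \<longlonglongrightarrow> 0)"

definition bV :: "(real \<Rightarrow> real \<Rightarrow> real) \<Rightarrow> real \<Rightarrow> real" where
  "bV g \<theta> = (THE b. Vn_conv_prob (g \<theta>) b)"

definition Gn :: "nat \<Rightarrow> real \<Rightarrow> real" where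
  "Gn n t = (INF lam\<in>{0<..}.
     measure (sample (pareto_dens lam) n) {x \<in> space (sample (pareto_dens lam) n). Vn n x < t})"

definition ld_seq :: "real \<Rightarrow> nat \<Rightarrow> real" where
  "ld_seq t n = - (1 / real n) * ln (1 - Gn n t)"

definition ld_f :: "real \<Rightarrow> real" where
  "ld_f t = lim (ld_seq t)"

definition cV :: "(real \<Rightarrow> real \<Rightarrow> real) \<Rightarrow> real \<Rightarrow> real" where
  "cV g \<theta> = 2 * ld_f (bV g \<theta>)"

definition KL :: "(real \<Rightarrow> real \<Rightarrow> real) \<Rightarrow> real \<Rightarrow> real" where
  "KL g \<theta> = (INF lam\<in>{0<..}.
     (LINT x:{1..}|lborel. ln (g \<theta> x / (lam * x powr (- lam - 1))) * g \<theta> x))"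

definition psi :: "real \<Rightarrow> real \<Rightarrow> real \<Rightarrow> real" where
  "psi \<alpha> s t = t powr \<alpha> / s powr \<alpha> - 1 / (s powr \<alpha> * t powr \<alpha>) - 1/2 + 1 / (2 * t powr \<alpha>)
     + (if s \<le> t then 1/2 - t powr \<alpha> / s powr \<alpha> else 0)"

definition t0 :: "real \<Rightarrow> real" where
  "t0 \<alpha> = (sqrt 7 - 1) powr (1 / \<alpha>)"

definition h_alt :: "real \<Rightarrow> real \<Rightarrow> real \<Rightarrow> real \<Rightarrow> real" where
  "h_alt \<alpha> C D x = (if 1 \<le> x then
     C * \<alpha> * psi \<alpha> x (t0 \<alpha>) / x powr (\<alpha> + 1) + D * (\<alpha> * ln x - 1) / x powr (\<alpha> + 1) else 0)"

definition g_alt :: "real \<Rightarrow> real \<Rightarrow> real \<Rightarrow> real \<Rightarrow> real \<Rightarrow> real" where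
  "g_alt \<alpha> C D \<theta> x = (if 1 \<le> x then \<alpha> / x powr (\<alpha> + 1) + \<theta> * h_alt \<alpha> C D x else 0)"

end

theory Submission
  imports Defs "HOL-Real_Asymp.Real_Asymp"
begin

text \<open>
  Write \<open>\<Phi>\<^sub>t(Q)\<close> for the difference of the two limiting distribution functions at \<open>t\<close> when the observations have law \<open>Q\<close>, and
  \<open>V(Q) = sup\<^sub>t |\<Phi>\<^sub>t(Q)|\<close>. Both distribution functions are built from intervals, so \<open>V\<close> is Lipschitz in the Kolmogorov distance and
  \<open>V\<^sub>n\<close> converges to \<open>V(Q)\<close> in probability. For a Pareto law \<open>P\<close> and \<open>Q = qP\<close> one has \<open>\<Phi>\<^sub>t(Q) = 2 \<integral> \<psi>\<^sub>t q dP + R\<close> with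
  \<open>|R| \<le> (\<integral> |q - 1| dP)\<^sup>2\<close>, where \<open>\<psi>\<^sub>t\<close> is the projection of the kernel.

  Under \<open>P\<close>, a change of measure and the method of types bound the exponential rate of \<open>P(V\<^sub>n \<ge> t)\<close> by
  \<open>J(t) = inf {H(Q|P) : V(Q) \<ge> t}\<close> from both sides, up to replacing \<open>t\<close> by \<open>t \<plusminus> \<epsilon>\<close>. By the Donsker-Varadhan inequality
  \<open>J(t) \<sim> t\<^sup>2 / (8 v)\<close> as \<open>t \<rightarrow> 0\<close>, where \<open>v\<close>, the maximum over \<open>t\<close> of the variance of \<open>\<psi>\<^sub>t\<close>, is attained at \<open>t\<^sub>0\<close>; and \<open>J\<close> is Lipschitz near 0
  because mixing a near-minimizer with the tilt \<open>1 \<plusminus> \<psi>\<^sub>t\<close> raises \<open>V\<close> at a linear rate. So the rate exists and equals \<open>J(t)\<close> for small \<open>t\<close>.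

  For the given alternatives the logarithmic term is the score of the Pareto family, which is orthogonal to every \<open>\<psi>\<^sub>t\<close>; by Cauchy-Schwarz
  \<open>b\<^sub>V(\<theta>) \<sim> 2 \<theta> C v\<close>, while minimizing over the Pareto parameter removes the logarithmic term from the divergence, leaving
  \<open>K(\<theta>) \<sim> \<theta>\<^sup>2 C\<^sup>2 v / 2\<close>. Hence \<open>2 J(b\<^sub>V(\<theta>)) / (2 K(\<theta>)) \<rightarrow> 1\<close>.
\<close>

section \<open>Pareto laws and the projection of the kernel\<close>

text \<open>With s = \<open>t powr (- l)\<close> the projection is the difference of two copies of
  one centred function, \<open>x powr (- l) - 1/2\<close>, one weighted by s and the other restarted
  at t. Lack of memory of the Pareto law then gives all its moments; its variance is s (1 - s) (1 +
  2 s) / 12, maximal where 6 s^2 = 1 + 2 s, and this is the origin of sqrt 7. The constant 8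
  balances a tilt by e times the projection: it shifts the statistic by about 2 e v and costs
  entropy about e^2 v / 2, so reaching the level t = 2 e v costs t^2 / (8 v). The slope evaluates
  the rate at \<open>bV g \<theta>\<close> for each fixed \<theta>, before \<theta> tends to 0.
  Asymptotics of J alone are therefore not enough: the limit defining the rate must exist at every
  small level, and continuity of J is what closes the gap between the two bounds. Neither an
  attained infimum nor an attained supremum over t is used, so that step works with near-minimizers
  and near-maximal t throughout. Competing laws are restricted to bounded densities. This keeps
  entropies finite and costs nothing on either side, since both the densities of types and the tilts
  by the projection are bounded.\<close>

definition par :: "real \<Rightarrow> real measure" where
  "par l = density lborel (\<lambda>x. ennreal (pareto_dens l x))"

lemma pareto_dens_measurable [measurable]: "pareto_dens l \<in> borel_measurable borel"
  unfolding pareto_dens_def by measurable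

lemma pareto_dens_nonneg: "l > 0 \<Longrightarrow> 0 \<le> pareto_dens l x"
  unfolding pareto_dens_def by auto

lemma sets_par [simp, measurable_cong]: "sets (par l) = sets borel"
  by (simp add: par_def)

lemma space_par [simp]: "space (par l) = UNIV"
  by (simp add: par_def)

section \<open>Integration against Pareto laws\<close>

lemma has_bochner_integral_par_iff:
  fixes f :: "real \<Rightarrow> real"
  assumes "l > 0" "f \<in> borel_measurable borel"
  shows "has_bochner_integral (par l) f I \<longleftrightarrow>
         has_bochner_integral lborel (\<lambda>x. pareto_dens l x * f x) I"
  using assms unfolding par_def has_bochner_integral_iff
  by (subst integrable_density integral_density; auto simp: pareto_dens_nonneg)+

text \<open>For a nonnegative integrand the fundamental theorem of calculus on a half-line gives
  integrability and value together, so each moment of the logarithm costs one derivative and one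
  limit.\<close>

lemma has_bochner_integral_par_FTC:
  fixes f F :: "real \<Rightarrow> real"
  assumes l: "l > 0" and f: "f \<in> borel_measurable borel"
    and nonneg: "\<And>x. 1 \<le> x \<Longrightarrow> 0 \<le> f x"
    and F: "\<And>x. 1 \<le> x \<Longrightarrow> DERIV F x :> l * x powr (- l - 1) * f x"
    and lim: "(F \<longlongrightarrow> T) at_top"
  shows "has_bochner_integral (par l) f (T - F 1)"
proof -
  have "(\<integral>\<^sup>+x. ennreal (l * x powr (- l - 1) * f x) * indicator {1..} x \<partial>lborel) = T - F 1"
    using l nonneg by (intro nn_integral_FTC_atLeast F lim) (use f in auto)
  also have "(\<integral>\<^sup>+x. ennreal (l * x powr (- l - 1) * f x) * indicator {1..} x \<partial>lborel)
       = (\<integral>\<^sup>+x. ennreal (pareto_dens l x * f x) \<partial>lborel)"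
    by (intro nn_integral_cong) (auto simp: pareto_dens_def split: split_indicator)
  finally have *: "(\<integral>\<^sup>+x. ennreal (pareto_dens l x * f x) \<partial>lborel) = ennreal (T - F 1)" .
  \<comment> \<open>\<open>ennreal\<close> sends negative numbers to 0, so the sign of
    \<open>T - F 1\<close> is needed to read the value back as a real number.\<close>
  have "F 1 \<le> T"
  proof (rule tendsto_lowerbound[OF lim])
    have "F 1 \<le> F x" if "1 \<le> x" for x
    proof (rule DERIV_nonneg_imp_nondecreasing[OF that])
      fix y :: real assume "1 \<le> y" "y \<le> x"
      then show "\<exists>z. DERIV F y :> z \<and> 0 \<le> z"
        using F[of y] nonneg[of y] l by (intro exI[of _ "l * y powr (- l - 1) * f y"]) auto
    qed
    then show "\<forall>\<^sub>F x in at_top. F 1 \<le> F x"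
      by (auto simp: eventually_at_top_linorder)
  qed simp
  moreover have "AE x in lborel. 0 \<le> pareto_dens l x * f x"
    using nonneg l by (auto simp: pareto_dens_def)
  ultimately show ?thesis
    unfolding has_bochner_integral_par_iff[OF l f]
    by (intro has_bochner_integral_nn_integral *) (use f in auto)
qed

lemma has_bochner_integral_par_one: "l > 0 \<Longrightarrow> has_bochner_integral (par l) (\<lambda>_. 1) (1::real)"
  by (rule has_bochner_integral_par_FTC[where F="\<lambda>x. - (x powr (- l))" and T=0, simplified])
     (auto intro!: derivative_eq_intros simp: powr_diff powr_minus field_simps, real_asymp)

lemma has_bochner_integral_par_ln: "l > 0 \<Longrightarrow> has_bochner_integral (par l) ln (1 / l)"
  by (rule has_bochner_integral_par_FTC[where F="\<lambda>x. - (x powr (- l)) * (ln x + 1 / l)" and T=0, simplified])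
     (auto intro!: derivative_eq_intros simp: powr_diff powr_minus field_simps, real_asymp)

lemma has_bochner_integral_par_ln2: "l > 0 \<Longrightarrow> has_bochner_integral (par l) (\<lambda>x. (ln x)^2) (2 / l^2)"
  by (rule has_bochner_integral_par_FTC[where F="\<lambda>x. - (x powr (- l)) * ((ln x)^2 + 2 * ln x / l + 2 / l^2)" and T=0, simplified])
     (auto intro!: derivative_eq_intros simp: powr_diff powr_minus field_simps power2_eq_square, real_asymp)

lemma integrable_par_ln3:
  assumes "l > 0" shows "integrable (par l) (\<lambda>x. (ln x)^3)"
proof -
  have "has_bochner_integral (par l) (\<lambda>x. (ln x)^3)
     (0 - (- (1 powr (- l)) * ((ln 1)^3 + 3 * (ln 1)^2 / l + 6 * ln 1 / l^2 + 6 / l^3)))"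
    by (rule has_bochner_integral_par_FTC[where F="\<lambda>x. - (x powr (- l)) * ((ln x)^3 + 3 * (ln x)^2 / l + 6 * ln x / l^2 + 6 / l^3)"])
     (use assms in \<open>auto intro!: derivative_eq_intros simp: powr_diff powr_minus field_simps power2_eq_square power3_eq_cube, real_asymp\<close>)
  then show ?thesis by (rule integrable.intros)
qed

lemma prob_space_par: "l > 0 \<Longrightarrow> prob_space (par l)"
proof
  assume l: "l > 0"
  have *: "has_bochner_integral lborel (pareto_dens l) 1"
    using has_bochner_integral_par_one[OF l] by (subst (asm) has_bochner_integral_par_iff) (use l in auto)
  have "emeasure (par l) (space (par l)) = (\<integral>\<^sup>+x. ennreal (pareto_dens l x) \<partial>lborel)"
    unfolding par_def by (subst emeasure_density) (auto simp: space_density)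
  also have "\<dots> = ennreal 1"
    using * l by (intro nn_integral_eq_integrable[THEN iffD2])
       (auto simp: has_bochner_integral_iff pareto_dens_nonneg)
  finally show "emeasure (par l) (space (par l)) = 1" by simp
qed

lemma AE_par_ge1: "AE x in par l. 1 \<le> x"
  unfolding par_def by (subst AE_density) (auto simp: pareto_dens_def split: if_splits)

text \<open>The weight turns the density with parameter \<open>l\<close> into
  \<open>l / (l + b)\<close> times the one with parameter \<open>l + b\<close>.\<close>

lemma has_bochner_integral_par_powr:
  fixes f :: "real \<Rightarrow> real"
  assumes "l > 0" "b \<ge> 0" "f \<in> borel_measurable borel" "has_bochner_integral (par (l + b)) f I"
  shows "has_bochner_integral (par l) (\<lambda>x. x powr (- b) * f x) (l / (l + b) * I)"
proof -
  have "has_bochner_integral lborel (\<lambda>x. l / (l + b) * (pareto_dens (l + b) x * f x)) (l / (l + b) * I)"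
    using assms by (intro has_bochner_integral_mult_right) (subst (asm) has_bochner_integral_par_iff, auto)
  also have "(\<lambda>x. l / (l + b) * (pareto_dens (l + b) x * f x)) = (\<lambda>x. pareto_dens l x * (x powr (- b) * f x))"
    using assms by (auto simp: pareto_dens_def fun_eq_iff powr_diff powr_minus powr_add field_simps)
  finally show ?thesis
    using assms by (subst has_bochner_integral_par_iff) auto
qed

text \<open>Lack of memory: beyond \<open>t\<close>, a set of mass \<open>t powr (- l)\<close>, the
  ratio \<open>x / t\<close> is again Pareto with parameter \<open>l\<close>.\<close>

lemma has_bochner_integral_par_memoryless:
  fixes f :: "real \<Rightarrow> real"
  assumes l: "l > 0" and t: "t \<ge> 1" and f [measurable]: "f \<in> borel_measurable borel"
    and I: "has_bochner_integral (par l) f I"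
  shows "has_bochner_integral (par l) (\<lambda>x. indicator {t<..} x * f (x / t)) (t powr (- l) * I)"
proof -
  have "has_bochner_integral lborel (\<lambda>x. t powr (- l) * (pareto_dens l x * f x)) (t powr (- l) * I)"
    using assms by (intro has_bochner_integral_mult_right) (subst (asm) has_bochner_integral_par_iff, auto)
  then have "has_bochner_integral lborel (\<lambda>x. (1/t) *\<^sub>R (t powr (- l) * (pareto_dens l (x / t) * f (x / t)))) (t powr (- l) * I)"
    using t lborel_has_bochner_integral_real_affine_iff[of "1/t" "\<lambda>x. t powr (- l) * (pareto_dens l x * f x)" "t powr (- l) * I" 0]
    by (simp add: has_bochner_integral_iff divide_simps mult_ac)
  then have "has_bochner_integral lborel (\<lambda>x. pareto_dens l x * (indicator {t<..} x * f (x / t))) (t powr (- l) * I)"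
  proof (rule has_bochner_integral_cong_AE[THEN iffD1, rotated -1])
    \<comment> \<open>At \<open>x = t\<close> the rescaled density is still positive while the open
      indicator is 0, so the two integrands agree only off this point.\<close>
    have *: "AE x in lborel. x \<noteq> t" by (rule AE_lborel_singleton)
    show "AE x in lborel. (1/t) *\<^sub>R (t powr (- l) * (pareto_dens l (x / t) * f (x / t))) =
       pareto_dens l x * (indicator {t<..} x * f (x / t))"
      using * by eventually_elim
       (use t in \<open>auto simp: pareto_dens_def powr_divide powr_diff powr_minus field_simps split: split_indicator\<close>)
  qed auto
  then show ?thesis
    using assms by (subst has_bochner_integral_par_iff) auto
qed

lemma measure_par_greaterThan:
  assumes "l > 0" "t \<ge> 1" shows "measure (par l) {t<..} = t powr (- l)"
  using has_bochner_integral_par_memoryless[OF assms _ has_bochner_integral_par_one[OF assms(1)]]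
  by (simp add: has_bochner_integral_iff)

lemma measure_par_atMost:
  assumes "l > 0" "t \<ge> 1" shows "measure (par l) {..t} = 1 - t powr (- l)"
proof -
  interpret prob_space "par l" using assms by (intro prob_space_par)
  have "measure (par l) (UNIV - {t<..}) = 1 - t powr (- l)"
    using prob_compl[of "{t<..}"] measure_par_greaterThan[OF assms] by simp
  moreover have "UNIV - {t<..} = {..t}" by auto
  ultimately show ?thesis by simp
qed

lemma emeasure_par_singleton: "emeasure (par l) {x} = 0"
  unfolding par_def by (subst emeasure_density) (auto intro!: nn_integral_0_iff_AE[THEN iffD2] AE_I[of _ _ "{x}"] split: split_indicator)

text \<open>For positive \<open>x\<close>, \<open>y\<close>, \<open>t\<close>, membership of
  \<open>y\<close> means \<open>max (x / y) (y / x) \<le> t\<close>. As an interval in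
  \<open>y\<close>, its mass is controlled by the distribution function.\<close>

definition win :: "real \<Rightarrow> real \<Rightarrow> real set" where
  "win t x = {x / t..t * x}"

lemma win_measurable [measurable]: "win t x \<in> sets borel"
  by (simp add: win_def)

lemma measure_par_atLeast:
  assumes "l > 0" "t \<ge> 1" shows "measure (par l) {t..} = t powr (- l)"
proof -
  interpret prob_space "par l" using assms by (intro prob_space_par)
  have "measure (par l) ({t<..} \<union> {t}) = measure (par l) {t<..}"
    by (rule measure_Un_null_set) (auto simp: null_sets_def emeasure_par_singleton)
  moreover have "{t<..} \<union> {t} = {t..}" by auto
  ultimately show ?thesis using measure_par_greaterThan[OF assms] by simp
qed

text \<open>The two cases differ in whether the lower end \<open>x / t\<close> still lies inside the
  support; for \<open>x \<le> t\<close> it has dropped to 1 or below.\<close>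

lemma measure_par_win:
  assumes "l > 0" "t \<ge> 1" "x \<ge> 1"
  shows "measure (par l) (win t x) = (if x \<le> t then 1 else (x/t) powr (- l)) - (t * x) powr (- l)"
proof -
  interpret prob_space "par l" using assms by (intro prob_space_par)
  have t: "1 \<le> t * x" using assms mult_mono[of 1 t 1 x] by simp
  show ?thesis
  proof (cases "x \<le> t")
    case True
    have "measure (par l) (win t x) = measure (par l) {..t * x}"
    proof (rule measure_eq_AE)
      show "AE y in par l. (y \<in> win t x) = (y \<in> {..t * x})"
        using AE_par_ge1 proof eventually_elim
        case (elim y)
        have "1 * t \<le> y * t" using elim assms by (intro mult_right_mono) auto
        then have "x \<le> y * t" using True by linarith
        then have "x / t \<le> y" using assms by (simp add: divide_le_eq)
        then show ?case by (simp add: win_def)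
      qed
    qed auto
    then show ?thesis using True measure_par_atMost[OF assms(1) t] by simp
  next
    case False
    then have 1: "1 \<le> x / t" using assms by (simp add: le_divide_eq)
    have sub: "x / t \<le> t * x"
    proof -
      have "x \<le> x * (t * t)" using assms mult_mono[of 1 t 1 t] by (simp add: mult_le_cancel_left1)
      then show ?thesis using assms by (simp add: divide_le_eq mult_ac)
    qed
    have "win t x = {x/t..} - {t * x<..}" using sub by (auto simp: win_def)
    then have "measure (par l) (win t x) = measure (par l) {x/t..} - measure (par l) {t*x<..}"
    proof -
      have "{t * x<..} \<subseteq> {x/t..}"
      proof
        fix y assume "y \<in> {t * x<..}"
        then have "x / t \<le> y" using sub by (simp del: divide_le_eq_1)
        then show "y \<in> {x/t..}" by simp
      qed
      then have "measure (par l) ({x/t..} - {t * x<..}) = measure (par l) {x/t..} - measure (par l) {t*x<..}"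
        by (intro finite_measure_Diff) simp_all
      then show ?thesis using \<open>win t x = _\<close> by simp
    qed
    then show ?thesis using False measure_par_atLeast[OF assms(1) 1] measure_par_greaterThan[OF assms(1) t] by simp
  qed
qed

lemma measure_win_measurable [measurable]:
  assumes "sigma_finite_measure M" and [simp, measurable_cong]: "sets M = sets borel"
  shows "(\<lambda>x. measure M (win t x)) \<in> borel_measurable borel"
proof -
  interpret sigma_finite_measure M by fact
  have [simp]: "space M = UNIV" using sets_eq_imp_space_eq[OF assms(2)] by simp
  have "{x \<in> space (borel \<Otimes>\<^sub>M borel :: (real \<times> real) measure). fst x / t \<le> snd x \<and> snd x \<le> t * fst x} \<in> sets (borel \<Otimes>\<^sub>M borel)"
    by measurable
  moreover have "sets (borel \<Otimes>\<^sub>M M) = sets (borel \<Otimes>\<^sub>M (borel :: real measure))"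
    by (intro sets_pair_measure_cong) simp_all
  ultimately show ?thesis
    unfolding win_def by (intro measurable_measure) (simp_all add: space_pair_measure)
qed

text \<open>Hoeffding projection: the symmetrized kernel is the indicator of
  \<open>y \<in> win t x\<close> minus the mean of the indicators of \<open>x \<le> t\<close> and
  \<open>y \<le> t\<close>, and \<open>y\<close> is integrated out under
  \<open>par l\<close>.\<close>

definition ps :: "real \<Rightarrow> real \<Rightarrow> real \<Rightarrow> real" where
  "ps l t x = measure (par l) (win t x) - indicator {..t} x / 2 - measure (par l) {..t} / 2"

lemma ps_measurable [measurable]: "l > 0 \<Longrightarrow> ps l t \<in> borel_measurable borel"
  unfolding ps_def by (intro borel_measurable_diff measure_win_measurable)
    (auto intro: prob_space_imp_sigma_finite prob_space_par)

lemma abs_ps_le_1: "l > 0 \<Longrightarrow> \<bar>ps l t x\<bar> \<le> 1"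
proof -
  assume "l > 0"
  then interpret prob_space "par l" by (rule prob_space_par)
  have aux: "\<bar>a - i / 2 - b / 2\<bar> \<le> 1" if "0 \<le> a" "a \<le> 1" "0 \<le> b" "b \<le> 1" "0 \<le> i" "i \<le> 1" for a b i :: real
    using that by (auto simp: abs_le_iff)
  show ?thesis unfolding ps_def by (rule aux) (auto simp: indicator_def)
qed

lemma ps_eq:
  assumes "l > 0" "t \<ge> 1" "x \<ge> 1"
  shows "ps l t x = - (t powr (- l)) * (x powr (- l) - 1/2)
           + indicator {t<..} x * ((x / t) powr (- l) - 1/2)"
  using assms measure_par_win[OF assms] measure_par_atMost[OF assms(1,2)]
  by (auto simp: ps_def powr_mult field_simps indicator_def)

lemma ps_eq_psi:
  assumes "l > 0" "t \<ge> 1" "x \<ge> 1"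
  shows "ps l t x = psi l x t"
  using assms by (auto simp: ps_eq psi_def powr_divide powr_minus field_simps indicator_def)

section \<open>Mean, orthogonality to the logarithm, and variance of the projection\<close>

context
  fixes l :: real assumes l: "l > 0"
begin

lemma moment_powr: "has_bochner_integral (par l) (\<lambda>x. x powr (- l)) (1/2)"
  using has_bochner_integral_par_powr[OF l, of l "\<lambda>_. 1" 1] l has_bochner_integral_par_one[of "l + l"]
  by simp

lemma centred_powr: "has_bochner_integral (par l) (\<lambda>x. x powr (- l) - 1/2) 0"
  using has_bochner_integral_diff[OF moment_powr has_bochner_integral_mult_right[OF has_bochner_integral_par_one[OF l], of "1/2"]]
  by simp

lemma centred_powr2: "has_bochner_integral (par l) (\<lambda>x. (x powr (- l) - 1/2)^2) (1/12)"
proof -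
  have "has_bochner_integral (par l) (\<lambda>x. x powr (- (2 * l)) * 1) (l / (l + 2 * l) * 1)"
    using l by (intro has_bochner_integral_par_powr has_bochner_integral_par_one) auto
  then have *: "has_bochner_integral (par l) (\<lambda>x. x powr (- (2 * l))) (1 / 3)" using l by simp
  have "has_bochner_integral (par l) (\<lambda>x. x powr (- (2 * l)) - x powr (- l) + 1/4 * 1) (1/3 - 1/2 + 1/4 * 1)"
    by (intro has_bochner_integral_add has_bochner_integral_diff * moment_powr
        has_bochner_integral_mult_right has_bochner_integral_par_one l)
  also have "(\<lambda>x. x powr (- (2 * l)) - x powr (- l) + 1/4 * 1) = (\<lambda>x. (x powr (- l) - 1/2)^2)"
    by (auto simp: fun_eq_iff power2_eq_square algebra_simps powr_add[symmetric])
  finally show ?thesis by simp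
qed

lemma centred_powr_ln: "has_bochner_integral (par l) (\<lambda>x. (x powr (- l) - 1/2) * ln x) (- 1 / (4 * l))"
proof -
  have "has_bochner_integral (par l) (\<lambda>x. x powr (- l) * ln x) (l / (l + l) * (1 / (l + l)))"
    using l by (intro has_bochner_integral_par_powr has_bochner_integral_par_ln) auto
  then have "has_bochner_integral (par l) (\<lambda>x. x powr (- l) * ln x - 1/2 * ln x) (l / (l + l) * (1 / (l + l)) - 1/2 * (1 / l))"
    by (intro has_bochner_integral_diff has_bochner_integral_mult_right has_bochner_integral_par_ln l)
  also have "(\<lambda>x. x powr (- l) * ln x - 1/2 * ln x) = (\<lambda>x. (x powr (- l) - 1/2) * ln x)"
    by (auto simp: algebra_simps)
  finally show ?thesis using l by (simp add: field_simps)
qed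

lemma has_bochner_integral_ps: 
  assumes t: "t \<ge> 1" shows "has_bochner_integral (par l) (ps l t) 0"
proof -
  have "has_bochner_integral (par l) (\<lambda>x. - (t powr (- l)) * (x powr (- l) - 1/2)
           + indicator {t<..} x * ((x / t) powr (- l) - 1/2)) (- (t powr (- l)) * 0 + t powr (- l) * 0)"
    by (intro has_bochner_integral_add has_bochner_integral_mult_right centred_powr
        has_bochner_integral_par_memoryless[OF l t]) measurable
  then have "has_bochner_integral (par l) (ps l t) (- (t powr (- l)) * 0 + t powr (- l) * 0)"
  proof (rule has_bochner_integral_cong_AE[THEN iffD1, rotated -1])
    show "AE x in par l. - (t powr (- l)) * (x powr (- l) - 1/2)
           + indicator {t<..} x * ((x / t) powr (- l) - 1/2) = ps l t x"
      using AE_par_ge1 by eventually_elim (simp add: ps_eq[OF l t])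
  qed (use l in measurable)
  then show ?thesis by simp
qed

text \<open>After writing \<open>ln x\<close> as \<open>ln (x / t) + ln t\<close> beyond
  \<open>t\<close>, lack of memory makes the two copies of the centred function contribute opposite
  multiples of \<open>1 / (4 * l)\<close>, and \<open>ln t\<close> multiplies a term of mean
  0.\<close>

lemma has_bochner_integral_ps_ln: 
  assumes t: "t \<ge> 1" shows "has_bochner_integral (par l) (\<lambda>x. ps l t x * ln x) 0"
proof -
  have "has_bochner_integral (par l) (\<lambda>x. - (t powr (- l)) * ((x powr (- l) - 1/2) * ln x)
           + (indicator {t<..} x * (((x / t) powr (- l) - 1/2) * ln (x / t)) 
             + ln t * (indicator {t<..} x * ((x / t) powr (- l) - 1/2))))
       (- (t powr (- l)) * (- 1 / (4 * l)) + (t powr (- l) * (- 1 / (4 * l)) + ln t * (t powr (- l) * 0)))"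
    by (intro has_bochner_integral_add has_bochner_integral_mult_right centred_powr centred_powr_ln
        has_bochner_integral_par_memoryless[OF l t]
        has_bochner_integral_par_memoryless[OF l t, where f="\<lambda>x. (x powr (- l) - 1/2) * ln x"]) measurable
  then have "has_bochner_integral (par l) (\<lambda>x. ps l t x * ln x)
     (- (t powr (- l)) * (- 1 / (4 * l)) + (t powr (- l) * (- 1 / (4 * l)) + ln t * (t powr (- l) * 0)))"
  proof (rule has_bochner_integral_cong_AE[THEN iffD1, rotated -1])
    show "AE x in par l. - (t powr (- l)) * ((x powr (- l) - 1/2) * ln x)
           + (indicator {t<..} x * (((x / t) powr (- l) - 1/2) * ln (x / t)) 
             + ln t * (indicator {t<..} x * ((x / t) powr (- l) - 1/2))) = ps l t x * ln x"
      using AE_par_ge1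
    proof eventually_elim
      case (elim x)
      obtain L where "L = ln x - ln t" by blast
      moreover have "ln (x / t) = ln x - ln t" using elim t by (intro ln_divide_pos) auto
      ultimately have L: "ln (x / t) = L" "ln x = L + ln t" by simp_all
      have "- s * (a * (L + m)) + (i * (b * L) + m * (i * b)) = (- s * a + i * b) * (L + m)"
        for s a m i b :: real by (simp add: algebra_simps)
      then show ?case unfolding ps_eq[OF l t elim] L .
    qed
  qed (use l in measurable)
  then show ?thesis by simp
qed

definition vps :: "real \<Rightarrow> real" where
  "vps t = (let s = t powr (- l) in (s + s^2 - 2 * s^3) / 12)"

lemma has_bochner_integral_ps2: 
  assumes t: "t \<ge> 1" shows "has_bochner_integral (par l) (\<lambda>x. (ps l t x)^2) (vps t)"
proof -
  define s where "s = t powr (- l)"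
  define c where "c x = x powr (- l) - 1/2" for x :: real
  have [measurable]: "c \<in> borel_measurable borel" unfolding c_def by measurable
  have c: "has_bochner_integral (par l) c 0" "has_bochner_integral (par l) (\<lambda>x. (c x)^2) (1/12)"
    using centred_powr centred_powr2 unfolding c_def[abs_def] by auto
  have s: "s > 0" using t l by (auto simp: s_def)
  \<comment> \<open>This removes \<open>c x\<close> from the cross term beyond \<open>t\<close>, so
    that the square contains only functions of \<open>x / t\<close> there and lack of memory
    applies.\<close>
  have *: "c x = s * c (x / t) + (s - 1) / 2" if "x \<ge> 1" for x
    using that t l by (simp add: c_def s_def powr_divide field_simps)
  have "has_bochner_integral (par l) (\<lambda>x. s^2 * (c x)^2 + (
      (1 - 2 * s^2) * (indicator {t<..} x * (c (x / t))^2) 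
      + (- s * (s - 1)) * (indicator {t<..} x * c (x / t))))
     (s^2 * (1/12) + ((1 - 2 * s^2) * (s * (1/12)) + (- s * (s - 1)) * (s * 0)))"
    unfolding s_def
    by (intro has_bochner_integral_add has_bochner_integral_mult_right c
        has_bochner_integral_par_memoryless[OF l t, where f="\<lambda>x. (c x)^2"]
        has_bochner_integral_par_memoryless[OF l t, where f=c]) measurable
  then have "has_bochner_integral (par l) (\<lambda>x. (ps l t x)^2)
     (s^2 * (1/12) + ((1 - 2 * s^2) * (s * (1/12)) + (- s * (s - 1)) * (s * 0)))"
  proof (rule has_bochner_integral_cong_AE[THEN iffD1, rotated -1])
    show "AE x in par l. s^2 * (c x)^2 + (
      (1 - 2 * s^2) * (indicator {t<..} x * (c (x / t))^2) 
      + (- s * (s - 1)) * (indicator {t<..} x * c (x / t))) = (ps l t x)^2"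
      using AE_par_ge1
    proof eventually_elim
      case (elim x)
      have "ps l t x = - s * c x + indicator {t<..} x * c (x / t)"
        using ps_eq[OF l t elim] by (simp add: s_def c_def)
      show ?case unfolding \<open>ps l t x = _\<close> *[OF elim]
        by (cases "t < x") (simp_all add: power2_eq_square field_simps)
    qed
  qed (use l in measurable)
  then show ?thesis by (simp add: vps_def s_def Let_def power2_eq_square power3_eq_cube field_simps)
qed

text \<open>The value is the positive root of 6 s^2 = 1 + 2 s, the critical point of s + s^2 - 2
  s^3.\<close>

lemma t0_powr: "t0 l \<ge> 1" "t0 l powr (- l) = (sqrt 7 + 1) / 6"
proof -
  have s7: "sqrt 7 > 2" by (rule real_less_rsqrt) simp
  show "t0 l \<ge> 1" unfolding t0_def using s7 l by (intro ge_one_powr_ge_zero) auto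
  have "t0 l powr (- l) = inverse (sqrt 7 - 1)" unfolding t0_def powr_powr using l s7
    by (simp add: powr_minus)
  also have "\<dots> = (sqrt 7 + 1) / 6"
    using s7 by (simp add: field_simps)
  finally show "t0 l powr (- l) = (sqrt 7 + 1) / 6" .
qed

lemma vps_le: assumes "t \<ge> 1" shows "vps t \<le> vps (t0 l)"
proof -
  define s where "s = t powr (- l)"
  define r where "r = (sqrt 7 + 1) / 6"
  have s: "s > 0" using assms l by (auto simp: s_def)
  have s7: "sqrt 7 > 2" by (rule real_less_rsqrt) simp
  have r: "r > 1/2" "6 * r^2 = 1 + 2 * r" using s7 by (auto simp: r_def power2_eq_square field_simps)
  have r3: "6 * (r * r^2) = r + 2 * r^2" 
  proof -
    have "6 * (r * r^2) = r * (6 * r^2)" by simp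
    also have "\<dots> = r + 2 * r^2" unfolding r(2) by (simp add: power2_eq_square algebra_simps)
    finally show ?thesis .
  qed
  \<comment> \<open>A critical point is a double root of the difference, which leaves one linear
    factor, positive because \<open>r > 1/2\<close>.\<close>
  have "(r + r^2 - 2 * r^3) - (s + s^2 - 2 * s^3) = (s - r)^2 * (2 * s + 4 * r - 1)"
  proof -
    have "(r + r^2 - 2 * r^3) - (s + s^2 - 2 * s^3) - (s - r)^2 * (2 * s + 4 * r - 1)
       = (r + 2 * r^2 - 6 * (r * r^2)) - s * (1 + 2 * r - 6 * r^2)"
      by (simp add: power2_eq_square power3_eq_cube algebra_simps)
    then show ?thesis using r(2) r3 by simp
  qed
  also have "\<dots> \<ge> 0" using s r by (intro mult_nonneg_nonneg) auto
  finally show ?thesis unfolding vps_def t0_powr Let_def s_def[symmetric] r_def[symmetric] by simp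
qed

lemma vps_t0_pos: "vps (t0 l) > 0"
proof -
  have s7: "sqrt 7 > 2" "sqrt 7 < 3" by (auto intro: real_less_rsqrt real_less_lsqrt)
  define r where "r = (sqrt 7 + 1) / 6"
  have r: "r > 0" "r < 1" using s7 by (auto simp: r_def)
  have "r + r^2 - 2 * r^3 = r * (1 - r) * (1 + 2 * r)" by (simp add: power2_eq_square power3_eq_cube algebra_simps)
  also have "\<dots> > 0" using r by (intro mult_pos_pos) auto
  finally show ?thesis unfolding vps_def t0_powr Let_def r_def[symmetric] by simp
qed

end

section \<open>The limit functional and its continuity in Kolmogorov distance\<close>

lemma abs_SUP_diff_le:
  fixes f g :: "'a \<Rightarrow> real"
  assumes ne: "A \<noteq> {}" and f: "\<And>t. t \<in> A \<Longrightarrow> \<bar>f t\<bar> \<le> K" and g: "\<And>t. t \<in> A \<Longrightarrow> \<bar>g t\<bar> \<le> K"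
    and fg: "\<And>t. t \<in> A \<Longrightarrow> \<bar>f t - g t\<bar> \<le> c"
  shows "\<bar>(SUP t\<in>A. \<bar>f t\<bar>) - (SUP t\<in>A. \<bar>g t\<bar>)\<bar> \<le> c"
proof -
  have bf: "bdd_above ((\<lambda>t. \<bar>f t\<bar>) ` A)" and bg: "bdd_above ((\<lambda>t. \<bar>g t\<bar>) ` A)"
    using f g by (auto intro!: bdd_aboveI2)
  have "(SUP t\<in>A. \<bar>f t\<bar>) \<le> (SUP t\<in>A. \<bar>g t\<bar>) + c"
  proof (rule cSUP_least[OF ne])
    fix t assume t: "t \<in> A"
    have "\<bar>g t\<bar> \<le> (SUP t\<in>A. \<bar>g t\<bar>)" by (rule cSUP_upper[OF t bg])
    then show "\<bar>f t\<bar> \<le> (SUP t\<in>A. \<bar>g t\<bar>) + c" using fg[OF t] by linarith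
  qed
  moreover have "(SUP t\<in>A. \<bar>g t\<bar>) \<le> (SUP t\<in>A. \<bar>f t\<bar>) + c"
  proof (rule cSUP_least[OF ne])
    fix t assume t: "t \<in> A"
    have "\<bar>f t\<bar> \<le> (SUP t\<in>A. \<bar>f t\<bar>)" by (rule cSUP_upper[OF t bf])
    then show "\<bar>g t\<bar> \<le> (SUP t\<in>A. \<bar>f t\<bar>) + c" using fg[OF t] by linarith
  qed
  ultimately show ?thesis by linarith
qed

text \<open>Common frame for Pareto, tilted and empirical laws. Positivity is what makes the
  relation \<open>y \<in> win t x\<close> symmetric almost everywhere.\<close>

definition pos_law :: "real measure \<Rightarrow> bool" where
  "pos_law M \<longleftrightarrow> prob_space M \<and> sets M = sets borel \<and> (AE x in M. 0 < x)"

lemma pos_lawD: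
  assumes "pos_law M"
  shows "prob_space M" "sets M = sets borel" "AE x in M. 0 < x" "sigma_finite_measure M"
    "finite_measure M" "space M = UNIV"
  using assms unfolding pos_law_def
  by (auto simp: prob_space_imp_sigma_finite prob_space_def dest: sets_eq_imp_space_eq)

definition Phi :: "real measure \<Rightarrow> real \<Rightarrow> real" where
  "Phi M t = (\<integral>x. measure M (win t x) \<partial>M) - measure M {..t}"

definition Vf :: "real measure \<Rightarrow> real" where
  "Vf M = (SUP t\<in>{1..}. \<bar>Phi M t\<bar>)"

lemma integrable_measure_win:
  assumes "pos_law M" "pos_law N" shows "integrable N (\<lambda>x. measure M (win t x))"
proof -
  note M = pos_lawD[OF assms(1)] and N = pos_lawD[OF assms(2)]
  interpret M: prob_space M by fact
  interpret N: prob_space N by fact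
  have "(\<lambda>x. measure M (win t x)) \<in> borel_measurable N"
    using measure_win_measurable[OF M(4,2)] measurable_cong_sets[OF N(2) refl] by blast
  then show ?thesis by (intro N.integrable_const_bound[of _ 1]) auto
qed

lemma integral_measure_win_bounds:
  assumes "pos_law M" "pos_law N"
  shows "0 \<le> (\<integral>x. measure M (win t x) \<partial>N)" "(\<integral>x. measure M (win t x) \<partial>N) \<le> 1"
proof -
  note M = pos_lawD[OF assms(1)] and N = pos_lawD[OF assms(2)]
  interpret M: prob_space M by fact
  interpret N: prob_space N by fact
  have "(\<integral>x. measure M (win t x) \<partial>N) \<le> (\<integral>x. 1 \<partial>N)"
    by (intro integral_mono integrable_measure_win assms) auto
  then show "(\<integral>x. measure M (win t x) \<partial>N) \<le> 1" by (simp add: N.prob_space)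
qed auto

lemma abs_Phi_le_1: assumes "pos_law M" shows "\<bar>Phi M t\<bar> \<le> 1"
proof -
  interpret M: prob_space M using pos_lawD[OF assms] by simp
  have "0 \<le> M.prob {..t}" "M.prob {..t} \<le> 1" by auto
  with integral_measure_win_bounds[OF assms assms, of t] show ?thesis unfolding Phi_def by linarith
qed

lemma abs_Phi_le_Vf: "pos_law M \<Longrightarrow> 1 \<le> t \<Longrightarrow> \<bar>Phi M t\<bar> \<le> Vf M"
  unfolding Vf_def using abs_Phi_le_1 by (intro cSUP_upper) (auto intro!: bdd_aboveI2)

lemma Vf_le: "(\<And>t. 1 \<le> t \<Longrightarrow> \<bar>Phi M t\<bar> \<le> c) \<Longrightarrow> Vf M \<le> c"
  unfolding Vf_def by (intro cSUP_least) auto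

lemma win_commute: "t > 0 \<Longrightarrow> x > 0 \<Longrightarrow> y > 0 \<Longrightarrow> y \<in> win t x \<longleftrightarrow> x \<in> win t y"
  unfolding win_def by (auto simp: divide_le_eq mult_ac)

text \<open>Fubini together with \<open>win_commute\<close>; both sides are the mass of the pairs
  with ratios at most \<open>t\<close> under the product law.\<close>

lemma integral_measure_win_commute:
  assumes "pos_law M" "pos_law N" "t > 0"
  shows "(\<integral>x. measure M (win t x) \<partial>N) = (\<integral>x. measure N (win t x) \<partial>M)"
proof -
  note M = pos_lawD[OF assms(1)] and N = pos_lawD[OF assms(2)]
  interpret M: prob_space M by fact
  interpret N: prob_space N by fact
  interpret pair_sigma_finite N M ..
  interpret NM: pair_prob_space N M ..
  have [measurable_cong]: "sets M = sets borel" "sets N = sets borel" using M N by auto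
  define f where "f x y = (indicator {z :: real \<times> real. fst z / t \<le> snd z \<and> snd z \<le> t * fst z} (x, y) :: real)" for x y
  have f: "f x y = indicator (win t x) y" for x y by (auto simp: f_def win_def indicator_def)
  have "integrable (N \<Otimes>\<^sub>M M) (case_prod f)"
  proof (rule NM.integrable_const_bound[of _ 1])
    have "{z \<in> space (borel \<Otimes>\<^sub>M borel :: (real \<times> real) measure). fst z / t \<le> snd z \<and> snd z \<le> t * fst z} \<in> sets (borel \<Otimes>\<^sub>M borel)"
      by measurable
    moreover have "sets (N \<Otimes>\<^sub>M M) = sets (borel \<Otimes>\<^sub>M (borel :: real measure))"
      by (intro sets_pair_measure_cong M N)
    ultimately show "case_prod f \<in> borel_measurable (N \<Otimes>\<^sub>M M)"
      unfolding f_def by (simp add: space_pair_measure)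
  qed (auto simp: f_def)
  from Fubini_integral[OF this]
  have "(\<integral>y. (\<integral>x. f x y \<partial>N) \<partial>M) = (\<integral>x. (\<integral>y. f x y \<partial>M) \<partial>N)" .
  also have "(\<integral>x. (\<integral>y. f x y \<partial>M) \<partial>N) = (\<integral>x. measure M (win t x) \<partial>N)"
    unfolding f using M(6) by simp
  also have "(\<integral>y. (\<integral>x. f x y \<partial>N) \<partial>M) = (\<integral>y. measure N (win t y) \<partial>M)"
  proof (rule integral_cong_AE)
    have *: "AE y in M. 0 < y" "AE x in N. 0 < x" using M N by auto
    show "AE y in M. (\<integral>x. f x y \<partial>N) = measure N (win t y)"
      using *(1)
    proof eventually_elim
      case (elim y)
      have "(\<integral>x. f x y \<partial>N) = (\<integral>x. indicator (win t y) x \<partial>N)"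
      proof (rule integral_cong_AE)
        show "AE x in N. f x y = indicator (win t y) x"
          using *(2) by eventually_elim (use elim assms(3) win_commute[of t] in \<open>auto simp: f indicator_def\<close>)
        show "(\<lambda>x. f x y) \<in> borel_measurable N" unfolding f_def by measurable
      qed (use N in measurable)
      then show ?case using N(6) by simp
    qed
    show "(\<lambda>x. measure N (win t x)) \<in> borel_measurable M"
      by (rule borel_measurable_integrable[OF integrable_measure_win[OF assms(2,1)]])
    have "{z \<in> space (borel \<Otimes>\<^sub>M borel :: (real \<times> real) measure). fst z / t \<le> snd z \<and> snd z \<le> t * fst z} \<in> sets (borel \<Otimes>\<^sub>M borel)"
      by measurable
    then show "(\<lambda>y. \<integral>x. f x y \<partial>N) \<in> borel_measurable M" 
      unfolding f_def by (simp add: space_pair_measure) measurable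
  qed
  finally show ?thesis by simp
qed

definition kclose :: "real \<Rightarrow> real measure \<Rightarrow> real measure \<Rightarrow> bool" where
  "kclose k M N \<longleftrightarrow> (\<forall>a. \<bar>measure M {..a} - measure N {..a}\<bar> \<le> k)"

text \<open>The window is closed at its lower end, so its mass involves the strict distribution
  function, a left limit of the ordinary one.\<close>

lemma kclose_lessThan:
  assumes "pos_law M" "pos_law N" "kclose k M N"
  shows "\<bar>measure M {..<a} - measure N {..<a}\<bar> \<le> k"
proof -
  note M = pos_lawD[OF assms(1)] and N = pos_lawD[OF assms(2)]
  interpret M: finite_borel_measure M using M by (simp add: finite_borel_measure_def finite_borel_measure_axioms_def)
  interpret N: finite_borel_measure N using N by (simp add: finite_borel_measure_def finite_borel_measure_axioms_def)
  have "((\<lambda>x. \<bar>cdf M x - cdf N x\<bar>) \<longlongrightarrow> \<bar>measure M {..<a} - measure N {..<a}\<bar>) (at_left a)"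
    by (intro tendsto_rabs tendsto_diff M.cdf_at_left N.cdf_at_left)
  then show ?thesis
    by (rule tendsto_upperbound) (use assms(3) in \<open>auto simp: cdf_def kclose_def\<close>)
qed

lemma kclose_win:
  assumes "pos_law M" "pos_law N" "kclose k M N"
  shows "\<bar>measure M (win t x) - measure N (win t x)\<bar> \<le> 2 * k"
proof -
  note M = pos_lawD[OF assms(1)] and N = pos_lawD[OF assms(2)]
  have k: "0 \<le> k" using assms(3) unfolding kclose_def by (metis abs_ge_zero order_trans)
  show ?thesis
  proof (cases "x / t \<le> t * x")
    case True
    have w: "win t x = {..t * x} - {..<x / t}" by (auto simp: win_def)
    have sub: "{..<x / t} \<subseteq> {..t * x}" using True by auto
    have "measure M (win t x) = measure M {..t * x} - measure M {..<x / t}" unfolding w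
      by (rule finite_measure.finite_measure_Diff[OF M(5) _ _ sub]) (auto simp: M)
    moreover have "measure N (win t x) = measure N {..t * x} - measure N {..<x / t}" unfolding w
      by (rule finite_measure.finite_measure_Diff[OF N(5) _ _ sub]) (auto simp: N)
    moreover have "\<bar>measure M {..t * x} - measure N {..t * x}\<bar> \<le> k" using assms(3) by (auto simp: kclose_def)
    ultimately show ?thesis using kclose_lessThan[OF assms, of "x / t"] by linarith
  next
    case False
    then have "win t x = {}" by (auto simp: win_def)
    then show ?thesis using k by simp
  qed
qed

lemma kclose_integral_measure_win:
  assumes "pos_law M" "pos_law N" "kclose k M N" "pos_law L"
  shows "\<bar>(\<integral>x. measure M (win t x) \<partial>L) - (\<integral>x. measure N (win t x) \<partial>L)\<bar> \<le> 2 * k"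
proof -
  interpret prob_space L using pos_lawD[OF assms(4)] by simp
  have "\<bar>(\<integral>x. measure M (win t x) \<partial>L) - (\<integral>x. measure N (win t x) \<partial>L)\<bar>
     = \<bar>\<integral>x. measure M (win t x) - measure N (win t x) \<partial>L\<bar>"
    by (subst Bochner_Integration.integral_diff) (auto intro!: integrable_measure_win assms)
  also have "\<dots> \<le> (\<integral>x. \<bar>measure M (win t x) - measure N (win t x)\<bar> \<partial>L)"
    by (rule integral_abs_bound)
  also have "\<dots> \<le> (\<integral>x. 2 * k \<partial>L)"
    by (intro integral_mono integrable_abs Bochner_Integration.integrable_diff integrable_measure_win assms kclose_win) auto
  finally show ?thesis by (simp add: prob_space)
qed

text \<open>The measure is replaced in one argument at a time, with the symmetry of the window
  integral in between: 2 k for each replacement, and k for the distribution function.\<close>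

lemma kclose_Phi:
  assumes "pos_law M" "pos_law N" "kclose k M N" "t > 0"
  shows "\<bar>Phi M t - Phi N t\<bar> \<le> 5 * k"
proof -
  have "\<bar>measure M {..t} - measure N {..t}\<bar> \<le> k" using assms(3) by (auto simp: kclose_def)
  with kclose_integral_measure_win[OF assms(1-3,1), of t]
    kclose_integral_measure_win[OF assms(1-3,2), of t] integral_measure_win_commute[OF assms(1,2,4)]
  show ?thesis unfolding Phi_def by linarith
qed

lemma kclose_Vf:
  assumes "pos_law M" "pos_law N" "kclose k M N"
  shows "\<bar>Vf M - Vf N\<bar> \<le> 5 * k"
  unfolding Vf_def
  by (rule abs_SUP_diff_le[where K=1]) (auto intro!: abs_Phi_le_1 kclose_Phi assms)

section \<open>Empirical measures\<close>

definition emp :: "nat \<Rightarrow> (nat \<Rightarrow> real) \<Rightarrow> real measure" where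
  "emp n x = distr (uniform_count_measure {..<n}) borel x"

lemma measurable_uniform_count_measure: "x \<in> uniform_count_measure A \<rightarrow>\<^sub>M borel"
  by (auto simp: measurable_def sets_uniform_count_measure space_uniform_count_measure)

lemma measure_emp:
  "A \<in> sets borel \<Longrightarrow> measure (emp n x) A = real (card {i. i < n \<and> x i \<in> A}) / real n"
  unfolding emp_def
  by (subst measure_distr[OF measurable_uniform_count_measure])
     (auto simp: space_uniform_count_measure measure_uniform_count_measure_if vimage_def Int_def conj_commute subset_eq)

lemma integral_emp:
  "f \<in> borel_measurable borel \<Longrightarrow> (\<integral>y. f y \<partial>emp n x) = (\<Sum>i<n. f (x i)) / real n"
  unfolding emp_def
  by (subst integral_distr[OF measurable_uniform_count_measure]) (auto simp: integral_uniform_count_measure)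

lemma pos_law_emp:
  assumes "n > 0" "\<And>i. i < n \<Longrightarrow> x i > 0" shows "pos_law (emp n x)"
proof -
  interpret prob_space "uniform_count_measure {..<n}"
    using assms(1) by (intro prob_space_uniform_count_measure) auto
  have "prob_space (emp n x)"
    unfolding emp_def by (rule prob_space_distr[OF measurable_uniform_count_measure])
  moreover have "AE y in emp n x. 0 < y"
    unfolding emp_def
    by (subst AE_distr_iff[OF measurable_uniform_count_measure])
       (use assms in \<open>auto intro!: AE_I2 simp: space_uniform_count_measure\<close>)
  moreover have "sets (emp n x) = sets borel" by (simp add: emp_def)
  ultimately show ?thesis by (simp add: pos_law_def)
qed

lemma Fn_eq_measure_emp: "Fn n x t = measure (emp n x) {..t}"
  by (simp add: Fn_def measure_emp)

text \<open>Double counting over ordered pairs: each unordered pair occurs twice, and the diagonal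
  adds \<open>n\<close> because \<open>t \<ge> 1\<close> puts every point in its own window.\<close>

lemma card_pairs_win:
  assumes "\<And>i. i < n \<Longrightarrow> x i > 0" "t \<ge> 1"
  shows "(\<Sum>i<n. card {j. j < n \<and> x j \<in> win t (x i)}) =
     2 * card {(i, j). i < j \<and> j < n \<and> max (x i / x j) (x j / x i) \<le> t} + n"
proof -
  let ?S = "{(i, j). i < j \<and> j < n \<and> max (x i / x j) (x j / x i) \<le> t}"
  let ?T = "{(i, j). i < n \<and> j < n \<and> x j \<in> win t (x i)}"
  have fin: "finite ?S" by (rule finite_subset[of _ "{..<n} \<times> {..<n}"]) auto
  have iff: "max (x i / x j) (x j / x i) \<le> t \<longleftrightarrow> x j \<in> win t (x i)" if "i < n" "j < n" for i j
    using assms(1)[OF that(1)] assms(1)[OF that(2)] assms(2)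
    by (auto simp: win_def divide_le_eq mult_ac)
  have comm: "x j \<in> win t (x i) \<longleftrightarrow> x i \<in> win t (x j)" if "i < n" "j < n" for i j
    using assms that by (intro win_commute) auto
  have diag: "x i \<in> win t (x i)" if "i < n" for i
  proof -
    have "x i * 1 \<le> x i * t" using assms(1)[OF that] assms(2) by (intro mult_left_mono) auto
    then show ?thesis using assms(2) by (auto simp: win_def divide_le_eq mult_ac)
  qed
  have T: "?T = ?S \<union> (prod.swap ` ?S \<union> (\<lambda>i. (i, i)) ` {..<n})"
  proof (rule set_eqI, clarify)
    fix i j
    show "(i, j) \<in> ?T \<longleftrightarrow> (i, j) \<in> ?S \<union> (prod.swap ` ?S \<union> (\<lambda>i. (i, i)) ` {..<n})"
    proof (cases i j rule: linorder_cases)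
      case less
      then show ?thesis using iff[of i j] by (auto simp: image_iff)
    next
      case equal
      then show ?thesis using diag[of i] by (auto simp: image_iff)
    next
      case greater
      then show ?thesis using iff[of j i] comm[of i j] by (auto simp: image_iff)
    qed
  qed
  have "card ?T = card ?S + (card (prod.swap ` ?S) + card ((\<lambda>i. (i, i)) ` {..<n}))"
    unfolding T using fin by (subst card_Un_disjoint; (subst card_Un_disjoint)?) auto
  also have "card (prod.swap ` ?S) = card ?S" by (intro card_image inj_onI) auto
  also have "card ((\<lambda>i. (i, i)) ` {..<n}) = n" by (subst card_image) (auto simp: inj_on_def)
  also have "card ?T = (\<Sum>i<n. card {j. j < n \<and> x j \<in> win t (x i)})"
  proof -
    have "?T = (SIGMA i : {..<n}. {j. j < n \<and> x j \<in> win t (x i)})" by auto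
    then show ?thesis by (simp add: card_SigmaI)
  qed
  finally show ?thesis by simp
qed

lemma Mn_eq: "n \<ge> 2 \<Longrightarrow> Mn n x t = 2 * real (card {(i, j). i < j \<and> j < n \<and> max (x i / x j) (x j / x i) \<le> t}) / (real n * (real n - 1))"
  by (simp add: Mn_def choose_two real_of_nat_div of_nat_diff)

lemma Mn_bounds: "0 \<le> Mn n x t" "Mn n x t \<le> 1"
proof -
  show "0 \<le> Mn n x t" by (simp add: Mn_def)
  let ?S = "{(i, j). i < j \<and> j < n \<and> max (x i / x j) (x j / x i) \<le> t}"
  have fin: "finite ?S" by (rule finite_subset[of _ "{..<n} \<times> {..<n}"]) auto
  have "card ?S \<le> card {A. A \<subseteq> {..<n} \<and> card A = 2}"
  proof (rule card_inj_on_le[where f="\<lambda>(i, j). {i, j}"])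
    show "inj_on (\<lambda>(i, j). {i, j}) ?S" by (auto simp: inj_on_def doubleton_eq_iff)
    show "(\<lambda>(i, j). {i, j}) ` ?S \<subseteq> {A. A \<subseteq> {..<n} \<and> card A = 2}" by (auto simp: card_insert_if)
  qed auto
  also have "\<dots> = n choose 2" by (simp add: n_subsets)
  finally show "Mn n x t \<le> 1" by (cases "n choose 2 = 0") (auto simp: Mn_def divide_le_eq)
qed

lemma Fn_bounds: "0 \<le> Fn n x t" "Fn n x t \<le> 1"
proof -
  have "card {i. i < n \<and> x i \<le> t} \<le> card {..<n}" by (intro card_mono) auto
  then show "0 \<le> Fn n x t" "Fn n x t \<le> 1"
    by (cases "n = 0"; auto simp: Fn_def divide_le_eq)+
qed

lemma abs_Mn_Fn_le: "\<bar>Mn n x t - Fn n x t\<bar> \<le> 1"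
  using Mn_bounds[of n x t] Fn_bounds[of n x t] by linarith

text \<open>The integral is the V-statistic belonging to the U-statistic \<open>Mn\<close>; the
  diagonal makes it equal to \<open>m + (1 - m) / n\<close> with \<open>m\<close> in [0, 1].\<close>

lemma Mn_emp:
  assumes n: "n \<ge> 2" and pos: "\<And>i. i < n \<Longrightarrow> x i > 0" and t: "t \<ge> 1"
  shows "\<bar>Mn n x t - (\<integral>y. measure (emp n x) (win t y) \<partial>emp n x)\<bar> \<le> 1 / n"
proof -
  let ?S = "{(i, j). i < j \<and> j < n \<and> max (x i / x j) (x j / x i) \<le> t}"
  define m where "m = Mn n x t"
  have "pos_law (emp n x)" using n pos by (intro pos_law_emp) auto
  then have "(\<integral>y. measure (emp n x) (win t y) \<partial>emp n x) = (\<Sum>i<n. measure (emp n x) (win t (x i))) / n"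
    by (intro integral_emp measure_win_measurable pos_lawD)
  also have "\<dots> = real (\<Sum>i<n. card {j. j < n \<and> x j \<in> win t (x i)}) / n / n"
    by (simp add: measure_emp sum_divide_distrib)
  also have "\<dots> = (2 * real (card ?S) + real n) / n / n"
    by (subst card_pairs_win[OF pos t]) auto
  also have "2 * real (card ?S) = m * (real n * (real n - 1))"
    using n by (simp add: m_def Mn_eq)
  also have "(m * (real n * (real n - 1)) + real n) / n / n = m + (1 - m) / n"
    using n by (simp add: field_simps)
  finally show ?thesis using Mn_bounds[of n x t] n unfolding m_def[symmetric]
    by (simp add: divide_right_mono)
qed

lemma Vn_emp:
  assumes n: "n \<ge> 2" and pos: "\<And>i. i < n \<Longrightarrow> x i > 0"
  shows "\<bar>Vn n x - Vf (emp n x)\<bar> \<le> 1 / n"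
proof -
  have "pos_law (emp n x)" using n pos by (intro pos_law_emp) auto
  note 1 = abs_Phi_le_1[OF this]
  have "\<bar>Mn n x t - Fn n x t - Phi (emp n x) t\<bar> \<le> 1 / n" if "t \<ge> 1" for t
    using Mn_emp[of n x, OF n pos that] by (simp add: Phi_def Fn_eq_measure_emp)
  then show ?thesis
    unfolding Vn_def Vf_def
    by (intro abs_SUP_diff_le[where K=1] 1 abs_Mn_Fn_le) auto
qed

lemma Vn_kclose:
  assumes n: "n \<ge> 2" and pos: "\<And>i. i < n \<Longrightarrow> x i > 0"
    and M: "pos_law M" "kclose k (emp n x) M"
  shows "\<bar>Vn n x - Vf M\<bar> \<le> 5 * k + 1 / n"
proof -
  have "pos_law (emp n x)" using n pos by (intro pos_law_emp) auto
  from kclose_Vf[OF this M] Vn_emp[of n x, OF n pos] show ?thesis by linarith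
qed

text \<open>The statistics are right-continuous step functions of \<open>t\<close>, so the supremum is attained along rational \<open>t\<close>.\<close>

lemma Vn_rat: "Vn n x = (SUP t\<in>{1..} \<inter> \<rat>. \<bar>Mn n x t - Fn n x t\<bar>)"
proof -
  have "(\<lambda>t. \<bar>Mn n x t - Fn n x t\<bar>) ` {1..} = (\<lambda>t. \<bar>Mn n x t - Fn n x t\<bar>) ` ({1..} \<inter> \<rat>)"
  proof (intro equalityI subsetI)
    fix v assume "v \<in> (\<lambda>t. \<bar>Mn n x t - Fn n x t\<bar>) ` {1..}"
    then obtain t where t: "t \<ge> 1" and v: "v = \<bar>Mn n x t - Fn n x t\<bar>" by auto
    \<comment> \<open>The finitely many jump points to the right of \<open>t\<close>; up to the
      first of them nothing changes, so a rational in between gives the same value.\<close>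
    define E where "E = (x ` {..<n} \<union> (\<lambda>(i, j). max (x i / x j) (x j / x i)) ` ({..<n} \<times> {..<n})) \<inter> {t<..}"
    have fin: "finite E" unfolding E_def by auto
    obtain u where u: "t < u" "\<And>e. e \<in> E \<Longrightarrow> u \<le> e"
    proof (cases "E = {}")
      case True then show ?thesis using that[of "t + 1"] by auto
    next
      case False
      then show ?thesis using that[of "Min E"] Min_in[OF fin] Min_le[OF fin] by (auto simp: E_def)
    qed
    obtain q where q: "q \<in> \<rat>" "t < q" "q < u" using Rats_dense_in_real[OF u(1)] by auto
    have 1: "x i \<le> t \<longleftrightarrow> x i \<le> q" if "i < n" for i
      using u(2)[of "x i"] that q by (force simp: E_def)
    have 2: "max (x i / x j) (x j / x i) \<le> t \<longleftrightarrow> max (x i / x j) (x j / x i) \<le> q" if "i < n" "j < n" for i j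
    proof -
      have "max (x i / x j) (x j / x i) > t \<Longrightarrow> max (x i / x j) (x j / x i) \<in> E"
        unfolding E_def using that by (intro IntI UnI2 image_eqI[of _ _ "(i, j)"]) auto
      then show ?thesis using u(2) q by force
    qed
    have "Fn n x t = Fn n x q" unfolding Fn_def using 1 by (metis (lifting))
    moreover have "{(i, j). i < j \<and> j < n \<and> max (x i / x j) (x j / x i) \<le> t} = 
        {(i, j). i < j \<and> j < n \<and> max (x i / x j) (x j / x i) \<le> q}"
      using 2 by (intro Collect_cong) (auto simp del: max.bounded_iff)
    then have "Mn n x t = Mn n x q" unfolding Mn_def by simp
    ultimately show "v \<in> (\<lambda>t. \<bar>Mn n x t - Fn n x t\<bar>) ` ({1..} \<inter> \<rat>)"
      using v q t by (intro image_eqI[of _ _ q]) auto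
  qed auto
  then show ?thesis unfolding Vn_def by simp
qed

lemma Fn_sum: "Fn n x t = (\<Sum>i<n. indicator {..t} (x i)) / n"
proof -
  have "real (card {i. i < n \<and> x i \<le> t}) = (\<Sum>i\<in>{i. i < n \<and> x i \<le> t}. 1)" by simp
  also have "\<dots> = (\<Sum>i<n. indicator {..t} (x i))"
    by (rule sum.mono_neutral_cong_left) (auto simp: indicator_def)
  finally show ?thesis by (simp add: Fn_def)
qed

lemma Mn_sum: "Mn n x t = (\<Sum>i<n. \<Sum>j<n. if i < j \<and> max (x i / x j) (x j / x i) \<le> t then 1 else 0) / real (n choose 2)"
proof -
  have "(\<Sum>i<n. \<Sum>j<n. if i < j \<and> max (x i / x j) (x j / x i) \<le> t then 1 else 0 :: real)
     = (\<Sum>p\<in>{..<n} \<times> {..<n}. if fst p < snd p \<and> max (x (fst p) / x (snd p)) (x (snd p) / x (fst p)) \<le> t then 1 else 0)"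
    by (simp add: sum.cartesian_product split_beta)
  also have "\<dots> = (\<Sum>p\<in>{(i, j). i < j \<and> j < n \<and> max (x i / x j) (x j / x i) \<le> t}. 1)"
    by (rule sum.mono_neutral_cong_right) auto
  finally show ?thesis by (simp add: Mn_def)
qed

text \<open>By \<open>Vn_rat\<close> the supremum is over a countable set, and for fixed
  \<open>t\<close> the statistics are finite sums of measurable indicators.\<close>

lemma Vn_measurable [measurable]:
  assumes "\<And>i. i < n \<Longrightarrow> sets (M i) = sets borel"
  shows "Vn n \<in> borel_measurable (PiM {..<n} M)"
proof -
  have *: "(\<lambda>x. x i) \<in> borel_measurable (PiM {..<n} M)" if "i < n" for i
  proof -
    have "(\<lambda>x. x i) \<in> PiM {..<n} M \<rightarrow>\<^sub>M M i"
      using that by (intro measurable_component_singleton) auto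
    then show ?thesis using measurable_cong_sets[OF refl assms[OF that]] by blast
  qed
  have "(\<lambda>x. SUP t\<in>{1..} \<inter> \<rat>. \<bar>Mn n x t - Fn n x t\<bar>) \<in> borel_measurable (PiM {..<n} M)"
  proof (rule borel_measurable_cSUP)
    show "countable ({1..} \<inter> \<rat> :: real set)" using countable_rat by auto
    show "bdd_above ((\<lambda>t. \<bar>Mn n x t - Fn n x t\<bar>) ` ({1..} \<inter> \<rat>))" for x
      using abs_Mn_Fn_le by (intro bdd_aboveI2)
    show "(\<lambda>x. \<bar>Mn n x t - Fn n x t\<bar>) \<in> borel_measurable (PiM {..<n} M)" for t
    proof -
      have 1: "(\<lambda>x. indicator {..t} (x i) :: real) \<in> borel_measurable (PiM {..<n} M)" if "i < n" for i
      proof -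
        note [measurable] = *[OF that]
        show ?thesis by measurable
      qed
      have 2: "(\<lambda>x. if i < j \<and> max (x i / x j) (x j / x i) \<le> t then 1 else 0 :: real) \<in> borel_measurable (PiM {..<n} M)"
        if "i < n" "j < n" for i j
      proof -
        note [measurable] = *[OF that(1)] *[OF that(2)]
        show ?thesis by measurable
      qed
      show ?thesis unfolding Fn_sum Mn_sum
        by (intro borel_measurable_abs borel_measurable_diff borel_measurable_divide borel_measurable_sum
            borel_measurable_const 1 2) simp_all
    qed
  qed
  then show ?thesis unfolding Vn_rat[abs_def] .
qed

section \<open>Consistency of the statistic\<close>

abbreviation iid :: "'a measure \<Rightarrow> nat \<Rightarrow> (nat \<Rightarrow> 'a) measure" where
  "iid M n \<equiv> PiM {..<n} (\<lambda>_. M)"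

lemma prob_space_iid: "prob_space M \<Longrightarrow> prob_space (iid M n)"
  by (rule prob_space_PiM)

lemma AE_iid:
  assumes "prob_space M" "AE x in M. P x" shows "AE x in iid M n. \<forall>i<n. P (x i)"
proof -
  have "AE x in iid M n. \<forall>i\<in>{..<n}. P (x i)"
    using assms by (intro AE_finite_allI AE_PiM_component) auto
  then show ?thesis by (rule eventually_mono) auto
qed

lemma iid_second_moment:
  fixes g :: "'a \<Rightarrow> real"
  assumes M: "prob_space M" and g [measurable]: "g \<in> borel_measurable M"
    and g2: "integrable M (\<lambda>x. (g x)^2)" and g0: "(\<integral>x. g x \<partial>M) = 0"
  shows "integrable (iid M n) (\<lambda>x. (\<Sum>i<n. g (x i))^2)"
    "(\<integral>x. (\<Sum>i<n. g (x i))^2 \<partial>iid M n) = n * (\<integral>x. (g x)^2 \<partial>M)"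
proof -
  interpret prob_space M by fact
  interpret product_sigma_finite "\<lambda>_::nat. M" by standard
  have g1: "integrable M g" using square_integrable_imp_integrable[OF g g2] .
  \<comment> \<open>Writes \<open>g (x i) * g (x j)\<close> as a product over all coordinates
    \<open>k\<close>. The two separate factors give the square when \<open>i = j\<close>, so one
    product formula covers diagonal and off-diagonal terms.\<close>
  define f where "f i j k = (\<lambda>y. (if k = i then g y else 1) * (if k = j then g y else 1))" for i j k :: nat
  have f: "integrable M (f i j k)" for i j k
    using g1 g2 by (cases "k = i"; cases "k = j"; simp add: f_def power2_eq_square)
  have prod: "(\<Prod>k<n. f i j k (x k)) = g (x i) * g (x j)" if "i < n" "j < n" for i j and x :: "nat \<Rightarrow> 'a"
    using that by (simp add: f_def prod.distrib prod.delta)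
  have int: "integrable (iid M n) (\<lambda>x. g (x i) * g (x j))" if "i < n" "j < n" for i j
    using product_integrable_prod[of "{..<n}" "f i j"] f prod[OF that] by simp
  have val: "(\<integral>x. g (x i) * g (x j) \<partial>iid M n) = (if i = j then (\<integral>x. (g x)^2 \<partial>M) else 0)" if "i < n" "j < n" for i j
  proof -
    have *: "(\<integral>x. g (x i) * g (x j) \<partial>iid M n) = (\<Prod>k<n. integral\<^sup>L M (f i j k))"
      using product_integral_prod[of "{..<n}" "f i j"] f prod[OF that] by simp
    show ?thesis
    proof (cases "i = j")
      case True
      have "(\<Prod>k<n. integral\<^sup>L M (f i j k)) = (\<Prod>k<n. if k = i then (\<integral>x. (g x)^2 \<partial>M) else 1)"
        using True by (intro prod.cong) (auto simp: f_def power2_eq_square prob_space)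
      then show ?thesis using * True that by (simp add: prod.delta)
    next
      case False
      have "integral\<^sup>L M (f i j i) = 0" using False g0 by (simp add: f_def)
      then have "(\<Prod>k<n. integral\<^sup>L M (f i j k)) = 0" using that by (intro prod_zero) auto
      then show ?thesis using * False by simp
    qed
  qed
  have sq: "(\<Sum>i<n. g (x i))^2 = (\<Sum>i<n. \<Sum>j<n. g (x i) * g (x j))" for x :: "nat \<Rightarrow> 'a"
    by (simp add: power2_eq_square sum_product)
  show "integrable (iid M n) (\<lambda>x. (\<Sum>i<n. g (x i))^2)"
    unfolding sq by (intro Bochner_Integration.integrable_sum int) auto
  have "(\<integral>x. (\<Sum>i<n. g (x i))^2 \<partial>iid M n) = (\<Sum>i<n. \<integral>x. (\<Sum>j<n. g (x i) * g (x j)) \<partial>iid M n)"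
    unfolding sq by (rule Bochner_Integration.integral_sum) (rule Bochner_Integration.integrable_sum, rule int, simp_all)
  also have "\<dots> = (\<Sum>i<n. \<Sum>j<n. \<integral>x. g (x i) * g (x j) \<partial>iid M n)"
    by (rule sum.cong[OF refl], rule Bochner_Integration.integral_sum, rule int) simp_all
  also have "\<dots> = (\<Sum>i<n. \<Sum>j<n. if i = j then (\<integral>x. (g x)^2 \<partial>M) else 0)"
    by (rule sum.cong[OF refl], rule sum.cong[OF refl], rule val) simp_all
  also have "\<dots> = n * (\<integral>x. (g x)^2 \<partial>M)" by (simp add: sum.delta)
  finally show "(\<integral>x. (\<Sum>i<n. g (x i))^2 \<partial>iid M n) = n * (\<integral>x. (g x)^2 \<partial>M)" .
qed

text \<open>Chebyshev's inequality with the second moment of the centred sum, which is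
  \<open>n\<close> times the variance.\<close>

lemma weak_law:
  fixes f :: "'a \<Rightarrow> real"
  assumes M: "prob_space M" and f [measurable]: "f \<in> borel_measurable M"
    and f2: "integrable M (\<lambda>x. (f x)^2)" and "e > 0"
  shows "(\<lambda>n. \<P>(x in iid M n. \<bar>(\<Sum>i<n. f (x i)) / n - (\<integral>x. f x \<partial>M)\<bar> \<ge> e)) \<longlonglongrightarrow> 0"
proof -
  interpret prob_space M by fact
  define m where "m = (\<integral>x. f x \<partial>M)"
  define g where "g x = f x - m" for x
  have f1: "integrable M f" using square_integrable_imp_integrable[OF f f2] .
  have g [measurable]: "g \<in> borel_measurable M" unfolding g_def by measurable
  have g2: "integrable M (\<lambda>x. (g x)^2)"
    unfolding g_def power2_diff using f1 f2
    by (intro Bochner_Integration.integrable_add Bochner_Integration.integrable_diff) auto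
  have g0: "(\<integral>x. g x \<partial>M) = 0" unfolding g_def using f1 by (simp add: m_def prob_space)
  define v where "v = (\<integral>x. (g x)^2 \<partial>M)"
  have bound: "\<P>(x in iid M n. \<bar>(\<Sum>i<n. f (x i)) / n - m\<bar> \<ge> e) \<le> v / e^2 / n"
    if n: "n > 0" for n
  proof -
    interpret I: prob_space "iid M n" by (rule prob_space_iid[OF M])
    have "{x \<in> space (iid M n). \<bar>(\<Sum>i<n. f (x i)) / n - m\<bar> \<ge> e} = {x \<in> space (iid M n). \<bar>\<Sum>i<n. g (x i)\<bar> \<ge> n * e}"
    proof (intro Collect_cong conj_cong refl)
      fix x :: "nat \<Rightarrow> 'a"
      have "(\<Sum>i<n. f (x i)) / n - m = (\<Sum>i<n. g (x i)) / n"
        using n by (simp add: g_def sum_subtractf diff_divide_distrib)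
      then show "(\<bar>(\<Sum>i<n. f (x i)) / n - m\<bar> \<ge> e) = (\<bar>\<Sum>i<n. g (x i)\<bar> \<ge> n * e)"
        using n by (simp add: pos_le_divide_eq mult.commute)
    qed
    also have "measure (iid M n) \<dots> \<le> (\<integral>x. (\<Sum>i<n. g (x i))^2 \<partial>iid M n) / (n * e)^2"
    proof (rule I.second_moment_method)
      show "(\<lambda>x. \<Sum>i<n. g (x i)) \<in> borel_measurable (iid M n)" by measurable
    qed (use iid_second_moment[OF M g g2 g0] n \<open>e > 0\<close> in auto)
    also have "\<dots> = v / e^2 / n" 
      unfolding iid_second_moment[OF M g g2 g0] v_def[symmetric] using n \<open>e > 0\<close> 
      by (simp add: field_simps power2_eq_square)
    finally show ?thesis .
  qed
  show ?thesis unfolding m_def[symmetric]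
  proof (rule tendsto_sandwich[of "\<lambda>_. 0"])
    show "\<forall>\<^sub>F n in sequentially. \<P>(x in iid M n. \<bar>(\<Sum>i<n. f (x i)) / n - m\<bar> \<ge> e) \<le> v / e^2 / n"
      using eventually_gt_at_top[of 0] by eventually_elim (rule bound)
    show "(\<lambda>n. v / e^2 / real n) \<longlonglongrightarrow> 0"
      using tendsto_mult[OF tendsto_const[of "v / e^2"] lim_inverse_n] by (simp add: divide_inverse)
  qed auto
qed

lemma Fn_mono: "a \<le> b \<Longrightarrow> Fn n x a \<le> Fn n x b"
  unfolding Fn_def by (intro mult_left_mono) (auto intro!: card_mono)

text \<open>On a grid of quantiles, pointwise closeness of two distribution functions is uniform closeness.\<close>

lemma quantile_grid:
  assumes M: "real_distribution M" and atomless: "\<And>x. measure M {x} = 0" and k: "k > 0"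
  obtains A :: "real set" and \<delta> where "finite A" "\<delta> > 0"
    "\<And>n x. (\<And>a. a \<in> A \<Longrightarrow> \<bar>Fn n x a - measure M {..a}\<bar> < \<delta>) \<Longrightarrow> kclose k (emp n x) M"
proof -
  interpret real_distribution M by fact
  \<comment> \<open>An error of 3 / N is what the grid argument loses: one unit from the pointwise
    closeness and up to two from rounding to a quantile.\<close>
  obtain N :: nat where N: "N > 0" "3 / N < k"
  proof -
    obtain N :: nat where N: "3 / k < N" using reals_Archimedean2 by blast
    moreover have "0 < 3 / k" using k by simp
    ultimately have "0 < real N" by linarith
    then show ?thesis using that[of N] N k by (simp add: field_simps)
  qed
  have cont: "isCont (cdf M) x" for x using atomless by (simp add: isCont_cdf)
  \<comment> \<open>Exact quantiles exist because the distribution function of an atomless law is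
    continuous.\<close>
  have "\<exists>a. cdf M a = real j / N" if "0 < j" "j < N" for j
  proof -
    have y: "0 < real j / N" "real j / N < 1" using that N by auto
    have "\<forall>\<^sub>F x in at_bot. cdf M x < real j / N" by (rule order_tendstoD(2)[OF cdf_lim_at_bot y(1)])
    then obtain x0 where x0: "cdf M x0 < real j / N" 
      by (auto simp: eventually_at_bot_linorder)
    have "\<forall>\<^sub>F x in at_top. cdf M x > real j / N" by (rule order_tendstoD(1)[OF cdf_lim_at_top_prob y(2)])
    then obtain x1 where x1: "\<And>x. x \<ge> x1 \<Longrightarrow> cdf M x > real j / N" 
      by (auto simp: eventually_at_top_linorder)
    have "\<exists>x\<ge>x0. x \<le> max x0 x1 \<and> cdf M x = real j / N"
      by (rule IVT) (use x0 x1[of "max x0 x1"] cont in auto)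
    then show ?thesis by auto
  qed
  then obtain a where a: "\<And>j. 0 < j \<Longrightarrow> j < N \<Longrightarrow> cdf M (a j) = real j / N" by metis
  show ?thesis
  proof (rule that[of "a ` {0<..<N}" "1 / N"])
    fix n and x :: "nat \<Rightarrow> real"
    assume close: "\<And>y. y \<in> a ` {0<..<N} \<Longrightarrow> \<bar>Fn n x y - measure M {..y}\<bar> < 1 / N"
    have c: "\<bar>Fn n x (a j) - real j / N\<bar> < 1 / N" if "0 < j" "j < N" for j
      using close[of "a j"] a[OF that] that by (auto simp: cdf_def)
    show "kclose k (emp n x) M"
      unfolding kclose_def
    proof
      fix y
      define u where "u = cdf M y"
      have u: "0 \<le> u" "u \<le> 1" unfolding u_def by (auto simp: cdf_nonneg cdf_bounded_prob)
      define j where "j = nat \<lfloor>N * u\<rfloor>"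
      have j: "real j \<le> N * u" "N * u < real j + 1" using u N by (auto simp: j_def)
      have up: "Fn n x y \<le> u + 2 / N"
      proof (cases "j + 1 < N")
        case True
        have "u < real (j + 1) / N" using j N by (simp add: less_divide_eq mult.commute)
        then have "cdf M y < cdf M (a (j + 1))" using a[of "j + 1"] True by (simp add: u_def)
        then have "y \<le> a (j + 1)" using cdf_nondecreasing[of "a (j + 1)" y] by linarith
        then have "Fn n x y \<le> Fn n x (a (j + 1))" by (rule Fn_mono)
        also have "\<dots> \<le> real (j + 1) / N + 1 / N" using c[of "j + 1"] True by linarith
        also have "\<dots> \<le> u + 2 / N" using j N by (simp add: field_simps)
        finally show ?thesis .
      next
        case False
        then have "1 \<le> u + 2 / N" using j N by (simp add: field_simps)
        then show ?thesis using Fn_bounds[of n x y] by linarith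
      qed
      \<comment> \<open>The quantile of index \<open>j - 1\<close> is used rather than
        \<open>j\<close>: \<open>j = N\<close> is possible and has no quantile on the grid, and only
        for \<open>j - 1\<close> is the inequality with \<open>u\<close> strict. Hence the loss of 3
        / N instead of 2 / N.\<close>
      have lo: "Fn n x y \<ge> u - 3 / N"
      proof (cases "j \<ge> 2")
        case True
        have jN: "j \<le> N" 
        proof -
          have "real N * u \<le> real N * 1" using u by (intro mult_left_mono) auto
          then have "real j \<le> real N" using j(1) by linarith
          then show ?thesis by simp
        qed
        have "real (j - 1) / N < u" using j N True by (simp add: divide_less_eq mult.commute of_nat_diff)
        then have "cdf M (a (j - 1)) < cdf M y" using a[of "j - 1"] True jN N by (simp add: u_def)
        then have "a (j - 1) \<le> y" using cdf_nondecreasing[of y "a (j - 1)"] by linarith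
        then have "Fn n x (a (j - 1)) \<le> Fn n x y" by (rule Fn_mono)
        moreover have "Fn n x (a (j - 1)) \<ge> real (j - 1) / N - 1 / N" using c[of "j - 1"] True jN by linarith
        moreover have "real (j - 1) / N - 1 / N = real (j + 1) / N - 3 / N"
          using True by (simp add: of_nat_diff diff_divide_distrib add_divide_distrib)
        moreover have "u < real (j + 1) / N" using j N by (simp add: less_divide_eq mult.commute)
        ultimately show ?thesis by linarith
      next
        case False
        then have "u - 3 / N \<le> 0" using j N by (simp add: field_simps)
        then show ?thesis using Fn_bounds[of n x y] by linarith
      qed
      have "2 / real N \<le> 3 / real N" by (simp add: divide_right_mono)
      then show "\<bar>measure (emp n x) {..y} - measure M {..y}\<bar> \<le> k"
        using up lo N unfolding Fn_eq_measure_emp[symmetric] u_def cdf_def by linarith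
    qed
  qed (use N in auto)
qed

lemma Vn_converges:
  assumes M: "pos_law M" and atomless: "\<And>x. measure M {x} = 0" and e: "e > 0"
  shows "(\<lambda>n. \<P>(x in iid M n. \<bar>Vn n x - Vf M\<bar> > e)) \<longlonglongrightarrow> 0"
proof -
  note MD = pos_lawD[OF M]
  interpret real_distribution M using MD by (simp add: real_distribution_def real_distribution_axioms_def)
  \<comment> \<open>The Lipschitz constant 5 turns \<open>e / 10\<close> into \<open>e / 2\<close>;
    the other half of \<open>e\<close> absorbs the term \<open>1 / n\<close>.\<close>
  obtain A \<delta> where A: "finite A" "\<delta> > 0"
    "\<And>n x. (\<And>a. a \<in> A \<Longrightarrow> \<bar>Fn n x a - measure M {..a}\<bar> < \<delta>) \<Longrightarrow> kclose (e / 10) (emp n x) M"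
    using quantile_grid[OF real_distribution_axioms atomless, of "e / 10"] e by auto
  define B where "B n a = {x \<in> space (iid M n). \<bar>Fn n x a - measure M {..a}\<bar> \<ge> \<delta>}" for n a
  have Bm: "B n a \<in> sets (iid M n)" for n a unfolding B_def Fn_sum by measurable
  have B0: "(\<lambda>n. measure (iid M n) (B n a)) \<longlonglongrightarrow> 0" for a
  proof -
    have *: "(indicator {..a} x :: real)^2 = indicator {..a} x" for x :: real by (simp add: indicator_def)
    have "integrable M (\<lambda>x. (indicator {..a} x :: real)^2)"
      unfolding * by (intro integrable_const_bound[of _ 1]) (auto simp: indicator_def)
    moreover have "(\<integral>x. indicator {..a} x \<partial>M) = measure M {..a}" by simp
    ultimately show ?thesis
      using weak_law[OF MD(1), of "indicator {..a}" \<delta>] A(2) unfolding B_def Fn_sum by simp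
  qed
  have "\<forall>\<^sub>F n in sequentially. \<P>(x in iid M n. \<bar>Vn n x - Vf M\<bar> > e) \<le> (\<Sum>a\<in>A. measure (iid M n) (B n a))"
    using eventually_gt_at_top[of "nat \<lceil>2 / e\<rceil> + 2"]
  proof eventually_elim
    case (elim n)
    interpret I: prob_space "iid M n" by (rule prob_space_iid[OF MD(1)])
    have "2 / e \<le> real n" using elim by linarith
    then have n: "n \<ge> 2" "1 / n \<le> e / 2" using elim e by (auto simp: field_simps)
    have "AE x in iid M n. \<forall>i<n. 0 < x i" by (rule AE_iid[OF MD(1,3)])
    then have "AE x in iid M n. x \<in> {x \<in> space (iid M n). \<bar>Vn n x - Vf M\<bar> > e} \<longrightarrow> x \<in> (\<Union>a\<in>A. B n a)"
    proof eventually_elim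
      case (elim x)
      show ?case
      proof (intro impI, rule ccontr)
        assume x: "x \<in> {x \<in> space (iid M n). \<bar>Vn n x - Vf M\<bar> > e}" "x \<notin> (\<Union>a\<in>A. B n a)"
        have "kclose (e / 10) (emp n x) M" by (rule A(3)) (use x in \<open>auto simp: B_def\<close>)
        from Vn_kclose[OF n(1) _ M this] elim x(1) n(2) show False by auto
      qed
    qed
    then have "\<P>(x in iid M n. \<bar>Vn n x - Vf M\<bar> > e) \<le> measure (iid M n) (\<Union>a\<in>A. B n a)"
      by (intro I.finite_measure_mono_AE) (use A(1) Bm in auto)
    also have "\<dots> \<le> (\<Sum>a\<in>A. measure (iid M n) (B n a))"
      using A(1) Bm by (intro I.finite_measure_subadditive_finite) auto
    finally show ?case .
  qed
  moreover have "(\<lambda>n. \<Sum>a\<in>A. measure (iid M n) (B n a)) \<longlonglongrightarrow> 0"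
    using tendsto_sum[of A "\<lambda>a n. measure (iid M n) (B n a)" "\<lambda>_. 0"] B0 by simp
  ultimately show ?thesis
    by (rule tendsto_sandwich[of "\<lambda>_. 0", rotated, OF _ tendsto_const]) simp
qed

text \<open>Uniqueness of the limit in probability determines the definite description in
  \<open>bV\<close>. If the limits differed, every value would be at distance more than a third of
  the gap from one of them.\<close>

lemma Vn_limit_unique:
  assumes M: "prob_space M" "sets M = sets borel"
    and b: "\<And>e. e > 0 \<Longrightarrow> (\<lambda>n. \<P>(x in iid M n. \<bar>Vn n x - b\<bar> > e)) \<longlonglongrightarrow> 0"
    and c: "\<And>e. e > 0 \<Longrightarrow> (\<lambda>n. \<P>(x in iid M n. \<bar>Vn n x - c\<bar> > e)) \<longlonglongrightarrow> 0"
  shows "b = c"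
proof (rule ccontr)
  assume "b \<noteq> c"
  define e where "e = \<bar>b - c\<bar> / 3"
  have e: "e > 0" using \<open>b \<noteq> c\<close> by (simp add: e_def)
  have [measurable]: "Vn n \<in> borel_measurable (iid M n)" for n using M by (intro Vn_measurable)
  have "1 \<le> \<P>(x in iid M n. \<bar>Vn n x - b\<bar> > e) +
        \<P>(x in iid M n. \<bar>Vn n x - c\<bar> > e)" for n
  proof -
    interpret I: prob_space "iid M n" by (rule prob_space_iid[OF M(1)])
    have "1 = measure (iid M n) (space (iid M n))" by (simp add: I.prob_space)
    also have "\<dots> \<le> measure (iid M n) ({x \<in> space (iid M n). \<bar>Vn n x - b\<bar> > e} \<union> {x \<in> space (iid M n). \<bar>Vn n x - c\<bar> > e})"
    proof (rule I.finite_measure_mono)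
      have "\<bar>v - b\<bar> > e \<or> \<bar>v - c\<bar> > e" for v
      proof (rule ccontr)
        assume "\<not> ?thesis"
        then have "\<bar>v - b\<bar> \<le> e" "\<bar>v - c\<bar> \<le> e" by auto
        moreover have "\<bar>b - c\<bar> \<le> \<bar>v - b\<bar> + \<bar>v - c\<bar>" by arith
        moreover have "\<bar>b - c\<bar> = 3 * e" by (simp add: e_def)
        ultimately show False using e by linarith
      qed
      then show "space (iid M n) \<subseteq> {x \<in> space (iid M n). \<bar>Vn n x - b\<bar> > e} \<union> {x \<in> space (iid M n). \<bar>Vn n x - c\<bar> > e}"
        by auto
    qed measurable
    also have "\<dots> \<le> \<P>(x in iid M n. \<bar>Vn n x - b\<bar> > e) +
        \<P>(x in iid M n. \<bar>Vn n x - c\<bar> > e)"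
      by (rule measure_Un_le) measurable
    finally show ?thesis .
  qed
  moreover have "(\<lambda>n. \<P>(x in iid M n. \<bar>Vn n x - b\<bar> > e) +
        \<P>(x in iid M n. \<bar>Vn n x - c\<bar> > e)) \<longlonglongrightarrow> 0 + 0"
    by (intro tendsto_add b c e)
  ultimately have "(1::real) \<le> 0 + 0" by (intro tendsto_lowerbound) auto
  then show False by simp
qed

section \<open>Tilting and the large deviation lower bound\<close>

text \<open>Boundedness makes \<open>q * ln q\<close> and \<open>q * (ln q)^2\<close> integrable, so
  the entropy is finite and the weak law applies to the log-likelihood.\<close>

definition bdens :: "real measure \<Rightarrow> (real \<Rightarrow> real) \<Rightarrow> bool" where
  "bdens P q \<longleftrightarrow> q \<in> borel_measurable borel \<and> (\<exists>B. \<forall>x. 0 \<le> q x \<and> q x \<le> B) \<and> (\<integral>x. q x \<partial>P) = 1"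

definition tilt :: "real measure \<Rightarrow> (real \<Rightarrow> real) \<Rightarrow> real measure" where
  "tilt P q = density P (\<lambda>x. ennreal (q x))"

definition ent :: "real measure \<Rightarrow> (real \<Rightarrow> real) \<Rightarrow> real" where
  "ent P q = (\<integral>x. q x * ln (q x) \<partial>P)"

lemma sets_tilt [simp, measurable_cong]: "sets (tilt P q) = sets P"
  by (simp add: tilt_def)

lemma space_tilt [simp]: "space (tilt P q) = space P"
  by (simp add: tilt_def)

text \<open>Measures on a finite product are determined by rectangles, where the integral of the
  product density factorizes.\<close>

lemma iid_density:
  assumes P: "prob_space P" and q: "q \<in> borel_measurable P" and Q: "prob_space (density P q)"
  shows "iid (density P q) n = density (iid P n) (\<lambda>x. \<Prod>i<n. q (x i))"
proof -
  interpret P: prob_space P by fact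
  interpret Q: prob_space "density P q" by fact
  interpret P: product_sigma_finite "\<lambda>_::nat. P" by standard
  interpret Q: product_sigma_finite "\<lambda>_::nat. density P q" by standard
  note [measurable] = q
  have "density (iid P n) (\<lambda>x. \<Prod>i<n. q (x i)) = iid (density P q) n"
  proof (rule Q.PiM_eqI)
    show "sets (density (iid P n) (\<lambda>x. \<Prod>i<n. q (x i))) = sets (iid (density P q) n)"
      by (simp cong: sets_PiM_cong)
    fix A :: "nat \<Rightarrow> _" assume "\<And>i. i \<in> {..<n} \<Longrightarrow> A i \<in> sets (density P q)"
    then have A: "A i \<in> sets P" if "i < n" for i using that by simp
    have "emeasure (density (iid P n) (\<lambda>x. \<Prod>i<n. q (x i))) (Pi\<^sub>E {..<n} A)
      = (\<integral>\<^sup>+x. (\<Prod>i<n. q (x i)) * indicator (Pi\<^sub>E {..<n} A) x \<partial>iid P n)"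
      using A by (intro emeasure_density sets_PiM_I_finite) auto
    also have "\<dots> = (\<integral>\<^sup>+x. (\<Prod>i<n. q (x i) * indicator (A i) (x i)) \<partial>iid P n)"
    proof (rule nn_integral_cong)
      fix x assume x: "x \<in> space (iid P n)"
      have "indicator (Pi\<^sub>E {..<n} A) x = (\<Prod>i<n. indicator (A i) (x i) :: ennreal)"
      proof (cases "x \<in> Pi\<^sub>E {..<n} A")
        case True
        then show ?thesis by (auto simp: PiE_iff intro!: prod.neutral)
      next
        case False
        then obtain i where "i < n" "x i \<notin> A i" using x by (auto simp: space_PiM PiE_iff)
        then have "(\<Prod>i<n. indicator (A i) (x i) :: ennreal) = 0"
          by (intro prod_zero) (auto intro!: bexI[of _ i])
        then show ?thesis using False by simp
      qed
      then show "(\<Prod>i<n. q (x i)) * indicator (Pi\<^sub>E {..<n} A) x = (\<Prod>i<n. q (x i) * indicator (A i) (x i))"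
        by (simp add: prod.distrib)
    qed
    also have "\<dots> = (\<Prod>i<n. \<integral>\<^sup>+x. q x * indicator (A i) x \<partial>P)"
      using A by (intro P.product_nn_integral_prod) auto
    also have "\<dots> = (\<Prod>i<n. emeasure (density P q) (A i))"
      using A by (intro prod.cong refl emeasure_density[symmetric]) auto
    finally show "emeasure (density (iid P n) (\<lambda>x. \<Prod>i<n. q (x i))) (Pi\<^sub>E {..<n} A) =
      (\<Prod>i<n. emeasure (density P q) (A i))" .
  qed simp
  then show ?thesis by simp
qed

text \<open>Fenchel-Young inequality: exp is the convex conjugate of \<open>q * ln q - q\<close>. It
  follows from the tangent of exp at 0, scaled by \<open>q\<close>.\<close>

lemma mult_exp_conjugate:
  fixes q y :: real assumes "q \<ge> 0" shows "q * y \<le> q * ln q - q + exp y"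
proof (cases "q = 0")
  case False
  then have q: "q > 0" using assms by simp
  have "q * (1 + (y - ln q)) \<le> q * exp (y - ln q)"
    using q exp_ge_add_one_self[of "y - ln q"] by (intro mult_left_mono) auto
  also have "\<dots> = exp y" using q by (simp add: exp_diff)
  finally show ?thesis by (simp add: algebra_simps)
qed simp

lemma abs_mult_ln_le:
  fixes q B :: real assumes "0 \<le> q" "q \<le> B" shows "\<bar>q * ln q\<bar> \<le> 1 + B^2" "q * (ln q)^2 \<le> 4 + B^3"
proof -
  have B: "0 \<le> B" using assms by simp
  have "\<bar>q * ln q\<bar> \<le> 1 + B^2 \<and> q * (ln q)^2 \<le> 4 + B^3"
  proof (cases "q \<le> 1")
    case True
    show ?thesis
    proof (cases "q = 0")
      case False
      then have q: "q > 0" using assms by simp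
      \<comment> \<open>The bound for \<open>q * (ln q)^2\<close> near 0 is the square of the
        elementary bound for \<open>y * ln y\<close>, hence the square root.\<close>
      define y where "y = sqrt q"
      have y: "y > 0" "y \<le> 1" "q = y^2" using q True by (auto simp: y_def)
      have l: "0 \<le> - ln y" using y by simp
      have u: "- ln y \<le> 1 / y" using y ln_le_minus_one[of "1/y"] by (simp add: ln_div)
      have yl: "y * (- ln y) \<le> 1" using mult_left_mono[OF u, of y] y by simp
      have "ln (y * y) = ln y + ln y" using y(1) by (intro ln_mult_pos) auto
      then have lnq: "ln q = 2 * ln y" unfolding y(3) power2_eq_square by linarith
      have "ln q \<le> 0" using q True by simp
      moreover have "q * (- ln q) \<le> 1"
      proof -
        have "- ln q \<le> 1 / q - 1" using q ln_le_minus_one[of "1/q"] by (simp add: ln_div)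
        from mult_left_mono[OF this, of q] q show ?thesis by (simp add: algebra_simps)
      qed
      ultimately have 1: "\<bar>q * ln q\<bar> \<le> 1" using q by (simp add: abs_mult)
      have "q * (ln q)^2 = 4 * (y * (- ln y))^2" unfolding lnq by (simp add: y(3) power2_eq_square)
      also have "(y * (- ln y))^2 \<le> 1" using yl l y by (intro power_le_one mult_nonneg_nonneg) auto
      finally have "q * (ln q)^2 \<le> 4" by simp
      then show ?thesis using 1 zero_le_power[OF B, of 2] zero_le_power[OF B, of 3] by linarith
    qed (use B in auto)
  next
    case False
    then have q: "q > 1" by simp
    have l: "0 \<le> ln q" "ln q \<le> q" using q ln_le_minus_one[of q] by auto
    have lB: "ln q \<le> B" using l assms by simp
    have "q * ln q \<le> B * B" using l lB assms B by (intro mult_mono) auto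
    moreover have "q * (ln q)^2 \<le> B * B^2" using l lB assms B by (intro mult_mono power_mono) auto
    ultimately show ?thesis using l q by (simp add: abs_mult power2_eq_square power3_eq_cube)
  qed
  then show "\<bar>q * ln q\<bar> \<le> 1 + B^2" "q * (ln q)^2 \<le> 4 + B^3" by auto
qed

section \<open>Tilted laws and relative entropy\<close>

context
  fixes P :: "real measure" assumes P: "pos_law P"
begin

interpretation P: real_distribution P
  using pos_lawD[OF P] by (simp add: real_distribution_def real_distribution_axioms_def)

lemma pos_law_UNIV: "measure P UNIV = 1" using P.prob_space by simp

lemma bdensD:
  assumes "bdens P q"
  shows "q \<in> borel_measurable borel" "\<And>x. 0 \<le> q x" "(\<integral>x. q x \<partial>P) = 1" "integrable P q"
proof -
  from assms obtain B where B: "q \<in> borel_measurable borel" "\<And>x. 0 \<le> q x" "\<And>x. q x \<le> B" "(\<integral>x. q x \<partial>P) = 1"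
    unfolding bdens_def by auto
  show "q \<in> borel_measurable borel" "\<And>x. 0 \<le> q x" "(\<integral>x. q x \<partial>P) = 1" by fact+
  show "integrable P q" using B by (intro P.integrable_const_bound[of _ B]) auto
qed

lemma bdens_integrable_mult:
  assumes "bdens P q" "f \<in> borel_measurable borel" "\<And>x. \<bar>f x\<bar> \<le> K"
  shows "integrable P (\<lambda>x. q x * f x)"
proof -
  from assms obtain B where B: "q \<in> borel_measurable borel" "\<And>x. 0 \<le> q x" "\<And>x. q x \<le> B"
    unfolding bdens_def by auto
  have "\<bar>q x * f x\<bar> \<le> B * K" for x
    unfolding abs_mult using B(2,3)[of x] assms(3)[of x] by (intro mult_mono) auto
  then show ?thesis using B assms(2) by (intro P.integrable_const_bound[of _ "B * K"]) auto
qed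

lemma bdens_integrable_ent: "bdens P q \<Longrightarrow> integrable P (\<lambda>x. q x * ln (q x))"
proof -
  assume "bdens P q"
  then obtain B where B: "q \<in> borel_measurable borel" "\<And>x. 0 \<le> q x" "\<And>x. q x \<le> B"
    unfolding bdens_def by auto
  then show ?thesis using abs_mult_ln_le(1)[of "q _" B] by (intro P.integrable_const_bound[of _ "1 + B^2"]) auto
qed

lemma prob_space_density:
  assumes "q \<in> borel_measurable borel" "AE x in P. 0 \<le> q x" "has_bochner_integral P q 1"
  shows "pos_law (tilt P q)"
proof -
  have "emeasure (tilt P q) (space (tilt P q)) = (\<integral>\<^sup>+x. ennreal (q x) \<partial>P)"
    unfolding tilt_def using assms by (subst emeasure_density) auto
  also have "\<dots> = ennreal 1"
    using assms by (intro nn_integral_eq_integrable[THEN iffD2]) (auto simp: has_bochner_integral_iff)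
  finally have "prob_space (tilt P q)" by (intro prob_spaceI) simp
  moreover have "AE x in tilt P q. 0 < x"
    unfolding tilt_def using pos_lawD(3)[OF P] assms(1) by (subst AE_density) auto
  ultimately show ?thesis by (simp add: pos_law_def)
qed

lemma pos_law_tilt: "bdens P q \<Longrightarrow> pos_law (tilt P q)"
  by (rule prob_space_density) (auto simp: bdensD has_bochner_integral_iff)

lemma tilt_atomless:
  assumes "q \<in> borel_measurable borel" "emeasure P {x} = 0" shows "measure (tilt P q) {x} = 0"
proof -
  have "AE y in P. y \<noteq> x" using assms by (intro AE_I[of _ _ "{x}"]) auto
  then have "AE y in P. ennreal (q y) * indicator {x} y = 0" by (rule eventually_mono) auto
  then have "(\<integral>\<^sup>+y. ennreal (q y) * indicator {x} y \<partial>P) = 0"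
    using assms by (subst nn_integral_0_iff_AE) auto
  then have "emeasure (tilt P q) {x} = 0"
    unfolding tilt_def using assms by (subst emeasure_density) auto
  then show ?thesis by (simp add: measure_def)
qed

lemma integral_tilt:
  fixes f :: "real \<Rightarrow> real"
  assumes "q \<in> borel_measurable borel" "\<And>x. 0 \<le> q x" "f \<in> borel_measurable borel"
  shows "(\<integral>x. f x \<partial>tilt P q) = (\<integral>x. q x * f x \<partial>P)"
  unfolding tilt_def using assms by (subst integral_density) auto

lemma measure_tilt:
  assumes "q \<in> borel_measurable borel" "\<And>x. 0 \<le> q x" "A \<in> sets borel"
  shows "measure (tilt P q) A = (\<integral>x. q x * indicator A x \<partial>P)"
  using integral_tilt[OF assms(1,2), of "indicator A"] assms(3) by simp

text \<open>The Fenchel-Young inequality at \<open>f x - ln Z\<close>, integrated: the terms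
  \<open>- q x\<close> and \<open>exp (f x) / Z\<close> cancel, since both \<open>q\<close> and
  \<open>exp f / Z\<close> integrate to 1.\<close>

lemma donsker_varadhan:
  assumes q: "bdens P q" and f: "f \<in> borel_measurable borel" "\<And>x. \<bar>f x\<bar> \<le> K"
  shows "(\<integral>x. q x * f x \<partial>P) \<le> ent P q + ln (\<integral>x. exp (f x) \<partial>P)"
proof -
  define Z where "Z = (\<integral>x. exp (f x) \<partial>P)"
  have fK: "- K \<le> f x" "f x \<le> K" for x using f(2)[of x] by auto
  have ie: "integrable P (\<lambda>x. exp (f x))"
    using f fK by (intro P.integrable_const_bound[of _ "exp K"]) auto
  have "(\<integral>x. exp (- K) \<partial>P) \<le> Z" unfolding Z_def using fK by (intro integral_mono ie) auto
  then have "exp (- K) \<le> Z" by (simp add: pos_law_UNIV)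
  then have Z: "Z > 0" using exp_gt_zero[of "- K"] by linarith
  note D = bdensD[OF q]
  have "(\<integral>x. q x * f x - q x * ln Z \<partial>P) \<le> (\<integral>x. q x * ln (q x) - q x + exp (f x) / Z \<partial>P)"
  proof (rule integral_mono)
    show "integrable P (\<lambda>x. q x * f x - q x * ln Z)"
      using D bdens_integrable_mult[OF q f] by auto
    show "integrable P (\<lambda>x. q x * ln (q x) - q x + exp (f x) / Z)"
      using D bdens_integrable_ent[OF q] ie by auto
    fix x
    show "q x * f x - q x * ln Z \<le> q x * ln (q x) - q x + exp (f x) / Z"
      using mult_exp_conjugate[OF D(2), of x "f x - ln Z"] Z by (simp add: exp_diff algebra_simps)
  qed
  also have "\<dots> = ent P q"
    using D bdens_integrable_ent[OF q] ie Z by (simp add: ent_def Z_def)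
  also have "(\<integral>x. q x * f x - q x * ln Z \<partial>P) = (\<integral>x. q x * f x \<partial>P) - ln Z"
    using D bdens_integrable_mult[OF q f] by simp
  finally show ?thesis unfolding Z_def by simp
qed

lemma ent_nonneg: "bdens P q \<Longrightarrow> 0 \<le> ent P q"
  using donsker_varadhan[of q "\<lambda>_. 0" 0] by (simp add: pos_law_UNIV)

text \<open>Change of measure: under the tilted law the event is typical and the log-likelihood ratio concentrates at \<open>n\<close> times the entropy.\<close>

lemma Vn_lower_bound:
  assumes atomless: "\<And>x. emeasure P {x} = 0" and q: "bdens P q" and t: "t < Vf (tilt P q)" and e: "e > 0"
  shows "\<forall>\<^sub>F n in sequentially. exp (- (real n * (ent P q + e))) \<le> \<P>(x in iid P n. t \<le> Vn n x)"
proof -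
  note D = bdensD[OF q]
  note [measurable] = D(1)
  define Q where "Q = tilt P q"
  have Q: "pos_law Q" unfolding Q_def by (rule pos_law_tilt[OF q])
  note QD = pos_lawD[OF Q]
  interpret Q: prob_space Q by fact
  define h where "h = ent P q"
  define f where "f x = ln (q x)" for x
  have f [measurable]: "f \<in> borel_measurable borel" unfolding f_def by measurable
  have fh: "(\<integral>x. f x \<partial>Q) = h"
    unfolding Q_def h_def ent_def f_def by (subst integral_tilt) (auto simp: D)
  have "integrable P (\<lambda>x. q x * (f x)^2)"
  proof -
    from q obtain B where B: "q \<in> borel_measurable borel" "\<And>x. 0 \<le> q x" "\<And>x. q x \<le> B"
      unfolding bdens_def by auto
    then show ?thesis using abs_mult_ln_le(2)[of "q _" B] unfolding f_def
      by (intro P.integrable_const_bound[of _ "4 + B^3"]) auto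
  qed
  then have f2: "integrable Q (\<lambda>x. (f x)^2)"
    unfolding Q_def tilt_def by (subst integrable_density) (auto simp: D)
  define b where "b = (Vf Q - t) / 2"
  have b: "b > 0" using t by (simp add: b_def Q_def)
  define E where "E n = {x \<in> space (iid P n). t \<le> Vn n x}" for n
  define X where "X n = {x \<in> space (iid Q n). \<bar>Vn n x - Vf Q\<bar> > b}" for n
  \<comment> \<open>Under the tilted law the log-likelihood ratio has mean \<open>h\<close>; off
    \<open>Y n\<close> it is at most \<open>n * (h + e / 2)\<close>, and the remaining
    \<open>e / 2\<close> will absorb the factor 1/2 once
    \<open>n \<ge> 2 * ln 2 / e\<close>.\<close>
  define Y where "Y n = {x \<in> space (iid Q n). \<bar>(\<Sum>i<n. f (x i)) / n - h\<bar> \<ge> e / 2}" for n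
  have sQ: "sets (iid Q n) = sets (iid P n)" for n
    by (intro sets_PiM_cong) (auto simp: Q_def)
  have spQ: "space (iid Q n) = space (iid P n)" for n using sets_eq_imp_space_eq[OF sQ] .
  have [measurable]: "Vn n \<in> borel_measurable (iid Q n)" "Vn n \<in> borel_measurable (iid P n)" for n
    by (intro Vn_measurable; simp add: QD)+
  have fQ: "f \<in> borel_measurable Q" by (simp add: Q_def)
  have "(\<lambda>n. measure (iid Q n) (X n)) \<longlonglongrightarrow> 0"
    unfolding X_def by (rule Vn_converges[OF Q _ b]) (simp add: Q_def tilt_atomless[OF D(1) atomless])
  moreover have "(\<lambda>n. measure (iid Q n) (Y n)) \<longlonglongrightarrow> 0"
    using weak_law[OF QD(1) fQ f2, of "e / 2"] e unfolding Y_def fh by simp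
  ultimately have "(\<lambda>n. measure (iid Q n) (X n) + measure (iid Q n) (Y n)) \<longlonglongrightarrow> 0 + 0"
    by (rule tendsto_add)
  then have "\<forall>\<^sub>F n in sequentially. measure (iid Q n) (X n) + measure (iid Q n) (Y n) < 1 / 2"
    by (rule order_tendstoD(2)) simp
  moreover have "\<forall>\<^sub>F n in sequentially. n \<ge> nat \<lceil>2 * ln 2 / e\<rceil>" by (rule eventually_ge_at_top)
  ultimately show ?thesis
  proof eventually_elim
    case (elim n)
    interpret In: prob_space "iid Q n" by (rule prob_space_iid[OF QD(1)])
    interpret Pn: prob_space "iid P n" by (rule prob_space_iid[OF P.prob_space_axioms])
    have Xm: "X n \<in> sets (iid Q n)" unfolding X_def by measurable
    have Ym: "Y n \<in> sets (iid Q n)" unfolding Y_def by (use fQ in measurable)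
    have Em: "E n \<in> sets (iid P n)" unfolding E_def by measurable
    define A where "A = space (iid P n) - (X n \<union> Y n)"
    have Am: "A \<in> sets (iid P n)" unfolding A_def using Xm Ym sQ by auto
    have AE: "A \<subseteq> E n"
    proof
      fix x assume x: "x \<in> A"
      then have "\<bar>Vn n x - Vf Q\<bar> \<le> b" by (auto simp: A_def X_def spQ)
      moreover have "2 * b = Vf Q - t" by (simp add: b_def)
      ultimately have "t \<le> Vn n x" using b by linarith
      then show "x \<in> E n" using x by (simp add: A_def E_def)
    qed
    have "1 / 2 \<le> measure (iid Q n) A"
    proof -
      have "measure (iid Q n) A = 1 - measure (iid Q n) (X n \<union> Y n)"
        unfolding A_def spQ[symmetric] using Xm Ym by (intro In.prob_compl) auto
      moreover have "measure (iid Q n) (X n \<union> Y n) \<le> measure (iid Q n) (X n) + measure (iid Q n) (Y n)"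
        using Xm Ym by (rule measure_Un_le)
      ultimately show ?thesis using elim by linarith
    qed
    also have "measure (iid Q n) A \<le> exp (n * (h + e / 2)) * measure (iid P n) A"
    proof -
      have "emeasure (iid Q n) A = (\<integral>\<^sup>+x. (\<Prod>i<n. ennreal (q (x i))) * indicator A x \<partial>iid P n)"
      proof -
        have eq: "iid Q n = density (iid P n) (\<lambda>x. \<Prod>i<n. ennreal (q (x i)))"
          unfolding Q_def tilt_def
          by (rule iid_density) (use QD(1) in \<open>simp_all add: Q_def tilt_def P.prob_space_axioms\<close>)
        have "(\<lambda>x. \<Prod>i<n. ennreal (q (x i))) \<in> borel_measurable (iid P n)" by measurable
        then show ?thesis unfolding eq by (rule emeasure_density[OF _ Am])
      qed
      also have "\<dots> \<le> (\<integral>\<^sup>+x. ennreal (exp (n * (h + e / 2))) * indicator A x \<partial>iid P n)"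
      proof (rule nn_integral_mono)
        fix x assume x: "x \<in> space (iid P n)"
        \<comment> \<open>Zeros of \<open>q\<close> are set apart because \<open>exp (ln 0)\<close>
          is not 0, and \<open>n = 0\<close> because the average divides by \<open>n\<close>; in
          both cases the bound is immediate.\<close>
        have "(\<Prod>i<n. ennreal (q (x i))) \<le> ennreal (exp (n * (h + e / 2)))" if xA: "x \<in> A"
        proof (cases "n = 0 \<or> (\<exists>i<n. q (x i) = 0)")
          case True
          then show ?thesis
          proof
            assume "n = 0" then show ?thesis by simp
          next
            assume "\<exists>i<n. q (x i) = 0"
            then obtain i where "i < n" "q (x i) = 0" by auto
            then have "(\<Prod>i<n. ennreal (q (x i))) = 0" by (intro prod_zero bexI[of _ i]) auto
            then show ?thesis by (simp only:) simp
          qed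
        next
          case False
          then have pos: "q (x i) > 0" if "i < n" for i using D(2)[of "x i"] False that by (auto simp: less_le)
          have "(\<Prod>i<n. ennreal (q (x i))) = ennreal (\<Prod>i<n. q (x i))" by (rule prod_ennreal) (rule D)
          also have "(\<Prod>i<n. q (x i)) = (\<Prod>i<n. exp (f (x i)))"
            using pos by (intro prod.cong) (auto simp: f_def)
          also have "\<dots> = exp (\<Sum>i<n. f (x i))" by (simp add: exp_sum)
          also have "\<dots> \<le> exp (n * (h + e / 2))"
          proof -
            have "\<bar>(\<Sum>i<n. f (x i)) / n - h\<bar> < e / 2" using xA by (auto simp: A_def Y_def spQ)
            then have "(\<Sum>i<n. f (x i)) / n \<le> h + e / 2" by linarith
            then show ?thesis using False by (simp add: pos_divide_le_eq mult.commute)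
          qed
          finally show ?thesis by (simp add: ennreal_leI)
        qed
        then show "(\<Prod>i<n. ennreal (q (x i))) * indicator A x \<le> ennreal (exp (n * (h + e / 2))) * indicator A x"
          by (auto split: split_indicator)
      qed
      also have "\<dots> = ennreal (exp (n * (h + e / 2))) * emeasure (iid P n) A"
        using Am by (rule nn_integral_cmult_indicator)
      also have "\<dots> = ennreal (exp (n * (h + e / 2)) * measure (iid P n) A)"
        by (simp add: Pn.emeasure_eq_measure ennreal_mult)
      finally show ?thesis by (simp add: In.emeasure_eq_measure)
    qed
    also have "measure (iid P n) A \<le> measure (iid P n) (E n)"
      by (rule Pn.finite_measure_mono[OF AE Em])
    finally have 1: "1 / 2 \<le> exp (n * (h + e / 2)) * measure (iid P n) (E n)" by simp
    have "2 * ln 2 / e \<le> n" using elim by linarith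
    then have "ln 2 \<le> n * (e / 2)" using e by (simp add: field_simps)
    then have "exp (ln 2) \<le> exp (n * (e / 2))" by (simp only: exp_le_cancel_iff)
    then have "2 \<le> exp (n * (e / 2))" by simp
    then have "1 \<le> exp (n * (e / 2)) * (exp (n * (h + e / 2)) * measure (iid P n) (E n))"
      using mult_mono[OF _ 1, of 2 "exp (n * (e / 2))"] by simp
    also have "\<dots> = exp (n * (h + e)) * measure (iid P n) (E n)"
      by (simp add: exp_add[symmetric] algebra_simps)
    finally show ?case unfolding h_def[symmetric] E_def[symmetric]
      by (simp add: exp_minus inverse_eq_divide pos_divide_le_eq mult.commute)
  qed
qed

end

section \<open>Types and the large deviation upper bound\<close>

text \<open>Cells are ordered by \<open>mono\<close>, so the cells below that of \<open>a\<close>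
  carry equal mass under both laws and the two can differ only inside one cell, of mass at most
  \<open>k\<close>.\<close>

lemma kclose_cells:
  fixes c :: "real \<Rightarrow> nat"
  assumes M: "pos_law M" and N: "pos_law N" and mono: "\<And>x y. x \<le> y \<Longrightarrow> c x \<le> c y"
    and meas: "\<And>j. {x. c x = j} \<in> sets borel"
    and eq: "\<And>j. measure M {x. c x = j} = measure N {x. c x = j}"
    and le: "\<And>j. measure M {x. c x = j} \<le> k"
  shows "kclose k M N"
  unfolding kclose_def
proof
  fix a
  have meas': "{x. c x < j} \<in> sets borel" for j
  proof -
    have "{x. c x < j} = (\<Union>i<j. {x. c x = i})" by auto
    then show ?thesis using meas by auto
  qed
  have lt: "measure L {x. c x < j} = (\<Sum>i<j. measure L {x. c x = i})" if L: "pos_law L" for L j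
  proof -
    interpret prob_space L using pos_lawD[OF L] by simp
    have "{x. c x < j} = (\<Union>i<j. {x. c x = i})" by auto
    also have "measure L \<dots> = (\<Sum>i<j. measure L {x. c x = i})"
      using meas pos_lawD(2)[OF L] by (intro finite_measure_finite_Union) (auto simp: disjoint_family_on_def)
    finally show ?thesis .
  qed
  have bd: "measure L {x. c x < c a} \<le> measure L {..a}"
    "measure L {..a} \<le> measure L {x. c x < c a} + measure L {x. c x = c a}" if L: "pos_law L" for L
  proof -
    interpret prob_space L using pos_lawD[OF L] by simp
    have "{x. c x < c a} \<subseteq> {..a}"
    proof
      fix x assume "x \<in> {x. c x < c a}"
      then have "\<not> a \<le> x" using mono[of a x] by auto
      then show "x \<in> {..a}" by auto
    qed
    then show "measure L {x. c x < c a} \<le> measure L {..a}"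
      using pos_lawD(2)[OF L] by (intro finite_measure_mono) auto
    have "{..a} \<subseteq> {x. c x < c a} \<union> {x. c x = c a}" using mono[of _ a] by (auto simp: less_le)
    then have "measure L {..a} \<le> measure L ({x. c x < c a} \<union> {x. c x = c a})"
      using pos_lawD(2)[OF L] meas meas' by (intro finite_measure_mono) auto
    also have "\<dots> \<le> measure L {x. c x < c a} + measure L {x. c x = c a}"
      using pos_lawD(2)[OF L] meas meas' by (intro measure_Un_le) auto
    finally show "measure L {..a} \<le> measure L {x. c x < c a} + measure L {x. c x = c a}" .
  qed
  have "measure M {x. c x < c a} = measure N {x. c x < c a}"
    using lt[OF M] lt[OF N] eq by simp
  then show "\<bar>measure M {..a} - measure N {..a}\<bar> \<le> k"
    using bd[OF M] bd[OF N] eq[of "c a"] le[of "c a"] by linarith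
qed

section \<open>Quantile cells, type densities and type classes of a Pareto law\<close>

context
  fixes l :: real assumes l: "l > 0"
begin

interpretation P: prob_space "par l" by (rule prob_space_par[OF l])

lemma pos_law_par: "pos_law (par l)"
proof -
  have "AE x in par l. 0 < x" using AE_par_ge1[of l] by eventually_elim simp
  then show ?thesis unfolding pos_law_def using P.prob_space_axioms by simp
qed

definition Fp :: "real \<Rightarrow> real" where "Fp x = measure (par l) {..x}"

lemma Fp_mono: "x \<le> y \<Longrightarrow> Fp x \<le> Fp y"
  unfolding Fp_def by (intro P.finite_measure_mono) auto

lemma Fp_ge1: "x \<ge> 1 \<Longrightarrow> Fp x = 1 - x powr (- l)"
  unfolding Fp_def by (rule measure_par_atMost[OF l])

lemma Fp_less1: "x < 1 \<Longrightarrow> Fp x = 0"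
proof -
  assume "x < 1"
  then have "Fp x \<le> Fp 1" by (intro Fp_mono) auto
  moreover have "0 \<le> Fp x" by (simp add: Fp_def)
  ultimately show ?thesis using Fp_ge1[of 1] by simp
qed

lemma Fp_bounds: "0 \<le> Fp x" "Fp x < 1"
proof -
  show "0 \<le> Fp x" by (simp add: Fp_def)
  show "Fp x < 1" by (cases "x < 1") (simp_all add: Fp_less1 Fp_ge1)
qed

text \<open>Probability integral transform: \<open>Fp\<close> is uniformly distributed under
  \<open>par l\<close>.\<close>

lemma measure_Fp_less:
  assumes "0 \<le> a" "a \<le> 1"
  shows "{x. Fp x < a} \<in> sets borel" "measure (par l) {x. Fp x < a} = a"
proof -
  consider "a = 0" | "a = 1" | "0 < a" "a < 1" using assms by linarith
  then have "{x. Fp x < a} \<in> sets borel \<and> measure (par l) {x. Fp x < a} = a"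
  proof cases
    case 1
    then have "{x. Fp x < a} = {}" using Fp_bounds(1) by (auto simp: not_less)
    then show ?thesis using 1 by simp
  next
    case 2
    then have "{x. Fp x < a} = UNIV" using Fp_bounds(2) by auto
    then show ?thesis using 2 P.prob_space by simp
  next
    case 3
    define y where "y = (1 - a) powr (- (1 / l))"
    have y: "y \<ge> 1" "y powr (- l) = 1 - a"
    proof -
      show "y \<ge> 1" using 3 l by (auto simp: y_def powr_minus one_le_inverse_iff powr_le1)
      show "y powr (- l) = 1 - a" unfolding y_def powr_powr using 3 l by simp
    qed
    have "Fp x < a \<longleftrightarrow> x < y" for x
    proof (cases "x < 1")
      case True
      then show ?thesis using 3 y(1) by (simp add: Fp_less1)
    next
      case False
      then have "Fp x < a \<longleftrightarrow> y powr (- l) < x powr (- l)" using y by (auto simp: Fp_ge1)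
      also have "\<dots> \<longleftrightarrow> x < y"
        using False y(1) l powr_less_mono2_neg[of "- l" x y] powr_mono2'[of "- l" y x] by (cases "x < y") auto
      finally show ?thesis .
    qed
    then have *: "{x. Fp x < a} = UNIV - {y..}" by (simp add: set_eq_iff not_le)
    have "measure (par l) (UNIV - {y..}) = 1 - measure (par l) {y..}"
      using P.prob_compl[of "{y..}"] unfolding space_par by (metis atLeast_borel sets_par)
    then show ?thesis unfolding * using y(2) measure_par_atLeast[OF l y(1)] by simp
  qed
  then show "{x. Fp x < a} \<in> sets borel" "measure (par l) {x. Fp x < a} = a" by auto
qed

text \<open>Index of the quantile interval: \<open>m\<close> consecutive cells of equal mass
  \<open>1 / m\<close>. As \<open>Fp\<close> stays strictly below 1, the index never reaches
  \<open>m\<close>.\<close>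

definition cell :: "nat \<Rightarrow> real \<Rightarrow> nat" where "cell m x = nat \<lfloor>real m * Fp x\<rfloor>"

lemma cell_mono: "x \<le> y \<Longrightarrow> cell m x \<le> cell m y"
  unfolding cell_def by (intro nat_mono floor_mono mult_left_mono Fp_mono) auto

lemma cell_eq_iff: "m > 0 \<Longrightarrow> cell m x = j \<longleftrightarrow> real j / m \<le> Fp x \<and> Fp x < real (Suc j) / m"
proof -
  assume m: "m > 0"
  have "0 \<le> real m * Fp x" using Fp_bounds by simp
  then have "cell m x = j \<longleftrightarrow> real j \<le> real m * Fp x \<and> real m * Fp x < real j + 1"
    unfolding cell_def by (simp add: nat_eq_iff floor_eq_iff)
  then show ?thesis using m by (simp add: divide_le_eq less_divide_eq mult.commute add.commute)
qed

lemma cell_less: assumes "m > 0" shows "cell m x < m"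
proof -
  have "real (cell m x) / m \<le> Fp x" using cell_eq_iff[OF assms, of x "cell m x"] by simp
  then have "real (cell m x) / m < 1" using Fp_bounds(2)[of x] by linarith
  then show ?thesis using assms by simp
qed

lemma cell_sets [measurable]: assumes "m > 0" shows "{x. cell m x = j} \<in> sets borel"
proof (cases "j < m")
  case True
  have "{x. cell m x = j} = {x. Fp x < real (Suc j) / m} - {x. Fp x < real j / m}"
    unfolding cell_eq_iff[OF assms] by auto
  then show ?thesis using True by (auto intro!: sets.Diff measure_Fp_less)
next
  case False
  then have "{x. cell m x = j} = {}" using cell_less[OF assms] by auto
  then show ?thesis by simp
qed

lemma measure_cell: assumes "m > 0" "j < m" shows "measure (par l) {x. cell m x = j} = 1 / m"
proof -
  have *: "{x. cell m x = j} = {x. Fp x < real (Suc j) / m} - {x. Fp x < real j / m}"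
    unfolding cell_eq_iff[OF assms(1)] by auto
  have "real j / m \<le> real (Suc j) / m" by (simp add: divide_right_mono)
  then have "measure (par l) {x. cell m x = j} = measure (par l) {x. Fp x < real (Suc j) / m} - measure (par l) {x. Fp x < real j / m}"
    unfolding * using assms by (intro P.finite_measure_Diff) (auto intro!: measure_Fp_less)
  also have "\<dots> = real (Suc j) / m - real j / m" using assms by (simp add: measure_Fp_less)
  finally show ?thesis by (simp add: diff_divide_distrib[symmetric])
qed

lemma cell_sum:
  fixes g :: "nat \<Rightarrow> real"
  assumes "m > 0" shows "g (cell m x) = (\<Sum>j<m. g j * indicator {x. cell m x = j} x)"
  using cell_less[OF assms, of x] by (simp add: indicator_def if_distrib sum.delta' cong: if_cong)

lemma cell_fun_measurable: assumes "m > 0" shows "(\<lambda>x. g (cell m x) :: real) \<in> borel_measurable borel"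
proof -
  have "(\<lambda>x. \<Sum>j<m. g j * indicator {x. cell m x = j} x) \<in> borel_measurable borel"
    using cell_sets[OF assms] by (intro borel_measurable_sum borel_measurable_times borel_measurable_const borel_measurable_indicator)
  then show ?thesis unfolding cell_sum[OF assms, of g] .
qed

lemma integral_cell: assumes "m > 0" shows "(\<integral>x. g (cell m x) \<partial>par l) = (\<Sum>j<m. g j) / real m"
proof -
  have [measurable]: "(indicator {x. cell m x = j} :: real \<Rightarrow> real) \<in> borel_measurable (par l)" for j
    using cell_sets[OF assms] by (intro borel_measurable_indicator) simp
  have "(\<integral>x. g (cell m x) \<partial>par l) = (\<integral>x. (\<Sum>j<m. g j * indicator {x. cell m x = j} x) \<partial>par l)"
    unfolding cell_sum[OF assms, of g] ..
  also have "\<dots> = (\<Sum>j<m. \<integral>x. g j * indicator {x. cell m x = j} x \<partial>par l)"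
    using cell_sets[OF assms] by (intro Bochner_Integration.integral_sum integrable_mult_right P.integrable_const_bound[of _ 1]) auto
  also have "\<dots> = (\<Sum>j<m. g j * (1 / m))"
    using cell_sets[OF assms] by (intro sum.cong refl) (simp add: measure_cell[OF assms])
  finally show ?thesis by (simp add: sum_divide_distrib)
qed

text \<open>Density of the law giving cell \<open>j\<close> the mass \<open>N j / n\<close> and
  proportional to \<open>par l\<close> inside each cell; the factor \<open>m\<close> offsets the
  cell mass \<open>1 / m\<close>.\<close>

definition type_dens :: "nat \<Rightarrow> nat \<Rightarrow> (nat \<Rightarrow> nat) \<Rightarrow> real \<Rightarrow> real" where
  "type_dens m n N x = real m * real (N (cell m x)) / real n"

context
  fixes m n :: nat and N :: "nat \<Rightarrow> nat"
  assumes m: "m > 0" and n: "n > 0" and N: "(\<Sum>j<m. N j) = n"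
begin

lemma type_dens_measurable [measurable]: "type_dens m n N \<in> borel_measurable borel"
  unfolding type_dens_def by (rule cell_fun_measurable[OF m, of "\<lambda>j. real m * real (N j) / real n"])

lemma bdens_type_dens: "bdens (par l) (type_dens m n N)"
proof -
  have "(\<integral>x. type_dens m n N x \<partial>par l) = (\<Sum>j<m. real m * real (N j) / real n) / real m"
    unfolding type_dens_def by (rule integral_cell[OF m, of "\<lambda>j. real m * real (N j) / real n"])
  also have "\<dots> = (\<Sum>j<m. real (N j)) / real n"
    using m by (simp add: sum_divide_distrib)
  also have "\<dots> = 1" using N n by (simp flip: of_nat_sum)
  finally have 1: "(\<integral>x. type_dens m n N x \<partial>par l) = 1" .
  have le: "N (cell m x) \<le> n" for x
    using member_le_sum[of "cell m x" "{..<m}" N] cell_less[OF m] N by simp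
  have "0 \<le> type_dens m n N x \<and> type_dens m n N x \<le> m" for x
    using le[of x] n by (simp add: type_dens_def divide_le_eq mult_left_mono)
  then show ?thesis using 1 unfolding bdens_def by (auto intro!: exI[of _ "real m"])
qed

lemma measure_type_dens_cell:
  assumes "j < m" shows "measure (tilt (par l) (type_dens m n N)) {x. cell m x = j} = N j / n"
proof -
  have "measure (tilt (par l) (type_dens m n N)) {x. cell m x = j} = (\<integral>x. type_dens m n N x * indicator {x. cell m x = j} x \<partial>par l)"
    using bdensD[OF pos_law_par bdens_type_dens] cell_sets[OF m] by (intro measure_tilt[OF pos_law_par])
  also have "\<dots> = (\<integral>x. (\<lambda>i. if i = j then real m * real (N j) / n else 0) (cell m x) \<partial>par l)"
    by (intro Bochner_Integration.integral_cong) (auto simp: type_dens_def indicator_def)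
  also have "\<dots> = (\<Sum>i<m. if i = j then real m * real (N j) / n else 0) / m"
    by (rule integral_cell[OF m])
  also have "\<dots> = N j / n"
    using assms m by (simp add: sum.delta)
  finally show ?thesis .
qed

lemma ent_type_dens: "ent (par l) (type_dens m n N) = (\<Sum>j<m. N j * ln (real m * real (N j) / n)) / n"
proof -
  have "ent (par l) (type_dens m n N) = (\<Sum>j<m. real m * real (N j) / n * ln (real m * real (N j) / n)) / m"
    unfolding ent_def type_dens_def
    by (rule integral_cell[OF m, of "\<lambda>j. real m * real (N j) / n * ln (real m * real (N j) / n)"])
  also have "\<dots> = (\<Sum>j<m. N j * ln (real m * real (N j) / n)) / n"
    using m n by (simp add: sum_divide_distrib)
  finally show ?thesis .
qed

definition tclass :: "(nat \<Rightarrow> real) set" where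
  "tclass = {x \<in> space (iid (par l) n). \<forall>j<m. (\<Sum>i<n. indicator {y. cell m y = j} (x i)) = real (N j)}"

lemma tclass_sets: "tclass \<in> sets (iid (par l) n)"
proof -
  define f where "f j x = (\<Sum>i<n. indicator {y. cell m y = j} (x i) :: real)" for j :: nat and x :: "nat \<Rightarrow> real"
  have ind: "(indicator {y. cell m y = j} :: real \<Rightarrow> real) \<in> borel_measurable (par l)" for j
    using cell_sets[OF m] by (intro borel_measurable_indicator) simp
  have [measurable]: "f j \<in> borel_measurable (iid (par l) n)" for j
    unfolding f_def
  proof (rule borel_measurable_sum)
    fix i assume i: "i \<in> {..<n}"
    have "(\<lambda>x. x i) \<in> iid (par l) n \<rightarrow>\<^sub>M par l" using i by (rule measurable_component_singleton)
    from measurable_compose[OF this ind]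
    show "(\<lambda>x. indicator {y. cell m y = j} (x i) :: real) \<in> borel_measurable (iid (par l) n)" .
  qed
  show ?thesis unfolding tclass_def f_def[symmetric] by measurable
qed

text \<open>The type class has probability at most 1 under the law of its own type, where the likelihood ratio is constant.\<close>

lemma measure_tclass_le: "measure (iid (par l) n) tclass \<le> exp (- (real n * ent (par l) (type_dens m n N)))"
proof -
  define q where "q = type_dens m n N"
  define h where "h = ent (par l) q"
  define Q where "Q = tilt (par l) q"
  note D = bdensD[OF pos_law_par bdens_type_dens, folded q_def]
  note [measurable] = D(1)
  have Q: "pos_law Q" unfolding Q_def q_def by (rule pos_law_tilt[OF pos_law_par bdens_type_dens])
  interpret Qn: prob_space "iid Q n" by (rule prob_space_iid[OF pos_lawD(1)[OF Q]])
  interpret Pn: prob_space "iid (par l) n" by (rule prob_space_iid[OF P.prob_space_axioms])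
  have lik: "(\<Prod>i<n. ennreal (q (x i))) = ennreal (exp (n * h))" if x: "x \<in> tclass" for x
  proof -
    have cnt: "(\<Sum>i<n. indicator {y. cell m y = j} (x i)) = real (N j)" if "j < m" for j
      using x that by (auto simp: tclass_def)
    \<comment> \<open>The cell of a sample point is hit at least once, so its count, and with it the
      density there, is positive and the logarithms are genuine.\<close>
    have pos: "q (x i) > 0" if i: "i < n" for i
    proof -
      have "1 \<le> (\<Sum>k<n. indicator {y. cell m y = cell m (x i)} (x k) :: real)"
        using member_le_sum[of i "{..<n}" "\<lambda>k. indicator {y. cell m y = cell m (x i)} (x k) :: real"] i by simp
      then have "N (cell m (x i)) > 0" using cnt[OF cell_less[OF m]] by simp
      then show ?thesis using m n by (simp add: q_def type_dens_def)
    qed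
    have "(\<Sum>i<n. ln (q (x i))) = (\<Sum>i<n. \<Sum>j<m. ln (real m * real (N j) / n) * indicator {y. cell m y = j} (x i))"
      unfolding q_def type_dens_def by (rule sum.cong[OF refl], rule cell_sum[OF m, of "\<lambda>j. ln (real m * real (N j) / n)"])
    also have "\<dots> = (\<Sum>j<m. ln (real m * real (N j) / n) * (\<Sum>i<n. indicator {y. cell m y = j} (x i)))"
      by (subst sum.swap) (simp add: sum_distrib_left)
    also have "\<dots> = n * h" unfolding h_def q_def ent_type_dens using n cnt by (simp add: mult.commute)
    finally have "exp (n * h) = (\<Prod>i<n. exp (ln (q (x i))))" by (simp add: exp_sum[symmetric])
    also have "\<dots> = (\<Prod>i<n. q (x i))" using pos by (intro prod.cong) auto
    finally show ?thesis using D(2) by (simp add: prod_ennreal)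
  qed
  have eq: "iid Q n = density (iid (par l) n) (\<lambda>x. \<Prod>i<n. ennreal (q (x i)))"
    unfolding Q_def tilt_def
  proof (rule iid_density)
    show "(\<lambda>x. ennreal (q x)) \<in> borel_measurable (par l)" by measurable
  qed (use pos_lawD(1)[OF Q] in \<open>simp_all add: Q_def tilt_def P.prob_space_axioms\<close>)
  have me: "(\<lambda>x. \<Prod>i<n. ennreal (q (x i))) \<in> borel_measurable (iid (par l) n)" by measurable
  have "emeasure (iid Q n) tclass = (\<integral>\<^sup>+x. (\<Prod>i<n. ennreal (q (x i))) * indicator tclass x \<partial>iid (par l) n)"
    unfolding eq by (rule emeasure_density[OF me tclass_sets])
  also have "\<dots> = (\<integral>\<^sup>+x. ennreal (exp (n * h)) * indicator tclass x \<partial>iid (par l) n)"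
    using lik by (intro nn_integral_cong) (auto split: split_indicator)
  also have "\<dots> = ennreal (exp (n * h)) * emeasure (iid (par l) n) tclass"
    by (rule nn_integral_cmult_indicator[OF tclass_sets])
  also have "\<dots> = ennreal (exp (n * h) * measure (iid (par l) n) tclass)"
    by (simp add: Pn.emeasure_eq_measure ennreal_mult)
  finally have "exp (n * h) * measure (iid (par l) n) tclass = measure (iid Q n) tclass"
    by (simp add: Qn.emeasure_eq_measure)
  also have "\<dots> \<le> 1" by (rule Qn.prob_le_1)
  finally show ?thesis unfolding h_def[symmetric] q_def[symmetric] by (simp add: exp_minus inverse_eq_divide pos_le_divide_eq mult.commute)
qed

text \<open>Donsker-Varadhan with \<open>ln m\<close> times the indicator of the heavy cell: the
  exponential moment stays below 2, while the mean is at least \<open>k * ln m\<close>. A fixed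
  share of mass in one of many cells is thus arbitrarily expensive.\<close>

lemma ent_type_dens_large:
  fixes k :: real
  assumes j: "j < m" "real (N j) \<ge> k * n" and k: "k \<ge> 0" shows "k * ln m - ln 2 \<le> ent (par l) (type_dens m n N)"
proof -
  define f where "f = (\<lambda>x. ln (real m) * indicator {x. cell m x = j} x)"
  have f: "f \<in> borel_measurable borel" "\<And>x. \<bar>f x\<bar> \<le> ln (real m)"
  proof -
    show "f \<in> borel_measurable borel"
      unfolding f_def using cell_sets[OF m]
      by (intro borel_measurable_times borel_measurable_const borel_measurable_indicator)
    have "0 \<le> ln (real m)" using m by simp
    then show "\<bar>f x\<bar> \<le> ln (real m)" for x by (simp add: f_def indicator_def)
  qed
  note D = bdensD[OF pos_law_par bdens_type_dens]
  have "(\<integral>x. type_dens m n N x * f x \<partial>par l) = ln m * (\<integral>x. type_dens m n N x * indicator {x. cell m x = j} x \<partial>par l)"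
    unfolding f_def by (subst integral_mult_right_zero[symmetric]) (simp add: mult_ac)
  also have "\<dots> = ln m * (N j / n)"
    using measure_type_dens_cell[OF j(1)] measure_tilt[OF pos_law_par D(1,2) cell_sets[OF m, of j]] by simp
  finally have 1: "(\<integral>x. type_dens m n N x * f x \<partial>par l) = ln m * (N j / n)" .
  have "(\<integral>x. exp (f x) \<partial>par l) = (\<integral>x. (\<lambda>i. if i = j then real m else 1) (cell m x) \<partial>par l)"
    using m by (intro Bochner_Integration.integral_cong) (auto simp: f_def indicator_def)
  also have "\<dots> = (\<Sum>i<m. if i = j then real m else 1) / m" by (rule integral_cell[OF m])
  also have "(\<Sum>i<m. if i = j then real m else 1) = (\<Sum>i<m. 1 + (if i = j then real m - 1 else 0))"
    by (intro sum.cong) auto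
  also have "\<dots> = 2 * real m - 1" using j by (simp add: sum.distrib sum.delta)
  finally have 2: "(\<integral>x. exp (f x) \<partial>par l) = (2 * real m - 1) / m" by simp
  have "(2 * real m - 1) / m \<le> 2" using m by (simp add: field_simps)
  moreover have "0 < (2 * real m - 1) / m" using m by simp
  ultimately have "ln ((2 * real m - 1) / m) \<le> ln 2" by simp
  moreover have "k * ln m \<le> ln m * (N j / n)"
    unfolding mult.commute[of k] using j n m by (intro mult_left_mono) (auto simp: le_divide_eq)
  moreover have "ln m * (N j / n) \<le> ent (par l) (type_dens m n N) + ln ((2 * real m - 1) / m)"
    using donsker_varadhan[OF pos_law_par bdens_type_dens f] unfolding 1 2 .
  ultimately show ?thesis by linarith
qed

end

end

text \<open>Method of types: up to a polynomial factor, the probability is the largest type-class probability among the types that are either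
  compatible with the event or concentrated on few cells.\<close>

lemma Vn_upper_bound:
  assumes l: "l > 0" and st: "s < t"
    and L: "\<And>q. bdens (par l) q \<Longrightarrow> s \<le> Vf (tilt (par l) q) \<Longrightarrow> L \<le> ent (par l) q"
  shows "\<exists>m. \<forall>\<^sub>F n in sequentially.
    \<P>(x in iid (par l) n. t \<le> Vn n x) \<le> (real n + 1) ^ m * exp (- (real n * L))"
proof -
  interpret P: prob_space "par l" by (rule prob_space_par[OF l])
  \<comment> \<open>Half of \<open>t - s\<close> pays for Kolmogorov distance \<open>k\<close>
    through the Lipschitz constant 5, the other half for \<open>1 / n \<le> 5 * k\<close>.\<close>
  define k where "k = (t - s) / 10"
  have k: "k > 0" using st by (simp add: k_def)
  \<comment> \<open>\<open>m\<close> is so large that any type with a cell of mass more than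
    \<open>k\<close> already has entropy at least \<open>L\<close>; it does not depend on
    \<open>n\<close>.\<close>
  obtain m :: nat where m0: "exp ((L + ln 2) / k) < m" using reals_Archimedean2 by blast
  have m: "m > 0" using m0 exp_gt_zero[of "(L + ln 2) / k"] by (cases m) auto
  have "(L + ln 2) / k \<le> ln m" using m0 m by (simp add: ln_ge_iff less_imp_le)
  then have km: "L \<le> k * ln m - ln 2" using k by (simp add: divide_le_eq mult.commute)
  have "\<P>(x in iid (par l) n. t \<le> Vn n x) \<le> (real n + 1) ^ m * exp (- (real n * L))"
    if n: "n \<ge> 2" "1 / real n \<le> 5 * k" for n
  proof -
    interpret I: prob_space "iid (par l) n" by (rule prob_space_iid[OF P.prob_space_axioms])
    \<comment> \<open>The types that matter; each is a function from \<open>m\<close> cells to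
      counts at most \<open>n\<close>, which explains the polynomial factor.\<close>
    define \<N> where "\<N> = {N \<in> {..<m} \<rightarrow>\<^sub>E {..n}. (\<Sum>j<m. N j) = n \<and> L \<le> ent (par l) (type_dens l m n N)}"
    have fin': "finite ({..<m} \<rightarrow>\<^sub>E {..n})" by (intro finite_PiE) auto
    have fin: "finite \<N>" unfolding \<N>_def using fin' by simp
    have "card \<N> \<le> card ({..<m} \<rightarrow>\<^sub>E {..n})" unfolding \<N>_def by (intro card_mono fin') auto
    then have "card \<N> \<le> Suc n ^ m" by (simp add: card_PiE)
    then have "real (card \<N>) \<le> real (Suc n ^ m)" by (rule of_nat_mono)
    then have card: "real (card \<N>) \<le> (real n + 1) ^ m" by (simp add: add.commute)
    have ts: "tclass l m n N \<in> sets (iid (par l) n)" if "N \<in> \<N>" for N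
      using that n m by (intro tclass_sets[OF l]) (auto simp: \<N>_def)
    have "AE x in iid (par l) n. \<forall>i<n. 0 < x i"
      by (rule AE_iid[OF P.prob_space_axioms]) (rule pos_lawD(3)[OF pos_law_par[OF l]])
    moreover have "AE x in iid (par l) n. x \<in> space (iid (par l) n)" by (rule AE_space)
    ultimately have "AE x in iid (par l) n. x \<in> {x \<in> space (iid (par l) n). t \<le> Vn n x} \<longrightarrow> x \<in> (\<Union>N\<in>\<N>. tclass l m n N)"
    proof eventually_elim
      case (elim x)
      show ?case
      proof
        assume "x \<in> {x \<in> space (iid (par l) n). t \<le> Vn n x}"
        then have tV: "t \<le> Vn n x" by simp
        define c where "c j = (\<Sum>i<n. if cell l m (x i) = j then 1 else 0 :: nat)" for j
        define N where "N = restrict c {..<m}"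
        have Nc: "N j = c j" if "j < m" for j using that by (simp add: N_def)
        have sumN: "(\<Sum>j<m. N j) = n"
        proof -
          have "(\<Sum>j<m. N j) = (\<Sum>j<m. c j)" by (intro sum.cong) (simp_all add: N_def)
          also have "\<dots> = (\<Sum>i<n. \<Sum>j<m. if cell l m (x i) = j then 1 else 0)"
            unfolding c_def by (rule sum.swap)
          also have "\<dots> = (\<Sum>i<n. 1)" using cell_less[OF l m] by (intro sum.cong) (simp_all add: sum.delta')
          finally show ?thesis by simp
        qed
        have "c j \<le> (\<Sum>i<n. 1)" for j unfolding c_def by (intro sum_mono) auto
        then have Npi: "N \<in> {..<m} \<rightarrow>\<^sub>E {..n}" by (auto simp: N_def)
        have n0: "n > 0" using n by simp
        have "x \<in> tclass l m n N"
          unfolding tclass_def[OF l m n0 sumN]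
        proof (intro CollectI conjI allI impI)
          show "x \<in> space (iid (par l) n)" by (rule elim(2))
          fix j assume "j < m"
          then have "real (N j) = (\<Sum>i<n. real (if cell l m (x i) = j then 1 else 0))"
            using Nc[OF \<open>j < m\<close>] by (simp only: c_def of_nat_sum)
          also have "\<dots> = (\<Sum>i<n. indicator {y. cell l m y = j} (x i))"
            by (intro sum.cong) (auto simp: indicator_def)
          finally show "(\<Sum>i<n. indicator {y. cell l m y = j} (x i)) = real (N j)" by (rule sym)
        qed
        moreover have "L \<le> ent (par l) (type_dens l m n N)"
        \<comment> \<open>Either some cell is heavy and the entropy is large, or all cells are
          light, the smoothed type is Kolmogorov-close to the empirical law, and the hypothesis on
          \<open>L\<close> applies to it.\<close>
        proof (cases "\<exists>j<m. k * n < N j")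
          case True
          then obtain j where "j < m" "k * n < N j" by auto
          then have "k * ln m - ln 2 \<le> ent (par l) (type_dens l m n N)"
            using k by (intro ent_type_dens_large[OF l m n0 sumN]) auto
          then show ?thesis using km by linarith
        next
          case False
          let ?Q = "tilt (par l) (type_dens l m n N)"
          have Q: "pos_law ?Q" by (intro pos_law_tilt pos_law_par[OF l] bdens_type_dens[OF l m n0 sumN])
          have emp: "pos_law (emp n x)" using elim(1) n0 by (intro pos_law_emp) auto
          have empj: "measure (emp n x) {y. cell l m y = j} = (if j < m then N j / n else 0)" for j
          proof (cases "j < m")
            case True
            have "card {i. i < n \<and> x i \<in> {y. cell l m y = j}} = c j"
              unfolding c_def by (simp add: sum.If_cases Int_def)
            then show ?thesis using True measure_emp[OF cell_sets[OF l m], of n x j] Nc by simp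
          next
            case False
            then have "{y. cell l m y = j} = {}" using cell_less[OF l m] by auto
            then show ?thesis using False by simp
          qed
          have Qj: "measure ?Q {y. cell l m y = j} = (if j < m then N j / n else 0)" for j
          proof (cases "j < m")
            case True
            then show ?thesis using measure_type_dens_cell[OF l m n0 sumN True] by simp
          next
            case False
            then have "{y. cell l m y = j} = {}" using cell_less[OF l m] by auto
            then show ?thesis using False by simp
          qed
          have "kclose k (emp n x) ?Q"
          proof (rule kclose_cells[OF emp Q cell_mono[OF l] cell_sets[OF l m]])
            fix j
            show "measure (emp n x) {y. cell l m y = j} \<le> k"
            proof (cases "j < m")
              case True
              then have "real (N j) \<le> k * n" using False by (meson not_less)
              then show ?thesis unfolding empj using True n0 by (simp add: divide_le_eq)
            qed (use empj k in auto)
          qed (simp_all add: empj Qj)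
          from Vn_kclose[of n x, OF n(1) _ Q this] elim(1)
          have "\<bar>Vn n x - Vf ?Q\<bar> \<le> 5 * k + 1 / n" by simp
          then have "Vn n x - Vf ?Q \<le> 5 * k + 1 / n" by (rule abs_le_D1)
          moreover have "10 * k = t - s" by (simp add: k_def)
          ultimately have "s \<le> Vf ?Q" using tV n(2) by argo
          then show ?thesis by (intro L bdens_type_dens[OF l m n0 sumN])
        qed
        ultimately show "x \<in> (\<Union>N\<in>\<N>. tclass l m n N)" using Npi sumN unfolding \<N>_def by blast
      qed
    qed
    then have "\<P>(x in iid (par l) n. t \<le> Vn n x) \<le> measure (iid (par l) n) (\<Union>N\<in>\<N>. tclass l m n N)"
      by (rule I.finite_measure_mono_AE) (use fin ts in auto)
    also have "\<dots> \<le> (\<Sum>N\<in>\<N>. measure (iid (par l) n) (tclass l m n N))"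
      using fin ts by (intro I.finite_measure_subadditive_finite) auto
    also have "\<dots> \<le> (\<Sum>N\<in>\<N>. exp (- (real n * L)))"
    proof (rule sum_mono)
      fix N assume N: "N \<in> \<N>"
      then have "measure (iid (par l) n) (tclass l m n N) \<le> exp (- (real n * ent (par l) (type_dens l m n N)))"
        using n by (intro measure_tclass_le[OF l m]) (auto simp: \<N>_def)
      also have "\<dots> \<le> exp (- (real n * L))" using N by (simp add: \<N>_def mult_left_mono)
      finally show "measure (iid (par l) n) (tclass l m n N) \<le> exp (- (real n * L))" .
    qed
    also have "\<dots> \<le> (real n + 1) ^ m * exp (- (real n * L))" using card by simp
    finally show ?thesis .
  qed
  moreover have "\<forall>\<^sub>F n in sequentially. n \<ge> 2 \<and> 1 / real n \<le> 5 * k"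
  proof -
    have "(\<lambda>n. 1 / real n) \<longlonglongrightarrow> 0" by (rule lim_1_over_n)
    then have "\<forall>\<^sub>F n in sequentially. 1 / real n < 5 * k" using k by (intro order_tendstoD(2)) auto
    then show ?thesis using eventually_ge_at_top[of 2] by eventually_elim auto
  qed
  ultimately show ?thesis by (intro exI[of _ m]) (auto elim: eventually_mono)
qed

section \<open>Small entropies\<close>

lemma abs_exp_le_cubic: "\<bar>y::real\<bar> \<le> 1 \<Longrightarrow> exp y \<le> 1 + y + y^2 / 2 + \<bar>y\<bar>^3"
proof -
  assume y: "\<bar>y\<bar> \<le> 1"
  obtain t where t: "\<bar>t\<bar> \<le> \<bar>y\<bar>" "exp y = (\<Sum>m<3. y ^ m / fact m) + exp t / fact 3 * y ^ 3"
    using Maclaurin_exp_le[of y 3] by auto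
  have "exp t \<le> exp 1" using t y by simp
  then have e: "exp t \<le> 3" using exp_le by linarith
  have "exp t / fact 3 * y ^ 3 \<le> exp t / fact 3 * \<bar>y\<bar> ^ 3"
    by (intro mult_left_mono) (auto simp: power_abs[symmetric])
  also have "\<dots> \<le> 1 * \<bar>y\<bar> ^ 3" using e by (intro mult_right_mono) (auto simp: fact_numeral)
  finally show ?thesis using t(2) by (simp add: eval_nat_numeral)
qed

lemma ln_upper_cubic: "(y::real) > -1 \<Longrightarrow> ln (1 + y) \<le> y - y^2 / 2 + y^3 / 3"
proof -
  assume y: "y > -1"
  define f where "f x = x - x^2 / 2 + x^3 / 3 - ln (1 + x)" for x :: real
  have der: "(f has_real_derivative x^3 / (1 + x)) (at x)" if "x > -1" for x
  proof -
    have "(f has_real_derivative (1 - x + x^2 - 1 / (1 + x))) (at x)"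
      unfolding f_def using that by (auto intro!: derivative_eq_intros simp: field_simps power2_eq_square)
    also have "1 - x + x^2 - 1 / (1 + x) = x^3 / (1 + x)"
      using that by (simp add: field_simps power2_eq_square power3_eq_cube)
    finally show ?thesis .
  qed
  have "f 0 \<le> f y"
  proof (cases "y \<ge> 0")
    case True
    show ?thesis
    proof (rule DERIV_nonneg_imp_nondecreasing[OF True])
      fix x assume "0 \<le> x" "x \<le> y"
      then show "\<exists>z. DERIV f x :> z \<and> 0 \<le> z" using der[of x] by (intro exI[of _ "x^3 / (1 + x)"]) auto
    qed
  next
    case False
    show ?thesis
    proof (rule DERIV_nonpos_imp_nonincreasing[of y 0 f])
      show "y \<le> 0" using False by simp
      fix x assume x: "y \<le> x" "x \<le> 0"
      then have "x^3 / (1 + x) \<le> 0" using y by (intro divide_nonpos_pos) auto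
      then show "\<exists>z. DERIV f x :> z \<and> z \<le> 0" using der[of x] x y by auto
    qed
  qed
  then show ?thesis by (simp add: f_def)
qed

lemma ln_lower_cubic: "- 1 / 2 \<le> (y::real) \<Longrightarrow> y \<le> 0 \<Longrightarrow> y - y^2 / 2 + y^3 \<le> ln (1 + y)"
proof -
  assume y: "- 1 / 2 \<le> y" "y \<le> 0"
  define f where "f x = ln (1 + x) - (x - x^2 / 2 + x^3)" for x :: real
  have "f 0 \<le> f y"
  proof (rule DERIV_nonpos_imp_nonincreasing[OF y(2)])
    fix x assume x: "y \<le> x" "x \<le> 0"
    have x1: "1 + x > 0" "1 + x \<ge> 1 / 2" using x y by auto
    have "(f has_real_derivative (1 / (1 + x) - (1 - x + 3 * x^2))) (at x)"
      unfolding f_def using x1 by (auto intro!: derivative_eq_intros simp: field_simps power2_eq_square)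
    also have "1 / (1 + x) - (1 - x + 3 * x^2) = x^2 * (1 / (1 + x) - 3)"
      using x1 by (simp add: field_simps power2_eq_square)
    finally have "(f has_real_derivative x^2 * (1 / (1 + x) - 3)) (at x)" .
    moreover have "x^2 * (1 / (1 + x) - 3) \<le> 0"
      using x1 by (intro mult_nonneg_nonpos) (auto simp: divide_le_eq)
    ultimately show "\<exists>z. DERIV f x :> z \<and> z \<le> 0" by auto
  qed
  then show ?thesis by (simp add: f_def)
qed

text \<open>Only the lower end of the range is restricted: for large \<open>y\<close> the cubic
  error dominates \<open>y * (1 + y)\<close>, so unbounded densities are covered. The bound below
  keeps the argument of \<open>ln\<close> away from 0.\<close>

lemma entropy_taylor:
  fixes y :: real assumes y: "- 1 / 2 \<le> y"
  shows "\<bar>(1 + y) * ln (1 + y) - y - y^2 / 2\<bar> \<le> \<bar>y\<bar>^3"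
proof -
  have up: "(1 + y) * ln (1 + y) \<le> y + y^2 / 2 + \<bar>y\<bar>^3"
  proof (cases "y \<le> 1")
    case True
    have "(1 + y) * ln (1 + y) \<le> (1 + y) * (y - y^2 / 2 + y^3 / 3)"
      using y by (intro mult_left_mono ln_upper_cubic) auto
    also have "\<dots> = y + y^2 / 2 + y^3 * (y / 3 - 1 / 6)"
      by (simp add: field_simps power2_eq_square power3_eq_cube)
    also have "y^3 * (y / 3 - 1 / 6) \<le> \<bar>y^3\<bar> * \<bar>y / 3 - 1 / 6\<bar>"
      by (metis abs_ge_self abs_mult)
    also have "\<dots> \<le> \<bar>y^3\<bar> * 1" using True y by (intro mult_left_mono) auto
    finally show ?thesis by (simp add: power_abs)
  next
    case False
    then have "(1 + y) * ln (1 + y) \<le> (1 + y) * y"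
      using y by (intro mult_left_mono ln_add_one_self_le_self) auto
    also have "\<dots> = y + y^2 / 2 + y^2 * (1 / 2)" by (simp add: power2_eq_square field_simps)
    also have "y^2 * (1 / 2) \<le> y^2 * y" using False by (intro mult_left_mono) auto
    finally show ?thesis using False by (simp add: power2_eq_square power3_eq_cube)
  qed
  have lo: "y + y^2 / 2 - \<bar>y\<bar>^3 \<le> (1 + y) * ln (1 + y)"
  proof (cases "y \<ge> 0")
    case True
    have "(1 + y) * (y - y^2 / 2) \<le> (1 + y) * ln (1 + y)"
    proof (rule mult_left_mono)
      define f where "f x = ln (1 + x) - (x - x^2 / 2)" for x :: real
      have "f 0 \<le> f y"
      proof (rule DERIV_nonneg_imp_nondecreasing[OF True])
        fix x assume x: "0 \<le> x" "x \<le> y"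
        have "(f has_real_derivative (1 / (1 + x) - (1 - x))) (at x)"
          unfolding f_def using x by (auto intro!: derivative_eq_intros simp: field_simps)
        also have "1 / (1 + x) - (1 - x) = x^2 / (1 + x)" using x by (simp add: field_simps power2_eq_square)
        finally show "\<exists>z. DERIV f x :> z \<and> 0 \<le> z" using x by (intro exI[of _ "x^2 / (1 + x)"]) auto
      qed
      then show "y - y^2 / 2 \<le> ln (1 + y)" by (simp add: f_def)
    qed (use True in simp)
    moreover have "(1 + y) * (y - y^2 / 2) = y + y^2 / 2 - y^3 / 2"
      by (simp add: field_simps power2_eq_square power3_eq_cube)
    moreover have "0 \<le> y^3" "\<bar>y\<bar>^3 = y^3" using True by simp_all
    ultimately show ?thesis by linarith
  next
    case False
    have "(1 + y) * (y - y^2 / 2 + y^3) \<le> (1 + y) * ln (1 + y)"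
      using y False by (intro mult_left_mono ln_lower_cubic) auto
    moreover have "(1 + y) * (y - y^2 / 2 + y^3) = y + y^2 / 2 + y^3 / 2 + (y^2)^2"
      by (simp add: field_simps power2_eq_square power3_eq_cube)
    moreover have "y^3 \<le> 0" using False by (simp add: power_le_zero_eq)
    moreover have "\<bar>y\<bar>^3 = - (y^3)" using False by (simp add: power_abs[symmetric] calculation)
    moreover have "0 \<le> (y^2)^2" by simp
    ultimately show ?thesis by linarith
  qed
  show ?thesis using up lo by linarith
qed

text \<open>Unlike \<open>bdens\<close> it allows unbounded densities, because the logarithmic term
  makes the alternatives unbounded relative to the Pareto law when its coefficient is not 0.\<close>

definition dens :: "real measure \<Rightarrow> (real \<Rightarrow> real) \<Rightarrow> bool" where
  "dens P q \<longleftrightarrow> q \<in> borel_measurable borel \<and> (\<forall>x. 0 \<le> q x) \<and> has_bochner_integral P q 1"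

section \<open>Second-order expansion of the limit functional around the Pareto law\<close>

context
  fixes l :: real assumes l: "l > 0"
begin

interpretation P: prob_space "par l" by (rule prob_space_par[OF l])

lemma bdens_dens: "bdens (par l) q \<Longrightarrow> dens (par l) q"
  using bdensD[OF pos_law_par[OF l]] by (auto simp: dens_def has_bochner_integral_iff)

lemma densD:
  assumes "dens (par l) q"
  shows "q \<in> borel_measurable borel" "\<And>x. 0 \<le> q x" "(\<integral>x. q x \<partial>par l) = 1" "integrable (par l) q" "pos_law (tilt (par l) q)"
    "integrable (par l) (\<lambda>x. q x - 1)"
  using assms prob_space_density[OF pos_law_par[OF l], of q] by (auto simp: dens_def has_bochner_integral_iff)

lemma dens_integrable_mult:
  assumes q: "integrable (par l) q" and f: "f \<in> borel_measurable borel" "\<And>x. \<bar>f x\<bar> \<le> K"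
  shows "integrable (par l) (\<lambda>x. q x * f x :: real)"
proof (rule Bochner_Integration.integrable_bound[of _ "\<lambda>x. K * q x"])
  show "(\<lambda>x. q x * f x) \<in> borel_measurable (par l)" using f borel_measurable_integrable[OF q] by simp
  show "AE x in par l. norm (q x * f x) \<le> norm (K * q x)"
  proof (rule AE_I2)
    fix x
    have "\<bar>f x\<bar> * \<bar>q x\<bar> \<le> \<bar>K\<bar> * \<bar>q x\<bar>" using f(2)[of x] by (intro mult_right_mono) auto
    then show "norm (q x * f x) \<le> norm (K * q x)" by (simp add: abs_mult mult.commute)
  qed
qed (use q in auto)

definition GQ :: "(real \<Rightarrow> real) \<Rightarrow> real \<Rightarrow> real \<Rightarrow> real" where
  "GQ q t x = measure (tilt (par l) q) (win t x)"

lemma GQ_props: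
  assumes "dens (par l) q"
  shows "GQ q t \<in> borel_measurable borel" "\<bar>GQ q t x\<bar> \<le> 1" "GQ q t x = (\<integral>y. q y * indicator (win t x) y \<partial>par l)"
proof -
  note D = densD[OF assms]
  note Q = pos_lawD[OF D(5)]
  show "GQ q t \<in> borel_measurable borel"
    unfolding GQ_def using Q by (intro measure_win_measurable)
  show "\<bar>GQ q t x\<bar> \<le> 1" unfolding GQ_def using prob_space.prob_le_1[OF Q(1)] by simp
  show "GQ q t x = (\<integral>y. q y * indicator (win t x) y \<partial>par l)"
    unfolding GQ_def by (rule measure_tilt[OF pos_law_par[OF l] D(1,2)]) simp
qed

lemma dens_one: "dens (par l) (\<lambda>_. 1)"
  using has_bochner_integral_par_one[OF l] by (simp add: dens_def)

lemma GQ_one: "GQ (\<lambda>_. 1) t x = measure (par l) (win t x)"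
  using GQ_props(3)[OF dens_one, of t x] by simp

lemma GQ_diff_le:
  assumes "dens (par l) q" "dens (par l) r"
  shows "\<bar>GQ q t x - GQ r t x\<bar> \<le> (\<integral>y. \<bar>q y - r y\<bar> \<partial>par l)"
proof -
  note D = densD[OF assms(1)] densD[OF assms(2)]
  have i: "integrable (par l) (\<lambda>y. q y * indicator (win t x) y)" "integrable (par l) (\<lambda>y. r y * indicator (win t x) y)"
    using D by (auto intro!: dens_integrable_mult[of _ _ 1] simp: indicator_def)
  have "GQ q t x - GQ r t x = (\<integral>y. q y * indicator (win t x) y - r y * indicator (win t x) y \<partial>par l)"
    using i by (simp add: GQ_props(3)[OF assms(1)] GQ_props(3)[OF assms(2)])
  also have "\<bar>\<dots>\<bar> \<le> (\<integral>y. \<bar>q y * indicator (win t x) y - r y * indicator (win t x) y\<bar> \<partial>par l)"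
    by (rule integral_abs_bound)
  also have "\<dots> \<le> (\<integral>y. \<bar>q y - r y\<bar> \<partial>par l)"
    using D i by (intro integral_mono integrable_abs Bochner_Integration.integrable_diff) (auto simp: indicator_def)
  finally show ?thesis .
qed

text \<open>The pure second-order term: the window kernel integrated against \<open>q - 1\<close> in
  both arguments.\<close>

definition Rem :: "(real \<Rightarrow> real) \<Rightarrow> real \<Rightarrow> real" where
  "Rem q t = (\<integral>x. (q x - 1) * (GQ q t x - GQ (\<lambda>_. 1) t x) \<partial>par l)"

text \<open>Expanding the quadratic functional at \<open>q = 1\<close>: the value there vanishes
  because \<open>ps\<close> has mean 0, and by symmetry of the window the two first-order terms
  coincide, hence the factor 2.\<close>

lemma Phi_tilt:
  assumes q: "dens (par l) q" and t: "t \<ge> 1"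
  shows "Phi (tilt (par l) q) t = 2 * (\<integral>x. q x * ps l t x \<partial>par l) + Rem q t"
proof -
  note D = densD[OF q]
  note G = GQ_props(1,2)[OF q, where t=t] and G1 = GQ_props(1,2)[OF dens_one, where t=t]
  let ?G = "GQ q t" and ?H = "GQ (\<lambda>_. 1) t"
  have i: "integrable (par l) (\<lambda>x. q x * ?G x)" "integrable (par l) (\<lambda>x. q x * ?H x)"
    using D G G1 by (auto intro!: dens_integrable_mult[of _ _ 1])
  have i1: "integrable (par l) ?G" "integrable (par l) ?H"
    using G G1 by (auto intro!: P.integrable_const_bound[of _ 1])
  have i2: "integrable (par l) (\<lambda>x. q x * indicator {..t} x)"
    using D by (auto intro!: dens_integrable_mult[of _ _ 1] simp: indicator_def)
  have i3: "integrable (par l) (indicator {..t} :: real \<Rightarrow> real)"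
    by (auto intro!: P.integrable_const_bound[of _ 1] simp: indicator_def)
  have comm: "(\<integral>x. ?G x \<partial>par l) = (\<integral>x. q x * ?H x \<partial>par l)"
  proof -
    have "(\<integral>x. ?G x \<partial>par l) = (\<integral>x. measure (par l) (win t x) \<partial>tilt (par l) q)"
      unfolding GQ_def using t by (intro integral_measure_win_commute D pos_law_par l) auto
    also have "\<dots> = (\<integral>x. ?H x \<partial>tilt (par l) q)" unfolding GQ_one ..
    also have "\<dots> = (\<integral>x. q x * ?H x \<partial>par l)" by (rule integral_tilt[OF pos_law_par[OF l] D(1,2) G1(1)])
    finally show ?thesis .
  qed
  have R: "Rem q t = (\<integral>x. q x * ?G x \<partial>par l) - 2 * (\<integral>x. q x * ?H x \<partial>par l) + (\<integral>x. ?H x \<partial>par l)"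
  proof -
    have "Rem q t = (\<integral>x. q x * ?G x - q x * ?H x - ?G x + ?H x \<partial>par l)"
      unfolding Rem_def by (intro Bochner_Integration.integral_cong) (auto simp: algebra_simps)
    then show ?thesis using i i1 comm by simp
  qed
  have psH: "ps l t x = ?H x - indicator {..t} x / 2 - measure (par l) {..t} / 2" for x
    by (simp add: ps_def GQ_one)
  have "0 = (\<integral>x. ps l t x \<partial>par l)" using has_bochner_integral_ps[OF l t] by (simp add: has_bochner_integral_iff)
  also have "\<dots> = (\<integral>x. ?H x \<partial>par l) - measure (par l) {..t}"
    unfolding psH using i1 i3 P.prob_space by simp
  finally have H: "(\<integral>x. ?H x \<partial>par l) = measure (par l) {..t}" by simp
  have "(\<integral>x. q x * ps l t x \<partial>par l) = (\<integral>x. q x * ?H x - (q x * indicator {..t} x) / 2 - q x * (measure (par l) {..t} / 2) \<partial>par l)"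
    unfolding psH by (intro Bochner_Integration.integral_cong) (auto simp: algebra_simps)
  also have "\<dots> = (\<integral>x. q x * ?H x \<partial>par l) - (\<integral>x. q x * indicator {..t} x \<partial>par l) / 2 - measure (par l) {..t} / 2"
    using i i2 D by simp
  finally have p: "(\<integral>x. q x * ps l t x \<partial>par l) = (\<integral>x. q x * ?H x \<partial>par l) - measure (tilt (par l) q) {..t} / 2 - measure (par l) {..t} / 2"
    using measure_tilt[OF pos_law_par[OF l] D(1,2), of "{..t}"] by simp
  have "Phi (tilt (par l) q) t = (\<integral>x. q x * ?G x \<partial>par l) - measure (tilt (par l) q) {..t}"
    unfolding Phi_def GQ_def[symmetric] by (simp add: integral_tilt[OF pos_law_par[OF l] D(1,2) G(1)])
  then show ?thesis using R H p by linarith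
qed

text \<open>A difference of values of a quadratic form: one argument is changed from
  \<open>q\<close> to \<open>r\<close> at a time, and window masses differ by at most the L1
  distance of the densities.\<close>

lemma Rem_diff_le:
  assumes q: "dens (par l) q" and r: "dens (par l) r"
  shows "\<bar>Rem q t - Rem r t\<bar> \<le> (\<integral>x. \<bar>q x - r x\<bar> \<partial>par l) * ((\<integral>x. \<bar>q x - 1\<bar> \<partial>par l) + (\<integral>x. \<bar>r x - 1\<bar> \<partial>par l))"
proof -
  note D = densD[OF q] densD[OF r]
  note G = GQ_props(1,2)[OF q, where t=t] GQ_props(1,2)[OF r, where t=t] GQ_props(1,2)[OF dens_one, where t=t]
  let ?G = "GQ q t" and ?K = "GQ r t" and ?H = "GQ (\<lambda>_. 1) t"
  define d where "d = (\<integral>x. \<bar>q x - r x\<bar> \<partial>par l)"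
  define e where "e = (\<integral>x. \<bar>r x - 1\<bar> \<partial>par l)"
  have bnd: "\<bar>?G x - ?K x\<bar> \<le> d" "\<bar>?K x - ?H x\<bar> \<le> e" for x
    using GQ_diff_le[OF q r] GQ_diff_le[OF r dens_one] by (auto simp: d_def e_def)
  have ia: "integrable (par l) (\<lambda>x. q x - 1)" "integrable (par l) (\<lambda>x. q x - r x)"
    using D(6) Bochner_Integration.integrable_diff[OF D(4,10)] by auto
  have i: "integrable (par l) (\<lambda>x. (q x - 1) * (?G x - ?K x))"
    using D G bnd by (intro dens_integrable_mult[of _ _ d]) auto
  have i': "integrable (par l) (\<lambda>x. (q x - r x) * (?K x - ?H x))"
    using D G bnd by (intro dens_integrable_mult[of _ _ e]) auto
  have i2: "integrable (par l) (\<lambda>x. (q x - 1) * (?G x - ?H x))" "integrable (par l) (\<lambda>x. (r x - 1) * (?K x - ?H x))"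
    using D G GQ_diff_le[OF q dens_one] GQ_diff_le[OF r dens_one] by (auto intro!: dens_integrable_mult)
  have eq: "Rem q t - Rem r t = (\<integral>x. (q x - 1) * (?G x - ?K x) + (q x - r x) * (?K x - ?H x) \<partial>par l)"
    unfolding Rem_def Bochner_Integration.integral_diff[OF i2, symmetric]
    by (intro Bochner_Integration.integral_cong) (auto simp: algebra_simps)
  have "\<bar>Rem q t - Rem r t\<bar> \<le> (\<integral>x. \<bar>(q x - 1) * (?G x - ?K x) + (q x - r x) * (?K x - ?H x)\<bar> \<partial>par l)"
    unfolding eq by (rule integral_abs_bound)
  also have "\<dots> \<le> (\<integral>x. \<bar>q x - 1\<bar> * d + \<bar>q x - r x\<bar> * e \<partial>par l)"
  proof (rule integral_mono)
    show "integrable (par l) (\<lambda>x. \<bar>(q x - 1) * (?G x - ?K x) + (q x - r x) * (?K x - ?H x)\<bar>)" 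
      by (intro integrable_abs Bochner_Integration.integrable_add i i')
    show "integrable (par l) (\<lambda>x. \<bar>q x - 1\<bar> * d + \<bar>q x - r x\<bar> * e)"
      by (intro Bochner_Integration.integrable_add integrable_mult_left integrable_abs ia(1) ia(2))
    fix x
    have "\<bar>(q x - 1) * (?G x - ?K x) + (q x - r x) * (?K x - ?H x)\<bar> \<le> \<bar>q x - 1\<bar> * \<bar>?G x - ?K x\<bar> + \<bar>q x - r x\<bar> * \<bar>?K x - ?H x\<bar>"
      by (rule order_trans[OF abs_triangle_ineq]) (simp add: abs_mult)
    also have "\<dots> \<le> \<bar>q x - 1\<bar> * d + \<bar>q x - r x\<bar> * e" using bnd by (intro add_mono mult_left_mono) auto
    finally show "\<bar>(q x - 1) * (?G x - ?K x) + (q x - r x) * (?K x - ?H x)\<bar> \<le> \<bar>q x - 1\<bar> * d + \<bar>q x - r x\<bar> * e" .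
  qed
  also have "\<dots> = d * ((\<integral>x. \<bar>q x - 1\<bar> \<partial>par l) + e)"
  proof -
    have "(\<integral>x. \<bar>q x - 1\<bar> * d + \<bar>q x - r x\<bar> * e \<partial>par l) = (\<integral>x. \<bar>q x - 1\<bar> * d \<partial>par l) + (\<integral>x. \<bar>q x - r x\<bar> * e \<partial>par l)"
      by (intro Bochner_Integration.integral_add integrable_mult_left integrable_abs ia)
    also have "\<dots> = (\<integral>x. \<bar>q x - 1\<bar> \<partial>par l) * d + d * e"
      unfolding integral_mult_left_zero d_def ..
    finally show ?thesis by (simp add: algebra_simps)
  qed
  finally show ?thesis unfolding d_def e_def .
qed

lemma abs_Rem_le: "dens (par l) q \<Longrightarrow> \<bar>Rem q t\<bar> \<le> (\<integral>x. \<bar>q x - 1\<bar> \<partial>par l)^2"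
  using Rem_diff_le[OF _ dens_one, of q t] by (simp add: Rem_def power2_eq_square)

end

section \<open>Bounding the statistic by the entropy\<close>

context
  fixes l :: real assumes l: "l > 0"
begin

interpretation P: prob_space "par l" by (rule prob_space_par[OF l])

text \<open>Donsker-Varadhan for \<open>c * f\<close>, with the log-moment expanded to third order,
  divided by \<open>c\<close>. The free parameter \<open>c\<close> is later taken of the order of
  the level.\<close>

lemma mean_bound:
  assumes q: "bdens (par l) q" and f: "f \<in> borel_measurable borel" "\<And>x. \<bar>f x\<bar> \<le> 1"
    and f0: "(\<integral>x. f x \<partial>par l) = 0" and c: "0 < c" "c \<le> 1"
  shows "(\<integral>x. q x * f x \<partial>par l) \<le> ent (par l) q / c + c * (\<integral>x. (f x)^2 \<partial>par l) / 2 + c^2"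
proof -
  define s where "s = (\<integral>x. (f x)^2 \<partial>par l)"
  have f1: "integrable (par l) f" using f by (intro P.integrable_const_bound[of _ 1]) auto
  have f2: "integrable (par l) (\<lambda>x. (f x)^2)"
    using f(1) by (intro P.integrable_const_bound[of _ 1]) (auto simp: f(2) power_le_one_iff abs_square_le_1)
  have cf: "\<bar>c * f x\<bar> \<le> 1" for x
    using c f(2)[of x] mult_mono[of c 1 "\<bar>f x\<bar>" 1] by (simp add: abs_mult)
  have ie: "integrable (par l) (\<lambda>x. exp (c * f x))"
    using f(1) cf by (intro P.integrable_const_bound[of _ "exp 1"]) (auto simp: abs_le_iff)
  have "(\<integral>x. exp (c * f x) \<partial>par l) \<le> (\<integral>x. 1 + c * f x + c^2 / 2 * (f x)^2 + c^3 \<partial>par l)"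
  proof (rule integral_mono[OF ie])
    show "integrable (par l) (\<lambda>x. 1 + c * f x + c^2 / 2 * (f x)^2 + c^3)" using f1 f2 by simp
    fix x
    have "\<bar>c * f x\<bar>^3 \<le> c^3"
      using c f(2)[of x] mult_left_mono[of "\<bar>f x\<bar>" 1 c] by (intro power_mono) (auto simp: abs_mult)
    then show "exp (c * f x) \<le> 1 + c * f x + c^2 / 2 * (f x)^2 + c^3"
      using abs_exp_le_cubic[OF cf[of x]] by (simp add: power_mult_distrib)
  qed
  also have "\<dots> = 1 + (c^2 / 2 * s + c^3)" using f1 f2 f0 P.prob_space by (simp add: s_def)
  finally have Z: "(\<integral>x. exp (c * f x) \<partial>par l) \<le> 1 + (c^2 / 2 * s + c^3)" .
  have "(\<integral>x. exp (- 1) \<partial>par l) \<le> (\<integral>x. exp (c * f x) \<partial>par l)"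
  proof (rule integral_mono[OF _ ie])
    fix x show "exp (- 1) \<le> exp (c * f x)" using cf[of x] by (simp add: abs_le_iff)
  qed simp
  then have "exp (- 1) \<le> (\<integral>x. exp (c * f x) \<partial>par l)" using P.prob_space by simp
  then have Z0: "0 < (\<integral>x. exp (c * f x) \<partial>par l)" using exp_gt_zero[of "- 1 :: real"] by linarith
  have "ln (\<integral>x. exp (c * f x) \<partial>par l) \<le> (\<integral>x. exp (c * f x) \<partial>par l) - 1"
    using Z0 by (rule ln_le_minus_one)
  also have "\<dots> \<le> c^2 / 2 * s + c^3" using Z by linarith
  finally have lnZ: "ln (\<integral>x. exp (c * f x) \<partial>par l) \<le> c^2 / 2 * s + c^3" .
  have "c * (\<integral>x. q x * f x \<partial>par l) = (\<integral>x. q x * (c * f x) \<partial>par l)"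
    by (subst integral_mult_right_zero[symmetric]) (simp add: mult_ac)
  also have "\<dots> \<le> ent (par l) q + ln (\<integral>x. exp (c * f x) \<partial>par l)"
    using f(1) cf by (intro donsker_varadhan[OF pos_law_par[OF l] q, of _ 1]) auto
  finally have "c * (\<integral>x. q x * f x \<partial>par l) \<le> ent (par l) q + (c^2 / 2 * s + c^3)" using lnZ by linarith
  also have "\<dots> = c * (ent (par l) q / c + c * s / 2 + c^2)"
    using c by (simp add: field_simps power2_eq_square power3_eq_cube)
  finally show ?thesis using c unfolding s_def by simp
qed

text \<open>A substitute for Pinsker's inequality: \<open>c\<close> of the order of the square root
  of the entropy bounds the L1 distance by that order too.\<close>

lemma total_variation_bound:
  assumes q: "bdens (par l) q" and c: "0 < c" "c \<le> 1"
  shows "(\<integral>x. \<bar>q x - 1\<bar> \<partial>par l) \<le> 2 * (ent (par l) q / c + c / 2 + c^2)"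
proof -
  note D = bdensD[OF pos_law_par[OF l] q]
  note [measurable] = D(1)
  define S where "S x = sgn (q x - 1)" for x
  define m where "m = (\<integral>x. S x \<partial>par l)"
  have S [measurable]: "S \<in> borel_measurable borel" unfolding S_def by measurable
  have S1: "\<bar>S x\<bar> \<le> 1" for x by (simp add: S_def sgn_if)
  have iS: "integrable (par l) S" using S1 by (intro P.integrable_const_bound[of _ 1]) auto
  have "\<bar>m\<bar> \<le> (\<integral>x. \<bar>S x\<bar> \<partial>par l)" unfolding m_def by (rule integral_abs_bound)
  also have "\<dots> \<le> (\<integral>x. 1 \<partial>par l)" using S1 iS by (intro integral_mono) auto
  finally have m1: "\<bar>m\<bar> \<le> 1" using P.prob_space by simp
  \<comment> \<open>Centring the sign of \<open>q - 1\<close> and halving it brings it within the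
    hypotheses of \<open>mean_bound\<close>; the halving explains the factor 2 in the
    result.\<close>
  define f where "f x = (S x - m) / 2" for x
  have f: "f \<in> borel_measurable borel" unfolding f_def by measurable
  have f1: "\<bar>f x\<bar> \<le> 1" for x using S1[of x] m1 by (simp add: f_def abs_le_iff)
  have f0: "(\<integral>x. f x \<partial>par l) = 0" unfolding f_def using iS P.prob_space by (simp add: m_def)
  have iqS: "integrable (par l) (\<lambda>x. q x * S x)" using D S S1 by (intro dens_integrable_mult[OF l, of _ _ 1]) auto
  have "(\<integral>x. (f x)^2 \<partial>par l) \<le> (\<integral>x. 1 \<partial>par l)"
  proof (rule integral_mono)
    show "integrable (par l) (\<lambda>x. (f x)^2)"
      using f by (intro P.integrable_const_bound[of _ 1]) (auto simp: f1 abs_square_le_1)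
  qed (auto simp: f1 abs_square_le_1)
  then have f2: "(\<integral>x. (f x)^2 \<partial>par l) \<le> 1" using P.prob_space by simp
  have "(\<integral>x. \<bar>q x - 1\<bar> \<partial>par l) = (\<integral>x. q x * S x - S x \<partial>par l)"
    by (intro Bochner_Integration.integral_cong) (auto simp: S_def sgn_if)
  also have "\<dots> = (\<integral>x. q x * S x \<partial>par l) - m" using iqS iS by (simp add: m_def)
  also have "\<dots> = 2 * (\<integral>x. q x * f x \<partial>par l)"
  proof -
    have "(\<integral>x. q x * f x \<partial>par l) = (\<integral>x. (q x * S x) / 2 - q x * (m / 2) \<partial>par l)"
      unfolding f_def by (intro Bochner_Integration.integral_cong) (auto simp: field_simps)
    also have "\<dots> = (\<integral>x. q x * S x \<partial>par l) / 2 - m / 2" using iqS D by simp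
    finally show ?thesis by simp
  qed
  also have "\<dots> \<le> 2 * (ent (par l) q / c + c * 1 / 2 + c^2)"
  proof (rule mult_left_mono)
    have "c * (\<integral>x. (f x)^2 \<partial>par l) / 2 \<le> c * 1 / 2" using c f2 by simp
    then show "(\<integral>x. q x * f x \<partial>par l) \<le> ent (par l) q / c + c * 1 / 2 + c^2"
      using mean_bound[OF q f f1 f0 c] by linarith
  qed simp
  finally show ?thesis by simp
qed

definition vv :: real where "vv = vps l (t0 l)"

lemma vv_pos: "vv > 0" unfolding vv_def by (rule vps_t0_pos[OF l])

lemma vps_le_vv: "t \<ge> 1 \<Longrightarrow> vps l t \<le> vv" unfolding vv_def by (rule vps_le[OF l])

lemma ps_integrals:
  assumes "t \<ge> 1"
  shows "integrable (par l) (ps l t)" "(\<integral>x. ps l t x \<partial>par l) = 0"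
    "integrable (par l) (\<lambda>x. (ps l t x)^2)" "(\<integral>x. (ps l t x)^2 \<partial>par l) = vps l t"
  using has_bochner_integral_ps[OF l assms] has_bochner_integral_ps2[OF l assms]
  by (auto simp: has_bochner_integral_iff)

lemma vv_le_1: "vv \<le> 1"
proof -
  have t: "t0 l \<ge> 1" by (rule t0_powr[OF l])
  have "vv = (\<integral>x. (ps l (t0 l) x)^2 \<partial>par l)" unfolding vv_def using ps_integrals[OF t] by simp
  also have "\<dots> \<le> (\<integral>x. 1 \<partial>par l)"
    using abs_ps_le_1[OF l] ps_integrals[OF t] by (intro integral_mono) (auto simp: abs_square_le_1)
  finally show ?thesis using P.prob_space by simp
qed

text \<open>\<open>K1\<close> collects 2 (ent / s + s / 2 + s^2) for ent at most s^2 /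
  \<open>vv\<close> and s at most 1; \<open>K2\<close> adds the cubic error of
  \<open>mean_bound\<close> at c = s / (2 \<open>vv\<close>) to the square of the L1 bound.\<close>

definition K1 :: real where "K1 = 2 / vv + 3"
definition K2 :: real where "K2 = 1 / (2 * vv^2) + K1^2"

lemma K_pos: "K1 > 0" "K2 > 0"
  using vv_pos by (auto simp: K1_def K2_def add_pos_nonneg)

lemma tv_small:
  assumes q: "bdens (par l) q" and e: "ent (par l) q \<le> s^2 / vv" and s: "0 < s" "s \<le> 1"
  shows "(\<integral>x. \<bar>q x - 1\<bar> \<partial>par l) \<le> K1 * s"
proof -
  have "ent (par l) q / s \<le> s^2 / vv / s" using e s by (intro divide_right_mono) auto
  then have "ent (par l) q / s \<le> s / vv" using s by (simp add: power2_eq_square)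
  moreover have "s^2 \<le> s" using s by (simp add: power2_eq_square mult_left_le)
  moreover have "K1 * s = 2 * (s / vv) + 3 * s" by (simp add: K1_def algebra_simps)
  ultimately have "2 * (ent (par l) q / s + s / 2 + s^2) \<le> K1 * s"
    unfolding distrib_left by linarith
  then show ?thesis using total_variation_bound[OF q s] by linarith
qed

lemma abs_mean_ps_le:
  assumes q: "bdens (par l) q" and c: "0 < c" "c \<le> 1" and t: "t \<ge> 1"
  shows "\<bar>\<integral>x. q x * ps l t x \<partial>par l\<bar> \<le> ent (par l) q / c + c * vps l t / 2 + c^2"
proof -
  have "(\<integral>x. q x * ps l t x \<partial>par l) \<le> ent (par l) q / c + c * vps l t / 2 + c^2"
    using mean_bound[OF q _ _ _ c, of "ps l t"] ps_measurable[OF l] abs_ps_le_1[OF l] ps_integrals[OF t] by simp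
  moreover have "(\<integral>x. q x * (- ps l t x) \<partial>par l) \<le> ent (par l) q / c + c * vps l t / 2 + c^2"
    using mean_bound[OF q _ _ _ c, of "\<lambda>x. - ps l t x"] ps_measurable[OF l] abs_ps_le_1[OF l] ps_integrals[OF t] by simp
  ultimately show ?thesis by simp
qed

text \<open>\<open>vps l t\<close> is kept instead of its maximum: besides bounding the entropy from
  below, the estimate must show that a nearly maximal \<open>t\<close> has variance comparable to
  \<open>vv\<close>.\<close>

lemma Phi_bound:
  assumes q: "bdens (par l) q" and e: "ent (par l) q \<le> s^2 / vv" and s: "0 < s" "s \<le> 1" "s \<le> 2 * vv" and t: "t \<ge> 1"
  shows "\<bar>Phi (tilt (par l) q) t\<bar> \<le> 4 * vv * ent (par l) q / s + s * vps l t / (2 * vv) + K2 * s^2"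
proof -
  note v = vv_pos
  define d where "d = (\<integral>x. \<bar>q x - 1\<bar> \<partial>par l)"
  have d: "0 \<le> d" "d \<le> K1 * s" using tv_small[OF q e s(1,2)] by (auto simp: d_def)
  have "\<bar>Rem l q t\<bar> \<le> d^2" unfolding d_def by (rule abs_Rem_le[OF l bdens_dens[OF l q]])
  also have "\<dots> \<le> (K1 * s)^2" using d by (intro power_mono) auto
  finally have R: "\<bar>Rem l q t\<bar> \<le> K1^2 * s^2" by (simp add: power_mult_distrib)
  \<comment> \<open>The minimizer of ent / c + c \<open>vv\<close> / 2 at the expected entropy s^2 /
    (8 \<open>vv\<close>).\<close>
  define c where "c = s / (2 * vv)"
  have c: "0 < c" "c \<le> 1" using s v by (auto simp: c_def)
  have "\<bar>Phi (tilt (par l) q) t\<bar> \<le> 2 * \<bar>\<integral>x. q x * ps l t x \<partial>par l\<bar> + \<bar>Rem l q t\<bar>"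
    unfolding Phi_tilt[OF l bdens_dens[OF l q] t] by linarith
  also have "\<dots> \<le> 2 * (ent (par l) q / c + c * vps l t / 2 + c^2) + K1^2 * s^2"
    by (intro add_mono mult_left_mono abs_mean_ps_le[OF q c t] R) simp
  also have "\<dots> = 4 * vv * ent (par l) q / s + s * vps l t / (2 * vv) + K2 * s^2"
    using v s by (simp add: c_def K2_def field_simps power2_eq_square)
  finally show ?thesis .
qed

text \<open>The a priori bound s^2 / \<open>vv\<close> needed for \<open>Phi_bound\<close> may be
  assumed, since otherwise the entropy exceeds the claim outright.\<close>

lemma ent_lower:
  assumes s: "0 < s" "s \<le> 1" "s \<le> 2 * vv" and q: "bdens (par l) q" and V: "s \<le> Vf (tilt (par l) q)"
  shows "s^2 / (8 * vv) * (1 - 2 * K2 * s) \<le> ent (par l) q"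
proof (cases "ent (par l) q \<le> s^2 / vv")
  case True
  note v = vv_pos
  have "Vf (tilt (par l) q) \<le> 4 * vv * ent (par l) q / s + s / 2 + K2 * s^2"
  proof (rule Vf_le)
    fix t :: real assume t: "1 \<le> t"
    have "s * vps l t / (2 * vv) \<le> s * vv / (2 * vv)"
      using vps_le_vv[OF t] s v by (intro divide_right_mono mult_left_mono) auto
    also have "\<dots> = s / 2" using v by simp
    finally show "\<bar>Phi (tilt (par l) q) t\<bar> \<le> 4 * vv * ent (par l) q / s + s / 2 + K2 * s^2"
      using Phi_bound[OF q True s t] by linarith
  qed
  then have "s / 2 - K2 * s^2 \<le> 4 * vv * ent (par l) q / s" using V by linarith
  then have "(s / 2 - K2 * s^2) * (s / (4 * vv)) \<le> 4 * vv * ent (par l) q / s * (s / (4 * vv))"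
    using s v by (intro mult_right_mono) auto
  then show ?thesis using s v by (simp add: field_simps power2_eq_square)
next
  case False
  note v = vv_pos
  have "s^2 / (8 * vv) * (1 - 2 * K2 * s) \<le> s^2 / (8 * vv) * 1"
    using s v K_pos by (intro mult_left_mono) auto
  also have "\<dots> \<le> s^2 / vv" using v by (simp add: field_simps)
  finally show ?thesis using False by linarith
qed

lemma bdens_tilt_ps:
  assumes e: "\<bar>e\<bar> \<le> 1" and t: "t \<ge> 1" shows "bdens (par l) (\<lambda>x. 1 + e * ps l t x)"
proof -
  have "\<bar>e * ps l t x\<bar> \<le> 1" for x
    unfolding abs_mult using e abs_ps_le_1[OF l, of t x] mult_mono[of "\<bar>e\<bar>" 1 "\<bar>ps l t x\<bar>" 1] by simp
  then have "0 \<le> 1 + e * ps l t x \<and> 1 + e * ps l t x \<le> 2" for x by (simp add: abs_le_iff) (smt (verit))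
  moreover have "(\<integral>x. 1 + e * ps l t x \<partial>par l) = 1" using ps_integrals[OF t] P.prob_space by simp
  moreover have "(\<lambda>x. 1 + e * ps l t x) \<in> borel_measurable borel" using ps_measurable[OF l, of t] by measurable
  ultimately show ?thesis unfolding bdens_def by blast
qed

text \<open>The tilt in the direction of maximal variance: it supplies competitors whose entropy
  matches the lower bound to leading order.\<close>

lemma tilt_ps_t0:
  assumes e: "0 < e" "e \<le> 1 / 2"
  shows "2 * e * vv - e^2 \<le> Vf (tilt (par l) (\<lambda>x. 1 + e * ps l (t0 l) x))"
    "ent (par l) (\<lambda>x. 1 + e * ps l (t0 l) x) \<le> e^2 * vv / 2 + e^3"
proof -
  have t: "t0 l \<ge> 1" by (rule t0_powr[OF l])
  define p where "p = ps l (t0 l)"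
  note I = ps_integrals[OF t, folded p_def vv_def]
  have p1: "\<bar>p x\<bar> \<le> 1" for x unfolding p_def by (rule abs_ps_le_1[OF l])
  have p [measurable]: "p \<in> borel_measurable borel" unfolding p_def by (rule ps_measurable[OF l])
  let ?q = "\<lambda>x. 1 + e * p x"
  have q: "bdens (par l) ?q" unfolding p_def using e by (intro bdens_tilt_ps t) auto
  note Q = bdens_dens[OF l q]
  have "(\<integral>x. ?q x * p x \<partial>par l) = (\<integral>x. p x + e * (p x)^2 \<partial>par l)"
    by (intro Bochner_Integration.integral_cong) (auto simp: power2_eq_square algebra_simps)
  also have "\<dots> = e * vv" using I by simp
  finally have m: "(\<integral>x. ?q x * p x \<partial>par l) = e * vv" .
  have "(\<integral>x. \<bar>?q x - 1\<bar> \<partial>par l) \<le> (\<integral>x. e \<partial>par l)"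
  proof (rule integral_mono)
    show "integrable (par l) (\<lambda>x. \<bar>?q x - 1\<bar>)" using I by simp
    show "\<bar>?q x - 1\<bar> \<le> e" for x using p1[of x] e mult_left_mono[of "\<bar>p x\<bar>" 1 e] by (simp add: abs_mult)
  qed simp
  then have "(\<integral>x. \<bar>?q x - 1\<bar> \<partial>par l) \<le> e" using P.prob_space by simp
  then have "(\<integral>x. \<bar>?q x - 1\<bar> \<partial>par l)^2 \<le> e^2" by (intro power_mono) auto
  then have "\<bar>Rem l ?q (t0 l)\<bar> \<le> e^2" using abs_Rem_le[OF l Q, of "t0 l"] by linarith
  then have "2 * e * vv - e^2 \<le> Phi (tilt (par l) ?q) (t0 l)"
    using Phi_tilt[OF l Q t, folded p_def] m by linarith
  also have "\<dots> \<le> Vf (tilt (par l) ?q)"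
    using abs_Phi_le_Vf[OF densD(5)[OF l Q] t] by linarith
  finally show "2 * e * vv - e^2 \<le> Vf (tilt (par l) (\<lambda>x. 1 + e * ps l (t0 l) x))" by (simp add: p_def)
  have "ent (par l) ?q \<le> (\<integral>x. e * p x + e^2 / 2 * (p x)^2 + e^3 \<partial>par l)"
    unfolding ent_def
  proof (rule integral_mono)
    show "integrable (par l) (\<lambda>x. ?q x * ln (?q x))" by (rule bdens_integrable_ent[OF pos_law_par[OF l] q])
    show "integrable (par l) (\<lambda>x. e * p x + e^2 / 2 * (p x)^2 + e^3)" using I by simp
    fix x
    have ep: "\<bar>e * p x\<bar> \<le> e" using p1[of x] e mult_left_mono[of "\<bar>p x\<bar>" 1 e] by (simp add: abs_mult)
    then have "\<bar>e * p x\<bar>^3 \<le> e^3" by (intro power_mono) auto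
    moreover have "- 1 / 2 \<le> e * p x" using ep e by (simp add: abs_le_iff)
    from entropy_taylor[OF this] have "?q x * ln (?q x) - e * p x - (e * p x)^2 / 2 \<le> \<bar>e * p x\<bar>^3" by (rule abs_le_D1)
    ultimately show "?q x * ln (?q x) \<le> e * p x + e^2 / 2 * (p x)^2 + e^3"
      by (simp add: power_mult_distrib)
  qed
  also have "\<dots> = e^2 * vv / 2 + e^3" using I P.prob_space by simp
  finally show "ent (par l) (\<lambda>x. 1 + e * ps l (t0 l) x) \<le> e^2 * vv / 2 + e^3" by (simp add: p_def)
qed

end

text \<open>Convexity of \<open>q * ln q\<close>: the Fenchel-Young inequality at the logarithm of
  the mixture is the tangent line there, averaged over the two points.\<close>

lemma mult_ln_convex:
  fixes a b d :: real
  assumes "0 \<le> a" "0 \<le> b" "0 < d" "d < 1"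
  shows "((1 - d) * a + d * b) * ln ((1 - d) * a + d * b) \<le> (1 - d) * (a * ln a) + d * (b * ln b)"
proof (cases "(1 - d) * a + d * b = 0")
  case True
  then have "a = 0" "b = 0"
    using assms add_nonneg_eq_0_iff[of "(1 - d) * a" "d * b"] by auto
  then show ?thesis by simp
next
  case False
  define p where "p = (1 - d) * a + d * b"
  have "0 \<le> p" unfolding p_def using assms by (intro add_nonneg_nonneg mult_nonneg_nonneg) auto
  then have p: "p > 0" using False by (simp add: p_def)
  have "(1 - d) * (a * ln p) \<le> (1 - d) * (a * ln a - a + p)" "d * (b * ln p) \<le> d * (b * ln b - b + p)"
    using mult_exp_conjugate[of a "ln p"] mult_exp_conjugate[of b "ln p"] assms p by (auto intro!: mult_left_mono)
  then have "p * ln p \<le> (1 - d) * (a * ln a) + d * (b * ln b)"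
    unfolding p_def by (simp add: algebra_simps)
  then show ?thesis by (simp add: p_def)
qed

context
  fixes l :: real assumes l: "l > 0"
begin

interpretation P: prob_space "par l" by (rule prob_space_par[OF l])

text \<open>Mixing with a small amount of the tilt by \<open>\<plusminus>ps l t\<close> moves the statistic away from 0 at a linear rate and at linear entropy cost.\<close>

lemma boost:
  assumes q: "bdens (par l) q" and t: "t \<ge> 1" and vt: "vv l / 2 \<le> vps l t"
    and tv: "(\<integral>x. \<bar>q x - 1\<bar> \<partial>par l) \<le> vv l / 20" and d: "0 < d" "d \<le> vv l / 20"
  shows "\<exists>r. bdens (par l) r \<and> ent (par l) r \<le> ent (par l) q + d \<and>
     \<bar>Phi (tilt (par l) q) t\<bar> + d * vv l / 2 \<le> \<bar>Phi (tilt (par l) r) t\<bar>"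
proof -
  note v = vv_pos[OF l] vv_le_1[OF l]
  have d1: "d < 1" using d v by linarith
  \<comment> \<open>The tilt goes in the direction of the sign that the functional already has at
    \<open>t\<close>, so that its absolute value grows.\<close>
  define \<sigma> :: real where "\<sigma> = (if 0 \<le> Phi (tilt (par l) q) t then 1 else - 1)"
  have \<sigma>: "\<bar>\<sigma>\<bar> = 1" "\<sigma> * \<sigma> = 1" by (auto simp: \<sigma>_def)
  define p where "p = ps l t"
  define u where "u x = 1 + \<sigma> * p x" for x
  define r where "r x = (1 - d) * q x + d * u x" for x
  note I = ps_integrals[OF l t, folded p_def]
  have p1: "\<bar>p x\<bar> \<le> 1" for x unfolding p_def by (rule abs_ps_le_1[OF l])
  have u: "bdens (par l) u" unfolding u_def p_def using \<sigma> t by (intro bdens_tilt_ps[OF l]) auto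
  have r: "bdens (par l) r"
  proof -
    from q obtain A where A: "q \<in> borel_measurable borel" "\<And>x. 0 \<le> q x" "\<And>x. q x \<le> A" unfolding bdens_def by auto
    from u obtain B where B: "u \<in> borel_measurable borel" "\<And>x. 0 \<le> u x" "\<And>x. u x \<le> B" unfolding bdens_def by auto
    have "r \<in> borel_measurable borel" unfolding r_def using A B by measurable
    moreover have "0 \<le> r x \<and> r x \<le> (1 - d) * A + d * B" for x
      unfolding r_def using A B d d1 by (intro conjI add_mono add_nonneg_nonneg mult_nonneg_nonneg mult_left_mono) auto
    moreover have "(\<integral>x. r x \<partial>par l) = 1"
      unfolding r_def using bdensD[OF pos_law_par[OF l] q] bdensD[OF pos_law_par[OF l] u] by simp
    ultimately show ?thesis unfolding bdens_def by blast
  qed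
  note Q = bdensD[OF pos_law_par[OF l] q] and U = bdensD[OF pos_law_par[OF l] u]
  have dq: "dens (par l) q" and dr: "dens (par l) r" using bdens_dens[OF l] q r by auto
  have "ent (par l) u \<le> (\<integral>x. \<sigma> * p x + (p x)^2 \<partial>par l)"
    unfolding ent_def
  proof (rule integral_mono)
    show "integrable (par l) (\<lambda>x. u x * ln (u x))" by (rule bdens_integrable_ent[OF pos_law_par[OF l] u])
    show "integrable (par l) (\<lambda>x. \<sigma> * p x + (p x)^2)" using I by simp
    fix x
    show "u x * ln (u x) \<le> \<sigma> * p x + (p x)^2"
    proof (cases "u x = 0")
      case True
      then have "\<sigma> * p x = - 1" by (simp add: u_def)
      then have "(\<sigma> * p x) * (\<sigma> * p x) = 1" by simp
      then have "(\<sigma> * \<sigma>) * (p x)^2 = 1" by (simp add: power2_eq_square mult_ac)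
      then show ?thesis using True \<open>\<sigma> * p x = - 1\<close> \<sigma> by simp
    next
      case False
      then have "u x > 0" using U(2)[of x] by simp
      \<comment> \<open>The crude bound on the logarithm already gives the variance as an upper
        bound for the entropy of the tilt.\<close>
      then have "u x * ln (u x) \<le> u x * (u x - 1)" by (intro mult_left_mono ln_le_minus_one) auto
      also have "\<dots> = \<sigma> * p x + (\<sigma> * \<sigma>) * (p x)^2" by (simp add: u_def power2_eq_square algebra_simps)
      finally show ?thesis using \<sigma> by simp
    qed
  qed
  also have "\<dots> = vps l t" using I by simp
  finally have eu: "ent (par l) u \<le> 1" using vps_le_vv[OF l t] v by linarith
  have "ent (par l) r \<le> (\<integral>x. (1 - d) * (q x * ln (q x)) + d * (u x * ln (u x)) \<partial>par l)"
    unfolding ent_def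
  proof (rule integral_mono)
    show "integrable (par l) (\<lambda>x. r x * ln (r x))" by (rule bdens_integrable_ent[OF pos_law_par[OF l] r])
    show "integrable (par l) (\<lambda>x. (1 - d) * (q x * ln (q x)) + d * (u x * ln (u x)))"
      using bdens_integrable_ent[OF pos_law_par[OF l] q] bdens_integrable_ent[OF pos_law_par[OF l] u] by simp
    show "r x * ln (r x) \<le> (1 - d) * (q x * ln (q x)) + d * (u x * ln (u x))" for x
      unfolding r_def using Q(2) U(2) d(1) d1 by (rule mult_ln_convex)
  qed
  also have "\<dots> = (1 - d) * ent (par l) q + d * ent (par l) u"
    unfolding ent_def using bdens_integrable_ent[OF pos_law_par[OF l] q] bdens_integrable_ent[OF pos_law_par[OF l] u] by simp
  also have "\<dots> \<le> 1 * ent (par l) q + d * 1"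
    using d d1 eu ent_nonneg[OF pos_law_par[OF l] q] by (intro add_mono mult_right_mono mult_left_mono) auto
  finally have er: "ent (par l) r \<le> ent (par l) q + d" by simp
  define \<delta> where "\<delta> = (\<integral>x. \<bar>q x - 1\<bar> \<partial>par l)"
  have \<delta>: "0 \<le> \<delta>" "\<delta> \<le> vv l / 20" using tv by (auto simp: \<delta>_def)
  have iq1: "integrable (par l) (\<lambda>x. q x - 1)" using Q by simp
  have u1: "(\<integral>x. \<bar>u x - 1\<bar> \<partial>par l) \<le> 1"
  proof -
    have "(\<integral>x. \<bar>u x - 1\<bar> \<partial>par l) \<le> (\<integral>x. 1 \<partial>par l)"
      using I p1 \<sigma> by (intro integral_mono) (auto simp: u_def abs_mult)
    then show ?thesis using P.prob_space by simp
  qed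
  have r1: "(\<integral>x. \<bar>r x - 1\<bar> \<partial>par l) \<le> \<delta> + d"
  proof -
    have "(\<integral>x. \<bar>r x - 1\<bar> \<partial>par l) \<le> (\<integral>x. \<bar>q x - 1\<bar> + d * \<bar>u x - 1\<bar> \<partial>par l)"
    proof (rule integral_mono)
      show "integrable (par l) (\<lambda>x. \<bar>r x - 1\<bar>)" using densD(6)[OF l dr] by simp
      show "integrable (par l) (\<lambda>x. \<bar>q x - 1\<bar> + d * \<bar>u x - 1\<bar>)" using Q U by simp
      fix x
      have "r x - 1 = (1 - d) * (q x - 1) + d * (u x - 1)" by (simp add: r_def algebra_simps)
      also have "\<bar>\<dots>\<bar> \<le> \<bar>(1 - d) * (q x - 1)\<bar> + \<bar>d * (u x - 1)\<bar>" by (rule abs_triangle_ineq)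
      also have "\<dots> \<le> 1 * \<bar>q x - 1\<bar> + d * \<bar>u x - 1\<bar>"
        unfolding abs_mult using d d1 by (intro add_mono mult_right_mono) auto
      finally show "\<bar>r x - 1\<bar> \<le> \<bar>q x - 1\<bar> + d * \<bar>u x - 1\<bar>" by simp
    qed
    also have "\<dots> = \<delta> + d * (\<integral>x. \<bar>u x - 1\<bar> \<partial>par l)" using Q U by (simp add: \<delta>_def)
    also have "\<dots> \<le> \<delta> + d * 1" using u1 d by (intro add_left_mono mult_left_mono) auto
    finally show ?thesis by simp
  qed
  have rq: "(\<integral>x. \<bar>r x - q x\<bar> \<partial>par l) \<le> d * (1 + \<delta>)"
  proof -
    have "(\<integral>x. \<bar>r x - q x\<bar> \<partial>par l) \<le> (\<integral>x. d * \<bar>u x - 1\<bar> + d * \<bar>q x - 1\<bar> \<partial>par l)"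
    proof (rule integral_mono)
      show "integrable (par l) (\<lambda>x. \<bar>r x - q x\<bar>)" using Q densD(4)[OF l dr] by simp
      show "integrable (par l) (\<lambda>x. d * \<bar>u x - 1\<bar> + d * \<bar>q x - 1\<bar>)" using Q U by simp
      fix x
      have "r x - q x = d * ((u x - 1) - (q x - 1))" by (simp add: r_def algebra_simps)
      then have "\<bar>r x - q x\<bar> = d * \<bar>(u x - 1) - (q x - 1)\<bar>" using d by (simp add: abs_mult)
      also have "\<dots> \<le> d * (\<bar>u x - 1\<bar> + \<bar>q x - 1\<bar>)" using d by (intro mult_left_mono abs_triangle_ineq4) auto
      finally show "\<bar>r x - q x\<bar> \<le> d * \<bar>u x - 1\<bar> + d * \<bar>q x - 1\<bar>" by (simp add: distrib_left)
    qed
    also have "\<dots> = d * ((\<integral>x. \<bar>u x - 1\<bar> \<partial>par l) + \<delta>)" using Q U by (simp add: \<delta>_def algebra_simps)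
    also have "\<dots> \<le> d * (1 + \<delta>)" using u1 d by (intro mult_left_mono add_right_mono) auto
    finally show ?thesis .
  qed
  have "\<bar>Rem l r t - Rem l q t\<bar> \<le> (\<integral>x. \<bar>r x - q x\<bar> \<partial>par l) * ((\<integral>x. \<bar>r x - 1\<bar> \<partial>par l) + \<delta>)"
    unfolding \<delta>_def by (rule Rem_diff_le[OF l dr dq])
  also have "\<dots> \<le> (d * (1 + \<delta>)) * ((\<delta> + d) + \<delta>)"
    using rq r1 d \<delta> by (intro mult_mono add_mono) auto
  \<comment> \<open>Uses \<open>1 + \<delta> \<le> 2\<close>, and that \<delta> and \<open>d\<close>
    are each at most \<open>vv l / 20\<close>.\<close>
  also have "\<dots> \<le> (d * 2) * (3 * vv l / 20)"
    using d \<delta> v by (intro mult_mono) auto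
  finally have RR: "\<bar>Rem l r t - Rem l q t\<bar> \<le> d * (3 * vv l / 10)" by simp
  define m where "m = (\<integral>x. q x * p x \<partial>par l)"
  have iqp: "integrable (par l) (\<lambda>x. q x * p x)"
    unfolding p_def using Q ps_measurable[OF l] abs_ps_le_1[OF l] by (intro dens_integrable_mult[OF l, of _ _ 1]) auto
  have m: "\<bar>m\<bar> \<le> \<delta>"
  proof -
    have "m = (\<integral>x. q x * p x - p x \<partial>par l)" using iqp I by (simp add: m_def)
    then have "\<bar>m\<bar> \<le> (\<integral>x. \<bar>q x * p x - p x\<bar> \<partial>par l)" by (simp add: integral_abs_bound)
    also have "\<dots> \<le> \<delta>" unfolding \<delta>_def
    proof (rule integral_mono)
      fix x
      have "\<bar>q x * p x - p x\<bar> = \<bar>q x - 1\<bar> * \<bar>p x\<bar>" by (simp add: abs_mult[symmetric] algebra_simps)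
      also have "\<dots> \<le> \<bar>q x - 1\<bar> * 1" using p1 by (intro mult_left_mono) auto
      finally show "\<bar>q x * p x - p x\<bar> \<le> \<bar>q x - 1\<bar>" by simp
    qed (use iqp I iq1 in auto)
    finally show ?thesis .
  qed
  have mr: "(\<integral>x. r x * p x \<partial>par l) = (1 - d) * m + d * (\<sigma> * vps l t)"
  proof -
    have "(\<integral>x. r x * p x \<partial>par l) = (\<integral>x. (1 - d) * (q x * p x) + d * (p x + \<sigma> * (p x)^2) \<partial>par l)"
      by (intro Bochner_Integration.integral_cong) (auto simp: r_def u_def power2_eq_square algebra_simps)
    then show ?thesis using iqp I by (simp add: m_def)
  qed
  have "Phi (tilt (par l) r) t - Phi (tilt (par l) q) t = - (2 * d * m) + 2 * d * (\<sigma> * vps l t) + (Rem l r t - Rem l q t)"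
    unfolding Phi_tilt[OF l dq t] Phi_tilt[OF l dr t] p_def[symmetric] mr m_def[symmetric]
    by (simp add: algebra_simps)
  then have *: "Phi (tilt (par l) r) t = Phi (tilt (par l) q) t +
      (- (2 * d * m) + 2 * d * (\<sigma> * vps l t) + (Rem l r t - Rem l q t))" by linarith
  have "\<sigma> * Phi (tilt (par l) r) t = \<sigma> * Phi (tilt (par l) q) t +
      (- (2 * d * (\<sigma> * m)) + 2 * d * (\<sigma> * \<sigma> * vps l t) + \<sigma> * (Rem l r t - Rem l q t))"
    unfolding * by (simp add: algebra_simps)
  moreover have "\<sigma> * Phi (tilt (par l) q) t = \<bar>Phi (tilt (par l) q) t\<bar>" by (simp add: \<sigma>_def)
  moreover have "\<sigma> * Phi (tilt (par l) r) t \<le> \<bar>Phi (tilt (par l) r) t\<bar>"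
    by (simp add: \<sigma>_def abs_ge_self abs_ge_minus_self)
  moreover have "- (d * (3 * vv l / 10)) \<le> \<sigma> * (Rem l r t - Rem l q t)"
  proof -
    have "\<bar>\<sigma> * (Rem l r t - Rem l q t)\<bar> \<le> d * (3 * vv l / 10)" using RR \<sigma> by (simp only: abs_mult mult_1)
    from abs_le_D2[OF this] show ?thesis by linarith
  qed
  moreover have "2 * d * (\<sigma> * m) \<le> 2 * d * (vv l / 20)"
  proof (rule mult_left_mono)
    have "\<bar>\<sigma> * m\<bar> \<le> \<delta>" using m \<sigma> by (simp only: abs_mult mult_1)
    from abs_le_D1[OF this] show "\<sigma> * m \<le> vv l / 20" using \<delta> by linarith
  qed (use d in simp)
  moreover have "2 * d * (vv l / 2) \<le> 2 * d * (\<sigma> * \<sigma> * vps l t)"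
    using vt d \<sigma> by (intro mult_left_mono) auto
  \<comment> \<open>In units of \<open>d * vv l\<close>: the tilt gains at least 1, the loss of
    weight on \<open>q\<close> costs at most 1/10 and the remainder at most 3/10, which leaves more
    than 1/2.\<close>
  ultimately have "\<bar>Phi (tilt (par l) q) t\<bar> + d * vv l / 2 \<le> \<bar>Phi (tilt (par l) r) t\<bar>"
  proof -
    assume "\<sigma> * Phi (tilt (par l) r) t = \<sigma> * Phi (tilt (par l) q) t +
      (- (2 * d * (\<sigma> * m)) + 2 * d * (\<sigma> * \<sigma> * vps l t) + \<sigma> * (Rem l r t - Rem l q t))"
      "\<sigma> * Phi (tilt (par l) q) t = \<bar>Phi (tilt (par l) q) t\<bar>"
      "\<sigma> * Phi (tilt (par l) r) t \<le> \<bar>Phi (tilt (par l) r) t\<bar>"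
      "- (d * (3 * vv l / 10)) \<le> \<sigma> * (Rem l r t - Rem l q t)"
      "2 * d * (\<sigma> * m) \<le> 2 * d * (vv l / 20)"
      "2 * d * (vv l / 2) \<le> 2 * d * (\<sigma> * \<sigma> * vps l t)"
    moreover have "2 * d * (vv l / 2) - 2 * d * (vv l / 20) - d * (3 * vv l / 10) = d * vv l / 2 + d * vv l / 10" by simp
    moreover have "0 \<le> d * vv l / 10" using d v by simp
    ultimately show ?thesis by linarith
  qed
  then show ?thesis using r er by blast
qed

section \<open>The rate function near 0\<close>

definition Jf :: "real \<Rightarrow> real" where
  "Jf s = Inf (ent (par l) ` {q. bdens (par l) q \<and> s \<le> Vf (tilt (par l) q)})"

lemma Jf_le: "bdens (par l) q \<Longrightarrow> s \<le> Vf (tilt (par l) q) \<Longrightarrow> Jf s \<le> ent (par l) q"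
  unfolding Jf_def
  by (intro cInf_lower) (auto intro!: bdd_belowI[of _ 0] ent_nonneg[OF pos_law_par[OF l]])

text \<open>To first order \<open>e\<close> is \<open>s / (2 * vv l)\<close>; the correction factor
  makes \<open>2 * e * vv l\<close> exceed \<open>s\<close> by \<open>(s / vv l)^2\<close>, enough
  to cover \<open>e^2\<close>. Feasibility is proved alongside, because \<open>Inf\<close> of an
  empty set of reals carries no information.\<close>

lemma Jf_upper:
  assumes s: "0 < s" "s \<le> (vv l)^2" "s \<le> vv l / 2"
  defines "e \<equiv> s / (2 * vv l) * (1 + s / (vv l)^2)"
  shows "{q. bdens (par l) q \<and> s \<le> Vf (tilt (par l) q)} \<noteq> {}" "Jf s \<le> e^2 * vv l / 2 + e^3"
proof -
  note v = vv_pos[OF l] vv_le_1[OF l]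
  have sv: "s / (vv l)^2 \<le> 1" "0 < s / (vv l)^2" using s v by auto
  have e0: "e > 0" using s v sv unfolding e_def by (intro mult_pos_pos add_pos_pos) auto
  have "e \<le> s / (2 * vv l) * 2" unfolding e_def using s v sv by (intro mult_left_mono) auto
  then have e1: "e \<le> s / vv l" by simp
  also have "s / vv l \<le> 1 / 2" using s v by (simp add: divide_le_eq)
  finally have e2: "e \<le> 1 / 2" .
  have "e^2 \<le> (s / vv l)^2" using e0 e1 by (intro power_mono) auto
  moreover have "2 * e * vv l = s + (s / vv l)^2"
    using v by (simp add: e_def field_simps power2_eq_square)
  ultimately have "s \<le> 2 * e * vv l - e^2" by linarith
  also have "\<dots> \<le> Vf (tilt (par l) (\<lambda>x. 1 + e * ps l (t0 l) x))" by (rule tilt_ps_t0(1)[OF l e0 e2])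
  finally have V: "s \<le> Vf (tilt (par l) (\<lambda>x. 1 + e * ps l (t0 l) x))" .
  have b: "bdens (par l) (\<lambda>x. 1 + e * ps l (t0 l) x)"
    using e0 e2 by (intro bdens_tilt_ps[OF l] t0_powr[OF l]) auto
  show "{q. bdens (par l) q \<and> s \<le> Vf (tilt (par l) q)} \<noteq> {}" using b V by blast
  show "Jf s \<le> e^2 * vv l / 2 + e^3"
    using Jf_le[OF b V] tilt_ps_t0(2)[OF l e0 e2] by linarith
qed

lemma Jf_lower:
  assumes s: "0 < s" "s \<le> 1" "s \<le> 2 * vv l" and ne: "{q. bdens (par l) q \<and> s \<le> Vf (tilt (par l) q)} \<noteq> {}"
  shows "s^2 / (8 * vv l) * (1 - 2 * K2 l * s) \<le> Jf s"
  unfolding Jf_def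
proof (rule cInf_greatest)
  fix y assume "y \<in> ent (par l) ` {q. bdens (par l) q \<and> s \<le> Vf (tilt (par l) q)}"
  then obtain q where "y = ent (par l) q" "bdens (par l) q" "s \<le> Vf (tilt (par l) q)" by auto
  then show "s^2 / (8 * vv l) * (1 - 2 * K2 l * s) \<le> y" using ent_lower[OF l s] by simp
qed (use ne in simp)

lemma eventually_small:
  assumes "0 < c" shows "\<forall>\<^sub>F s in at_right (0::real). 0 < s \<and> s \<le> c"
  using eventually_at_right_less[of 0] eventually_at_right_field[of "\<lambda>s. s \<le> c" 0] assms
  by (auto simp: eventually_at_right_field intro!: exI[of _ c])

lemma Jf_asymp: "((\<lambda>s. Jf s / s^2) \<longlongrightarrow> 1 / (8 * vv l)) (at_right 0)"
proof (rule tendsto_sandwich)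
  note v = vv_pos[OF l] vv_le_1[OF l]
  define c where "c = min (min 1 ((vv l)^2)) (vv l / 2)"
  have c: "c > 0" using v by (simp add: c_def)
  show "\<forall>\<^sub>F s in at_right 0. 1 / (8 * vv l) * (1 - 2 * K2 l * s) \<le> Jf s / s^2"
    using eventually_small[OF c]
  proof eventually_elim
    case (elim s)
    then have s: "0 < s" "s \<le> 1" "s \<le> (vv l)^2" "s \<le> vv l / 2" "s \<le> 2 * vv l" using v by (auto simp: c_def)
    then have "s^2 / (8 * vv l) * (1 - 2 * K2 l * s) \<le> Jf s" by (intro Jf_lower Jf_upper) auto
    then show ?case using s by (simp add: pos_le_divide_eq mult_ac)
  qed
  show "\<forall>\<^sub>F s in at_right 0. Jf s / s^2 \<le> (1 / (2 * vv l) * (1 + s / (vv l)^2))^2 * vv l / 2 + s * (1 / (2 * vv l) * (1 + s / (vv l)^2))^3"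
    using eventually_small[OF c]
  proof eventually_elim
    case (elim s)
    then have s: "0 < s" "s \<le> 1" "s \<le> (vv l)^2" "s \<le> vv l / 2" using v by (auto simp: c_def)
    define f where "f = 1 / (2 * vv l) * (1 + s / (vv l)^2)"
    have e: "s / (2 * vv l) * (1 + s / (vv l)^2) = s * f" by (simp add: f_def)
    have "Jf s \<le> (s * f)^2 * vv l / 2 + (s * f)^3" using Jf_upper(2)[OF s(1,3,4)] unfolding e .
    also have "\<dots> = (f^2 * vv l / 2 + s * f^3) * s^2" by (simp add: power2_eq_square power3_eq_cube algebra_simps)
    finally show ?case using s unfolding f_def[symmetric] by (simp add: pos_divide_le_eq)
  qed
  have "((\<lambda>s. 1 / (8 * vv l) * (1 - 2 * K2 l * s)) \<longlongrightarrow> 1 / (8 * vv l) * (1 - 2 * K2 l * 0)) (at_right 0)"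
    by (intro tendsto_intros)
  then show "((\<lambda>s. 1 / (8 * vv l) * (1 - 2 * K2 l * s)) \<longlongrightarrow> 1 / (8 * vv l)) (at_right 0)" by simp
  have "((\<lambda>s. (1 / (2 * vv l) * (1 + s / (vv l)^2))^2 * vv l / 2 + s * (1 / (2 * vv l) * (1 + s / (vv l)^2))^3)
     \<longlongrightarrow> (1 / (2 * vv l) * (1 + 0 / (vv l)^2))^2 * vv l / 2 + 0 * (1 / (2 * vv l) * (1 + 0 / (vv l)^2))^3) (at_right 0)"
    using v by (intro tendsto_intros) auto
  also have "(1 / (2 * vv l) * (1 + 0 / (vv l)^2))^2 * vv l / 2 + 0 * (1 / (2 * vv l) * (1 + 0 / (vv l)^2))^3 = 1 / (8 * vv l)"
    using v by (simp add: power2_eq_square field_simps)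
  finally show "((\<lambda>s. (1 / (2 * vv l) * (1 + s / (vv l)^2))^2 * vv l / 2 + s * (1 / (2 * vv l) * (1 + s / (vv l)^2))^3) \<longlongrightarrow> 1 / (8 * vv l)) (at_right 0)" .
qed

text \<open>A one-sided Lipschitz estimate at all small levels, obtained by boosting a
  near-minimizer. The known asymptotics of \<open>Jf\<close> keep its entropy near the leading
  order, which forces a large variance at the \<open>t\<close> in question.\<close>

lemma Jf_step:
  "\<exists>s1>0. \<forall>s d. 0 < s \<longrightarrow> s \<le> s1 \<longrightarrow> 0 < d \<longrightarrow> d \<le> vv l / 20 \<longrightarrow>
     {q. bdens (par l) q \<and> s + d * vv l / 4 \<le> Vf (tilt (par l) q)} \<noteq> {} \<and> Jf (s + d * vv l / 4) \<le> Jf s + 2 * d"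
proof -
  note v = vv_pos[OF l] vv_le_1[OF l] and K = K_pos[OF l]
  have "0 < 1 / (8 * vv l)" using v by simp
  then have "1 / (8 * vv l) < 11 / 10 * (1 / (8 * vv l))" by linarith
  then have "\<forall>\<^sub>F s in at_right 0. Jf s / s^2 < 11 / 10 * (1 / (8 * vv l))"
    by (rule order_tendstoD(2)[OF Jf_asymp])
  then obtain s0 where s0: "s0 > 0" "\<And>s. 0 < s \<Longrightarrow> s < s0 \<Longrightarrow> Jf s / s^2 < 11 / 10 * (1 / (8 * vv l))"
    by (auto simp: eventually_at_right_field)
  define s1 where "s1 = Min {s0 / 2, 1, (vv l)^2, vv l / 2, vv l / (20 * K1 l), 1 / (20 * K2 l)}"
  have s1: "s1 > 0" using s0 v K by (simp add: s1_def)
  show ?thesis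
  proof (intro exI[of _ s1] conjI allI impI s1)
    fix s d assume s: "0 < s" "s \<le> s1" and d: "0 < d" "d \<le> vv l / 20"
    have sb: "s < s0" "s \<le> 1" "s \<le> (vv l)^2" "s \<le> vv l / 2" "s \<le> vv l / (20 * K1 l)" "s \<le> 1 / (20 * K2 l)"
      using s s0(1) by (auto simp: s1_def)
    define h where "h = s^2 / (8 * vv l)"
    have h: "h > 0" using s v by (simp add: h_def)
    have J1: "Jf s < 11 / 10 * h" using s0(2)[OF s(1) sb(1)] s by (simp add: h_def divide_less_eq mult_ac)
    \<comment> \<open>The term \<open>d\<close> keeps the final cost at \<open>2 * d\<close>; the
      term \<open>h / 10\<close> keeps the entropy of the near-minimizer below 12/10 of the leading
      order \<open>h\<close>.\<close>
    have "Jf s < Jf s + min d (h / 10)" using d h by simp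
    then have "\<exists>y\<in>ent (par l) ` {q. bdens (par l) q \<and> s \<le> Vf (tilt (par l) q)}. y < Jf s + min d (h / 10)"
      using Jf_upper(1)[OF s(1) sb(3,4)] unfolding Jf_def[of s] by (intro cInf_lessD) simp_all
    then obtain q where q: "bdens (par l) q" "s \<le> Vf (tilt (par l) q)" "ent (par l) q < Jf s + min d (h / 10)"
      by blast
    have eq: "ent (par l) q \<le> Jf s + d" "ent (par l) q \<le> 12 / 10 * h" using q(3) J1 by auto
    have "12 / 10 * h \<le> s^2 / vv l" using v by (simp add: h_def field_simps)
    then have eq2: "ent (par l) q \<le> s^2 / vv l" using eq by linarith
    have tv: "(\<integral>x. \<bar>q x - 1\<bar> \<partial>par l) \<le> vv l / 20"
    proof -
      have "(\<integral>x. \<bar>q x - 1\<bar> \<partial>par l) \<le> K1 l * s" by (rule tv_small[OF l q(1) eq2 s(1) sb(2)])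
      also have "\<dots> \<le> vv l / 20" using sb(5) K by (simp add: le_divide_eq mult_ac)
      finally show ?thesis .
    qed
    \<comment> \<open>Slack because the supremum over \<open>t\<close> need not be attained:
      \<open>s / 10\<close> serves the variance estimate, and \<open>d * vv l / 4\<close> costs half
      of what boosting gains.\<close>
    define g where "g = min (s / 10) (d * vv l / 4)"
    have g: "g > 0" using s d v by (simp add: g_def)
    note pl = densD(5)[OF l bdens_dens[OF l q(1)]]
    have "\<exists>t\<ge>1. s - g < \<bar>Phi (tilt (par l) q) t\<bar>"
    proof (rule ccontr)
      assume "\<not> ?thesis"
      then have "Vf (tilt (par l) q) \<le> s - g" by (intro Vf_le) (auto simp: not_less)
      then show False using q(2) g by linarith
    qed
    then obtain t where t: "t \<ge> 1" "s - g < \<bar>Phi (tilt (par l) q) t\<bar>" by auto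
    \<comment> \<open>Of the value at least 9/10 s at \<open>t\<close>, the entropy term explains at
      most 6/10 s and the quadratic error s / 20. At least s / 4 is left for the variance
      term.\<close>
    have vt: "vv l / 2 \<le> vps l t"
    proof -
      have "\<bar>Phi (tilt (par l) q) t\<bar> \<le> 4 * vv l * ent (par l) q / s + s * vps l t / (2 * vv l) + K2 l * s^2"
        using s sb v by (intro Phi_bound[OF l q(1) eq2 _ _ _ t(1)]) auto
      moreover have "4 * vv l * ent (par l) q / s \<le> 4 * vv l * (12 / 10 * h) / s"
        using eq v s by (intro divide_right_mono mult_left_mono) auto
      moreover have "4 * vv l * (12 / 10 * h) / s = 6 / 10 * s" using v s by (simp add: h_def field_simps power2_eq_square)
      moreover have "K2 l * s^2 \<le> s / 20"
      proof -
        have "K2 l * s \<le> 1 / 20" using sb(6) K by (simp add: le_divide_eq mult_ac)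
        then have "(K2 l * s) * s \<le> 1 / 20 * s" using s by (intro mult_right_mono) auto
        then show ?thesis by (simp add: power2_eq_square)
      qed
      moreover have "s - s / 10 < \<bar>Phi (tilt (par l) q) t\<bar>" using t(2) by (simp add: g_def)
      ultimately have "s / 4 \<le> s * vps l t / (2 * vv l)" by linarith
      then have "s * (vv l / 2) \<le> s * vps l t" using v by (simp add: field_simps)
      then show ?thesis using s by simp
    qed
    from boost[OF q(1) t(1) vt tv d] obtain r where r: "bdens (par l) r" "ent (par l) r \<le> ent (par l) q + d"
      "\<bar>Phi (tilt (par l) q) t\<bar> + d * vv l / 2 \<le> \<bar>Phi (tilt (par l) r) t\<bar>" by auto
    have "s + d * vv l / 4 \<le> \<bar>Phi (tilt (par l) r) t\<bar>" using r(3) t(2) by (simp add: g_def min_def split: if_splits)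
    also have "\<dots> \<le> Vf (tilt (par l) r)"
      by (rule abs_Phi_le_Vf[OF densD(5)[OF l bdens_dens[OF l r(1)]] t(1)])
    finally have V: "s + d * vv l / 4 \<le> Vf (tilt (par l) r)" .
    show "{q. bdens (par l) q \<and> s + d * vv l / 4 \<le> Vf (tilt (par l) q)} \<noteq> {}" using V r(1) by blast
    show "Jf (s + d * vv l / 4) \<le> Jf s + 2 * d" using Jf_le[OF r(1) V] r(2) eq(1) by linarith
  qed
qed

end

section \<open>The large deviation rate under the null hypothesis\<close>

text \<open>The lower bound needs a law whose value lies strictly above \<open>t\<close>, the upper
  bound a level strictly below \<open>t\<close>; \<open>Jf_step\<close> is applied at
  \<open>t\<close> and at the lower level to return both to \<open>Jf l t\<close>.\<close>

lemma rate_limit: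
  assumes l: "l > 0"
  shows "\<exists>s1>0. \<forall>t. 0 < t \<longrightarrow> t < s1 \<longrightarrow>
    (\<lambda>n. - (1 / real n) * ln (\<P>(x in iid (par l) n. t \<le> Vn n x))) \<longlonglongrightarrow> Jf l t"
proof -
  note v = vv_pos[OF l] vv_le_1[OF l]
  obtain s1 where s1: "s1 > 0" "\<And>s d. 0 < s \<Longrightarrow> s \<le> s1 \<Longrightarrow> 0 < d \<Longrightarrow> d \<le> vv l / 20 \<Longrightarrow>
     {q. bdens (par l) q \<and> s + d * vv l / 4 \<le> Vf (tilt (par l) q)} \<noteq> {} \<and> Jf l (s + d * vv l / 4) \<le> Jf l s + 2 * d"
    using Jf_step[OF l] by blast
  show ?thesis
  proof (intro exI[of _ s1] conjI allI impI s1(1))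
    fix t :: real assume t: "0 < t" "t < s1"
    define p where "p n = \<P>(x in iid (par l) n. t \<le> Vn n x)" for n
    have "(\<lambda>n. - (1 / real n) * ln (p n)) \<longlonglongrightarrow> Jf l t"
    proof (rule tendstoI)
      fix e :: real assume e: "e > 0"
      \<comment> \<open>With \<open>e / 8\<close> each Lipschitz step costs at most
        \<open>e / 4\<close>; with \<open>t\<close> and \<open>vv l \<le> 1\<close> the lower level
        stays positive.\<close>
      define d where "d = Min {vv l / 20, e / 8, t}"
      have d: "0 < d" "d \<le> vv l / 20" "d \<le> e / 8" "d \<le> t" using v e t by (auto simp: d_def)
      have dv: "0 < d * vv l / 4" "d * vv l / 4 < t"
      proof -
        show "0 < d * vv l / 4" using d v by simp
        have "d * vv l \<le> d * 1" using d v by (intro mult_left_mono) auto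
        then show "d * vv l / 4 < t" using d by linarith
      qed
      from s1(2)[of t d] t d have
        ne: "{q. bdens (par l) q \<and> t + d * vv l / 4 \<le> Vf (tilt (par l) q)} \<noteq> {}" and
        up: "Jf l (t + d * vv l / 4) \<le> Jf l t + 2 * d" by auto
      have "\<exists>y\<in>ent (par l) ` {q. bdens (par l) q \<and> t + d * vv l / 4 \<le> Vf (tilt (par l) q)}. y < Jf l t + e / 2"
        using up d e ne unfolding Jf_def[OF l, of "t + d * vv l / 4"] by (intro cInf_lessD) simp_all
      then obtain q where q: "bdens (par l) q" "t + d * vv l / 4 \<le> Vf (tilt (par l) q)" "ent (par l) q < Jf l t + e / 2"
        by blast
      have "t < Vf (tilt (par l) q)" using q(2) dv by linarith
      then have LB: "\<forall>\<^sub>F n in sequentially. exp (- (real n * (ent (par l) q + e / 4))) \<le> p n"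
        unfolding p_def using e by (intro Vn_lower_bound[OF pos_law_par[OF l] emeasure_par_singleton q(1)]) auto
      define s where "s = t - d * vv l / 4"
      have s: "0 < s" "s < t" "s + d * vv l / 4 = t" using dv by (auto simp: s_def)
      have Js: "Jf l t \<le> Jf l s + 2 * d" using s1(2)[of s d] s t d by simp
      define L where "L = Jf l t - e / 4"
      have "L \<le> ent (par l) q" if "bdens (par l) q" "s \<le> Vf (tilt (par l) q)" for q
        using Jf_le[OF l that] Js d unfolding L_def by linarith
      from Vn_upper_bound[OF l s(2) this] obtain m where
        UB: "\<forall>\<^sub>F n in sequentially. p n \<le> (real n + 1) ^ m * exp (- (real n * L))" unfolding p_def by blast
      \<comment> \<open>The polynomial number of types disappears on the exponential scale.\<close>
      have "(\<lambda>n. real m * ln (real n + 1) / real n) \<longlonglongrightarrow> 0" by real_asymp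
      then have small: "\<forall>\<^sub>F n in sequentially. real m * ln (real n + 1) / real n < e / 2"
        using e by (intro order_tendstoD(2)) auto
      show "\<forall>\<^sub>F n in sequentially. dist (- (1 / real n) * ln (p n)) (Jf l t) < e"
        using LB UB small eventually_gt_at_top[of 0]
      proof eventually_elim
        case (elim n)
        have p: "0 < p n" using elim(1) exp_gt_zero[of "- (real n * (ent (par l) q + e / 4))"] by linarith
        have "ln (exp (- (real n * (ent (par l) q + e / 4)))) \<le> ln (p n)"
          using elim(1) p by (subst ln_le_cancel_iff) auto
        then have lo: "- (real n * (ent (par l) q + e / 4)) \<le> ln (p n)" by simp
        have "ln (p n) \<le> ln ((real n + 1) ^ m * exp (- (real n * L)))"
          using elim(2) p by (subst ln_le_cancel_iff) auto
        also have "\<dots> = real m * ln (real n + 1) - real n * L"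
          by (subst ln_mult_pos) (auto simp: ln_realpow)
        finally have hi: "ln (p n) \<le> real m * ln (real n + 1) - real n * L" .
        have "- (1 / real n) * ln (p n) \<le> ent (par l) q + e / 4"
          using lo elim(4) by (simp add: field_simps)
        moreover have "L - real m * ln (real n + 1) / real n \<le> - (1 / real n) * ln (p n)"
        proof -
          have "ln (p n) / n \<le> (real m * ln (real n + 1) - real n * L) / n"
            by (rule divide_right_mono[OF hi]) simp
          also have "\<dots> = real m * ln (real n + 1) / real n - L"
            using elim(4) by (simp add: diff_divide_distrib)
          finally show ?thesis by simp
        qed
        ultimately show ?case using q(3) elim(3) unfolding L_def dist_real_def abs_less_iff by linarith
      qed
    qed
    then show "(\<lambda>n. - (1 / real n) * ln (\<P>(x in iid (par l) n. t \<le> Vn n x))) \<longlonglongrightarrow> Jf l t"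
      unfolding p_def .
  qed
qed

section \<open>Invariance of the statistic under powers and the null distribution\<close>

lemma distr_par_powr:
  assumes "l > 0" "k > 0"
  shows "distr (par l) borel (\<lambda>x. x powr (l / k)) = par k"
proof (rule cdf_unique)
  interpret L: prob_space "par l" by (rule prob_space_par[OF assms(1)])
  interpret K: prob_space "par k" by (rule prob_space_par[OF assms(2)])
  interpret D: prob_space "distr (par l) borel (\<lambda>x. x powr (l / k))" by (rule L.prob_space_distr) simp
  show "real_distribution (distr (par l) borel (\<lambda>x. x powr (l / k)))" by standard auto
  show "real_distribution (par k)" by standard auto
  show "cdf (distr (par l) borel (\<lambda>x. x powr (l / k))) = cdf (par k)"
  proof
    fix a
    have c: "l / k > 0" using assms by simp
    have "cdf (distr (par l) borel (\<lambda>x. x powr (l / k))) a = measure (par l) {x. x powr (l / k) \<le> a}"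
      unfolding cdf_def by (subst measure_distr) (auto simp: vimage_def)
    also have "\<dots> = measure (par k) {..a}"
    proof (cases "a < 1")
      case True
      have "AE x in par l. (x \<in> {x. x powr (l / k) \<le> a}) = (x \<in> {})"
        using AE_par_ge1[of l]
      proof eventually_elim
        case (elim x)
        have "1 \<le> x powr (l / k)" using elim c by (intro ge_one_powr_ge_zero) auto
        then show ?case using True by simp
      qed
      then have "measure (par l) {x. x powr (l / k) \<le> a} = measure (par l) {}"
        by (intro measure_eq_AE) auto
      then show ?thesis using Fp_less1[OF assms(2) True] by (simp add: Fp_def[OF assms(2)])
    next
      case False
      define y where "y = a powr (k / l)"
      have y: "y \<ge> 1" "y powr (l / k) = a" "y powr (- l) = a powr (- k)"
        using False assms by (auto simp: y_def powr_powr intro!: ge_one_powr_ge_zero)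
      have "AE x in par l. (x \<in> {x. x powr (l / k) \<le> a}) = (x \<in> {..y})"
        using AE_par_ge1[of l]
      proof eventually_elim
        case (elim x)
        have "x powr (l / k) \<le> y powr (l / k) \<longleftrightarrow> x \<le> y"
          using elim y(1) c powr_mono2[of "l / k" x y] powr_less_mono2[of "l / k" y x] by (cases "x \<le> y") auto
        then show ?case using y(2) by simp
      qed
      then have "measure (par l) {x. x powr (l / k) \<le> a} = measure (par l) {..y}"
        by (intro measure_eq_AE) auto
      then show ?thesis
        using measure_par_atMost[OF assms(1) y(1)] measure_par_atMost[OF assms(2), of a] False y(3) by simp
    qed
    finally show "cdf (distr (par l) borel (\<lambda>x. x powr (l / k))) a = cdf (par k) a" by (simp add: cdf_def)
  qed
qed

text \<open>A positive power is increasing and compatible with quotients, so comparisons with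
  \<open>t\<close> become comparisons with \<open>t powr c\<close>; and \<open>t powr c\<close> runs
  through the same half-line.\<close>

lemma Vn_powr:
  assumes c: "c > 0" and pos: "\<And>i. i < n \<Longrightarrow> x i > 0" and y: "\<And>i. i < n \<Longrightarrow> y i = x i powr c"
  shows "Vn n y = Vn n x"
proof -
  have iff: "a powr c \<le> b powr c \<longleftrightarrow> a \<le> b" if "a > 0" "b > 0" for a b :: real
    using that c powr_mono2[of c a b] powr_less_mono2[of c b a] by (cases "a \<le> b") auto
  have F: "Fn n y (t powr c) = Fn n x t" if "t \<ge> 1" for t
  proof -
    have "{i. i < n \<and> y i \<le> t powr c} = {i. i < n \<and> x i \<le> t}"
      using y iff pos that by (intro Collect_cong) auto
    then show ?thesis by (simp add: Fn_def)
  qed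
  have M: "Mn n y (t powr c) = Mn n x t" if "t \<ge> 1" for t
  proof -
    have "max (y i / y j) (y j / y i) \<le> t powr c \<longleftrightarrow> max (x i / x j) (x j / x i) \<le> t" if ij: "i < j" "j < n" for i j
    proof -
      have p: "x i > 0" "x j > 0" using pos ij by auto
      have "y i / y j = (x i / x j) powr c" "y j / y i = (x j / x i) powr c"
        using y ij p by (simp_all add: powr_divide)
      then show ?thesis using iff[of "x i / x j" t] iff[of "x j / x i" t] p \<open>t \<ge> 1\<close> by simp
    qed
    then have "{(i, j). i < j \<and> j < n \<and> max (y i / y j) (y j / y i) \<le> t powr c} =
        {(i, j). i < j \<and> j < n \<and> max (x i / x j) (x j / x i) \<le> t}"
      by (intro Collect_cong) (auto simp del: max.bounded_iff)
    then show ?thesis by (simp add: Mn_def)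
  qed
  have img: "(\<lambda>t. t powr c) ` {1..} = {1::real..}"
  proof (intro equalityI subsetI)
    fix t :: real assume "t \<in> {1..}"
    then show "t \<in> (\<lambda>t. t powr c) ` {1..}"
      using c by (intro image_eqI[of _ _ "t powr (1 / c)"]) (auto simp: powr_powr intro!: ge_one_powr_ge_zero)
  qed (use c in \<open>auto intro!: ge_one_powr_ge_zero\<close>)
  have "Vn n y = (SUP t\<in>(\<lambda>t. t powr c) ` {1..}. \<bar>Mn n y t - Fn n y t\<bar>)" unfolding Vn_def img ..
  also have "\<dots> = (SUP t\<in>{1..}. \<bar>Mn n y (t powr c) - Fn n y (t powr c)\<bar>)" by (simp add: image_image)
  also have "\<dots> = Vn n x" unfolding Vn_def using F M by (intro SUP_cong) auto
  finally show ?thesis .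
qed

text \<open>Powers map the Pareto laws onto each other and only reparametrize \<open>t\<close>, so the statistic is distribution-free under the null hypothesis.\<close>

lemma Vn_distribution_free:
  assumes "l > 0" "k > 0"
  shows "\<P>(x in iid (par k) n. Vn n x < t) =
    \<P>(x in iid (par l) n. Vn n x < t)"
proof -
  define f where "f = (\<lambda>x :: real. x powr (l / k))"
  have pl: "prob_space (par l)" and pk: "prob_space (par k)" using assms by (auto intro: prob_space_par)
  have [measurable]: "f \<in> borel_measurable (par l)" unfolding f_def by measurable
  have fk: "f \<in> par l \<rightarrow>\<^sub>M par k" using measurable_cong_sets[OF refl sets_par] by auto
  \<comment> \<open>\<open>compose\<close> restricts to the index set, as points of the product
    space must be undefined outside it.\<close>
  have D: "distr (iid (par l) n) (iid (par k) n) (compose {..<n} f) = iid (par k) n"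
  proof -
    have "distr (iid (par l) n) (iid (par k) n) (compose {..<n} f) = PiM {..<n} (\<lambda>i. distr (par l) (par k) f)"
      using pl pk fk by (intro distr_PiM_finite_prob_space') auto
    also have "distr (par l) (par k) f = distr (par l) borel f" by (intro distr_cong) auto
    also have "\<dots> = par k" unfolding f_def by (rule distr_par_powr[OF assms])
    finally show ?thesis .
  qed
  have cm: "compose {..<n} f \<in> iid (par l) n \<rightarrow>\<^sub>M iid (par k) n"
    unfolding compose_def
    by (intro measurable_restrict measurable_compose[OF _ fk] measurable_component_singleton) auto
  have Vm [measurable]: "Vn n \<in> borel_measurable (iid (par k) n)" "Vn n \<in> borel_measurable (iid (par l) n)"
    by (intro Vn_measurable; simp)+
  have A: "{x \<in> space (iid (par k) n). Vn n x < t} \<in> sets (iid (par k) n)" by measurable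
  have B: "{x \<in> space (iid (par l) n). Vn n x < t} \<in> sets (iid (par l) n)" by measurable
  have "\<P>(x in iid (par k) n. Vn n x < t) =
     measure (iid (par l) n) (compose {..<n} f -` {x \<in> space (iid (par k) n). Vn n x < t} \<inter> space (iid (par l) n))"
    by (subst D[symmetric], rule measure_distr[OF cm A])
  also have "\<dots> = \<P>(x in iid (par l) n. Vn n x < t)"
  proof (rule measure_eq_AE[OF _ measurable_sets[OF cm A] B])
    have "AE x in iid (par l) n. \<forall>i<n. 1 \<le> x i" by (rule AE_iid[OF pl AE_par_ge1])
    then show "AE x in iid (par l) n. (x \<in> compose {..<n} f -` {x \<in> space (iid (par k) n). Vn n x < t} \<inter> space (iid (par l) n)) =
        (x \<in> {x \<in> space (iid (par l) n). Vn n x < t})"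
      using AE_space
    proof eventually_elim
      case (elim x)
      have "Vn n (compose {..<n} f x) = Vn n x"
        using assms elim(1) by (intro Vn_powr[of "l / k"]) (auto simp: compose_def f_def intro: less_le_trans[of 0 1])
      moreover have "compose {..<n} f x \<in> space (iid (par k) n)" by (rule measurable_space[OF cm elim(2)])
      ultimately show ?case using elim(2) by simp
    qed
  qed
  finally show ?thesis .
qed

text \<open>The infimum over the null parameter is over a constant family, by
  \<open>Vn_distribution_free\<close>.\<close>

lemma one_minus_Gn:
  assumes l: "l > 0"
  shows "1 - Gn n t = \<P>(x in iid (par l) n. t \<le> Vn n x)"
proof -
  interpret I: prob_space "iid (par l) n" by (rule prob_space_iid[OF prob_space_par[OF l]])
  have Vm [measurable]: "Vn n \<in> borel_measurable (iid (par l) n)" by (intro Vn_measurable) simp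
  have A: "{x \<in> space (iid (par l) n). Vn n x < t} \<in> sets (iid (par l) n)" by measurable
  have im: "(\<lambda>lam. \<P>(x in iid (par lam) n. Vn n x < t)) ` {0<..} =
      (\<lambda>lam. \<P>(x in iid (par l) n. Vn n x < t)) ` {0::real<..}"
  proof (rule image_cong[OF refl])
    fix k :: real assume "k \<in> {0<..}"
    then have "k > 0" by simp
    from Vn_distribution_free[OF l this]
    show "\<P>(x in iid (par k) n. Vn n x < t) =
      \<P>(x in iid (par l) n. Vn n x < t)" .
  qed
  have "Gn n t = (INF lam\<in>{0::real<..}. \<P>(x in iid (par l) n. Vn n x < t))"
    unfolding Gn_def sample_def par_def[symmetric] im ..
  also have "\<dots> = \<P>(x in iid (par l) n. Vn n x < t)"
    by (rule cINF_const) (auto intro: exI[of _ 1])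
  finally have "1 - Gn n t = measure (iid (par l) n) (space (iid (par l) n) - {x \<in> space (iid (par l) n). Vn n x < t})"
    using I.prob_compl[OF A] by simp
  also have "space (iid (par l) n) - {x \<in> space (iid (par l) n). Vn n x < t} = {x \<in> space (iid (par l) n). t \<le> Vn n x}"
    by auto
  finally show ?thesis .
qed

lemma ld_seq_limit:
  assumes l: "l > 0"
  shows "\<exists>s1>0. \<forall>t. 0 < t \<longrightarrow> t < s1 \<longrightarrow> ld_seq t \<longlonglongrightarrow> Jf l t"
  using rate_limit[OF l] unfolding ld_seq_def[abs_def] one_minus_Gn[OF l] .

section \<open>The alternatives\<close>

text \<open>The derivative of the alternative at 0 relative to the Pareto density. The value 0 below
  1 makes the tilt equal to 1 off the support, so its bounds hold at every point.\<close>

definition score :: "real \<Rightarrow> real \<Rightarrow> real \<Rightarrow> real \<Rightarrow> real" where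
  "score \<alpha> C D x = (if 1 \<le> x then C * ps \<alpha> (t0 \<alpha>) x + D * (ln x - 1 / \<alpha>) else 0)"

lemma g_alt_eq:
  assumes "\<alpha> > 0" shows "g_alt \<alpha> C D \<theta> x = pareto_dens \<alpha> x * (1 + \<theta> * score \<alpha> C D x)"
proof (cases "1 \<le> x")
  case True
  have p: "x powr (- \<alpha> - 1) = 1 / x powr (\<alpha> + 1)"
  proof -
    have "- \<alpha> - 1 = - (\<alpha> + 1)" by simp
    then show ?thesis by (simp only: powr_minus_divide)
  qed
  show ?thesis using True assms ps_eq_psi[OF assms t0_powr(1)[OF assms] True]
    unfolding g_alt_def h_alt_def score_def pareto_dens_def p by (simp add: field_simps)
qed (simp add: g_alt_def pareto_dens_def)

section \<open>Moments of the score of the alternatives\<close>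

context
  fixes \<alpha> C D :: real assumes \<alpha>: "\<alpha> > 0"
begin

interpretation P: prob_space "par \<alpha>" by (rule prob_space_par[OF \<alpha>])

lemma score_measurable [measurable]: "score \<alpha> C D \<in> borel_measurable borel"
  unfolding score_def using ps_measurable[OF \<alpha>, of "t0 \<alpha>"] by measurable

text \<open>\<open>score\<close> agrees with its formula only on the support, where the law
  lives.\<close>

lemma par_AE_cong:
  fixes f g :: "real \<Rightarrow> real"
  assumes "has_bochner_integral (par \<alpha>) f I" "f \<in> borel_measurable borel" "g \<in> borel_measurable borel"
    "\<And>x. 1 \<le> x \<Longrightarrow> f x = g x"
  shows "has_bochner_integral (par \<alpha>) g I"
proof (rule has_bochner_integral_cong_AE[THEN iffD1, OF _ _ _ assms(1)])
  show "AE x in par \<alpha>. f x = g x" using AE_par_ge1[of \<alpha>] by eventually_elim (rule assms(4))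
qed (use assms in simp_all)

definition cps :: "real \<Rightarrow> real" where "cps t = (\<integral>x. ps \<alpha> (t0 \<alpha>) x * ps \<alpha> t x \<partial>par \<alpha>)"

text \<open>The Cauchy-Schwarz step in additive form: the product is at most half the sum of the
  squares, and neither variance exceeds the maximum \<open>vv \<alpha>\<close>.\<close>

lemma
  assumes t: "t \<ge> 1"
  shows cps: "has_bochner_integral (par \<alpha>) (\<lambda>x. ps \<alpha> (t0 \<alpha>) x * ps \<alpha> t x) (cps t)"
    and abs_cps_le: "\<bar>cps t\<bar> \<le> vv \<alpha>"
proof -
  note T = t0_powr(1)[OF \<alpha>]
  note I = ps_integrals[OF \<alpha> t] ps_integrals[OF \<alpha> T]
  have "\<bar>ps \<alpha> (t0 \<alpha>) x * ps \<alpha> t x\<bar> \<le> 1" for x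
    unfolding abs_mult using mult_mono[OF abs_ps_le_1[OF \<alpha>, of "t0 \<alpha>" x] abs_ps_le_1[OF \<alpha>, of t x]] by simp
  then have i: "integrable (par \<alpha>) (\<lambda>x. ps \<alpha> (t0 \<alpha>) x * ps \<alpha> t x)"
    using ps_measurable[OF \<alpha>] by (intro P.integrable_const_bound[of _ 1]) auto
  then show "has_bochner_integral (par \<alpha>) (\<lambda>x. ps \<alpha> (t0 \<alpha>) x * ps \<alpha> t x) (cps t)"
    by (simp add: has_bochner_integral_iff cps_def)
  have "\<bar>cps t\<bar> \<le> (\<integral>x. \<bar>ps \<alpha> (t0 \<alpha>) x * ps \<alpha> t x\<bar> \<partial>par \<alpha>)" unfolding cps_def by (rule integral_abs_bound)
  also have "\<dots> \<le> (\<integral>x. (ps \<alpha> (t0 \<alpha>) x)^2 / 2 + (ps \<alpha> t x)^2 / 2 \<partial>par \<alpha>)"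
  proof (rule integral_mono)
    show "integrable (par \<alpha>) (\<lambda>x. \<bar>ps \<alpha> (t0 \<alpha>) x * ps \<alpha> t x\<bar>)" using i by simp
    show "integrable (par \<alpha>) (\<lambda>x. (ps \<alpha> (t0 \<alpha>) x)^2 / 2 + (ps \<alpha> t x)^2 / 2)" using I by simp
    fix x
    have "0 \<le> (\<bar>ps \<alpha> (t0 \<alpha>) x\<bar> - \<bar>ps \<alpha> t x\<bar>)^2" by simp
    then show "\<bar>ps \<alpha> (t0 \<alpha>) x * ps \<alpha> t x\<bar> \<le> (ps \<alpha> (t0 \<alpha>) x)^2 / 2 + (ps \<alpha> t x)^2 / 2"
      by (simp add: power2_diff abs_mult)
  qed
  also have "\<dots> = vv \<alpha> / 2 + vps \<alpha> t / 2" using I unfolding vv_def[OF \<alpha>] by simp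
  also have "\<dots> \<le> vv \<alpha>" using vps_le_vv[OF \<alpha> t] by simp
  finally show "\<bar>cps t\<bar> \<le> vv \<alpha>" .
qed

lemma cps_t0: "cps (t0 \<alpha>) = vv \<alpha>"
  using ps_integrals[OF \<alpha> t0_powr(1)[OF \<alpha>]] unfolding cps_def vv_def[OF \<alpha>] by (simp add: power2_eq_square)

lemma hbi_one: "has_bochner_integral (par \<alpha>) (\<lambda>_. c) (c :: real)"
  using has_bochner_integral_mult_right[OF has_bochner_integral_par_one[OF \<alpha>], of c] by simp

lemma hbi_centred_ln: "has_bochner_integral (par \<alpha>) (\<lambda>x. ln x - 1 / \<alpha>) 0"
  using has_bochner_integral_diff[OF has_bochner_integral_par_ln[OF \<alpha>] hbi_one[of "1 / \<alpha>"]] by simp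

lemma score_integral: "has_bochner_integral (par \<alpha>) (score \<alpha> C D) 0"
proof (rule par_AE_cong)
  show "has_bochner_integral (par \<alpha>) (\<lambda>x. C * ps \<alpha> (t0 \<alpha>) x + D * (ln x - 1 / \<alpha>)) 0"
    using has_bochner_integral_add[OF has_bochner_integral_mult_right[OF has_bochner_integral_ps[OF \<alpha> t0_powr(1)[OF \<alpha>]], of C]
      has_bochner_integral_mult_right[OF hbi_centred_ln, of D]] by simp
qed (use ps_measurable[OF \<alpha>, of "t0 \<alpha>"] in \<open>auto simp: score_def\<close>)

lemma score_ps_integral:
  assumes t: "t \<ge> 1" shows "has_bochner_integral (par \<alpha>) (\<lambda>x. score \<alpha> C D x * ps \<alpha> t x) (C * cps t)"
proof (rule par_AE_cong)
  have "has_bochner_integral (par \<alpha>) (\<lambda>x. C * (ps \<alpha> (t0 \<alpha>) x * ps \<alpha> t x) + D * (ps \<alpha> t x * ln x - 1 / \<alpha> * ps \<alpha> t x))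
     (C * cps t + D * (0 - 1 / \<alpha> * 0))"
    by (intro has_bochner_integral_add has_bochner_integral_diff has_bochner_integral_mult_right cps
        has_bochner_integral_ps_ln has_bochner_integral_ps \<alpha> t)
  then show "has_bochner_integral (par \<alpha>) (\<lambda>x. C * (ps \<alpha> (t0 \<alpha>) x * ps \<alpha> t x) + D * (ps \<alpha> t x * ln x - 1 / \<alpha> * ps \<alpha> t x)) (C * cps t)"
    by simp
qed (use ps_measurable[OF \<alpha>, of "t0 \<alpha>"] ps_measurable[OF \<alpha>, of t] in \<open>auto simp: score_def algebra_simps\<close>)

text \<open>Orthogonality removes the projection, and what remains is the variance
  \<open>1 / \<alpha>^2\<close> of the logarithm times \<open>D\<close>.\<close>

lemma score_ln_integral: "has_bochner_integral (par \<alpha>) (\<lambda>x. score \<alpha> C D x * ln x) (D / \<alpha>^2)"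
proof (rule par_AE_cong)
  have "has_bochner_integral (par \<alpha>) (\<lambda>x. C * (ps \<alpha> (t0 \<alpha>) x * ln x) + D * ((ln x)^2 - 1 / \<alpha> * ln x))
     (C * 0 + D * (2 / \<alpha>^2 - 1 / \<alpha> * (1 / \<alpha>)))"
    by (intro has_bochner_integral_add has_bochner_integral_diff has_bochner_integral_mult_right
        has_bochner_integral_ps_ln has_bochner_integral_par_ln has_bochner_integral_par_ln2 \<alpha> t0_powr(1))
  moreover have "C * 0 + D * (2 / \<alpha>^2 - 1 / \<alpha> * (1 / \<alpha>)) = D / \<alpha>^2" using \<alpha> by (simp add: field_simps power2_eq_square)
  ultimately show "has_bochner_integral (par \<alpha>) (\<lambda>x. C * (ps \<alpha> (t0 \<alpha>) x * ln x) + D * ((ln x)^2 - 1 / \<alpha> * ln x)) (D / \<alpha>^2)"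
    by simp
qed (use ps_measurable[OF \<alpha>, of "t0 \<alpha>"] in \<open>auto simp: score_def algebra_simps power2_eq_square\<close>)

lemma score2_integral: "has_bochner_integral (par \<alpha>) (\<lambda>x. (score \<alpha> C D x)^2) (C^2 * vv \<alpha> + D^2 / \<alpha>^2)"
proof (rule par_AE_cong)
  let ?p = "ps \<alpha> (t0 \<alpha>)"
  have p2: "has_bochner_integral (par \<alpha>) (\<lambda>x. (?p x)^2) (vv \<alpha>)"
    unfolding vv_def[OF \<alpha>] by (rule has_bochner_integral_ps2[OF \<alpha> t0_powr(1)[OF \<alpha>]])
  have "has_bochner_integral (par \<alpha>) (\<lambda>x. C^2 * (?p x)^2 + (2 * C * D * (?p x * ln x - 1 / \<alpha> * ?p x) +
      D^2 * ((ln x)^2 - 2 / \<alpha> * ln x + 1 / \<alpha>^2)))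
     (C^2 * vv \<alpha> + (2 * C * D * (0 - 1 / \<alpha> * 0) + D^2 * (2 / \<alpha>^2 - 2 / \<alpha> * (1 / \<alpha>) + 1 / \<alpha>^2)))"
    by (intro has_bochner_integral_add has_bochner_integral_diff has_bochner_integral_mult_right p2 hbi_one
        has_bochner_integral_ps_ln has_bochner_integral_ps has_bochner_integral_par_ln has_bochner_integral_par_ln2 \<alpha> t0_powr(1))
  moreover have "C^2 * vv \<alpha> + (2 * C * D * (0 - 1 / \<alpha> * 0) + D^2 * (2 / \<alpha>^2 - 2 / \<alpha> * (1 / \<alpha>) + 1 / \<alpha>^2)) = C^2 * vv \<alpha> + D^2 / \<alpha>^2"
    using \<alpha> by (simp add: power2_eq_square)
  ultimately show "has_bochner_integral (par \<alpha>) (\<lambda>x. C^2 * (?p x)^2 + (2 * C * D * (?p x * ln x - 1 / \<alpha> * ?p x) +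
      D^2 * ((ln x)^2 - 2 / \<alpha> * ln x + 1 / \<alpha>^2))) (C^2 * vv \<alpha> + D^2 / \<alpha>^2)" by simp
  fix x :: real assume "1 \<le> x"
  then have *: "score \<alpha> C D x = C * ?p x + D * (ln x - 1 / \<alpha>)" by (simp add: score_def)
  show "C^2 * (?p x)^2 + (2 * C * D * (?p x * ln x - 1 / \<alpha> * ?p x) +
      D^2 * ((ln x)^2 - 2 / \<alpha> * ln x + 1 / \<alpha>^2)) = (score \<alpha> C D x)^2"
    unfolding * using \<alpha> by (simp add: power2_eq_square field_simps)
qed (use ps_measurable[OF \<alpha>, of "t0 \<alpha>"] in measurable)

text \<open>Domination by the cube of \<open>a + b * ln x\<close>; this third moment controls the
  cubic error in the entropy of the alternative.\<close>

lemma score3_integrable: "integrable (par \<alpha>) (\<lambda>x. \<bar>score \<alpha> C D x\<bar>^3)"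
proof -
  define a where "a = \<bar>C\<bar> + \<bar>D\<bar> / \<alpha>"
  define b where "b = \<bar>D\<bar>"
  have ab: "a \<ge> 0" "b \<ge> 0" using \<alpha> by (auto simp: a_def b_def)
  have "integrable (par \<alpha>) (\<lambda>x. a^3 + 3 * a^2 * b * ln x + 3 * a * b^2 * (ln x)^2 + b^3 * (ln x)^3)"
    using integrable_par_ln3[OF \<alpha>] has_bochner_integral_par_ln[OF \<alpha>] has_bochner_integral_par_ln2[OF \<alpha>]
    by (intro Bochner_Integration.integrable_add integrable_mult_right P.integrable_const) (auto simp: has_bochner_integral_iff)
  then show ?thesis
  proof (rule Bochner_Integration.integrable_bound)
    show "(\<lambda>x. \<bar>score \<alpha> C D x\<bar>^3) \<in> borel_measurable (par \<alpha>)" by measurable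
    show "AE x in par \<alpha>. norm (\<bar>score \<alpha> C D x\<bar>^3) \<le> norm (a^3 + 3 * a^2 * b * ln x + 3 * a * b^2 * (ln x)^2 + b^3 * (ln x)^3)"
      using AE_par_ge1[of \<alpha>]
    proof eventually_elim
      case (elim x)
      then have l: "0 \<le> ln x" by simp
      have "\<bar>score \<alpha> C D x\<bar> \<le> \<bar>C * ps \<alpha> (t0 \<alpha>) x\<bar> + \<bar>D * (ln x - 1 / \<alpha>)\<bar>"
        using elim by (simp add: score_def abs_triangle_ineq)
      also have "\<dots> \<le> \<bar>C\<bar> * 1 + \<bar>D\<bar> * (ln x + 1 / \<alpha>)"
        unfolding abs_mult using abs_ps_le_1[OF \<alpha>] l \<alpha> by (intro add_mono mult_left_mono) (auto simp: abs_le_iff)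
      also have "\<dots> = a + b * ln x" by (simp add: a_def b_def algebra_simps)
      finally have "\<bar>score \<alpha> C D x\<bar>^3 \<le> (a + b * ln x)^3" by (intro power_mono) auto
      also have "\<dots> = a^3 + 3 * a^2 * b * ln x + 3 * a * b^2 * (ln x)^2 + b^3 * (ln x)^3"
        by (simp add: power2_eq_square power3_eq_cube algebra_simps)
      finally show ?case by simp
    qed
  qed
qed

section \<open>Limit of the statistic and divergence under the alternatives\<close>

definition tlt :: "real \<Rightarrow> real \<Rightarrow> real" where "tlt \<theta> x = 1 + \<theta> * score \<alpha> C D x"

lemma dens_tlt:
  assumes "\<And>x. 0 \<le> tlt \<theta> x" shows "dens (par \<alpha>) (tlt \<theta>)"
  using has_bochner_integral_add[OF has_bochner_integral_par_one[OF \<alpha>] has_bochner_integral_mult_right[OF score_integral, of \<theta>]]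
    assms unfolding dens_def tlt_def[abs_def] by simp

lemma sample_g_alt:
  assumes "\<And>x. 0 \<le> tlt \<theta> x" shows "sample (g_alt \<alpha> C D \<theta>) n = iid (tilt (par \<alpha>) (tlt \<theta>)) n"
proof -
  have "(\<lambda>x. ennreal (g_alt \<alpha> C D \<theta> x)) = (\<lambda>x. ennreal (pareto_dens \<alpha> x) * ennreal (tlt \<theta> x))"
    using assms by (simp add: g_alt_eq[OF \<alpha>] tlt_def[symmetric] ennreal_mult pareto_dens_nonneg[OF \<alpha>])
  then have "density lborel (\<lambda>x. ennreal (g_alt \<alpha> C D \<theta> x)) = tilt (par \<alpha>) (tlt \<theta>)"
    unfolding tilt_def par_def tlt_def[abs_def] by (subst density_density_eq) auto
  then show ?thesis by (simp add: sample_def)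
qed

lemma Vn_conv_prob_g_alt:
  assumes pos: "\<And>x. 0 \<le> tlt \<theta> x"
  shows "Vn_conv_prob (g_alt \<alpha> C D \<theta>) (Vf (tilt (par \<alpha>) (tlt \<theta>)))"
    "bV (g_alt \<alpha> C D) \<theta> = Vf (tilt (par \<alpha>) (tlt \<theta>))"
proof -
  note Q = densD[OF \<alpha> dens_tlt[OF pos]]
  show conv: "Vn_conv_prob (g_alt \<alpha> C D \<theta>) (Vf (tilt (par \<alpha>) (tlt \<theta>)))"
    unfolding Vn_conv_prob_def sample_g_alt[OF pos]
    by (intro allI impI Vn_converges Q(5) tilt_atomless[OF pos_law_par[OF \<alpha>] Q(1) emeasure_par_singleton])
  show "bV (g_alt \<alpha> C D) \<theta> = Vf (tilt (par \<alpha>) (tlt \<theta>))"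
    unfolding bV_def
  proof (rule the_equality[where P="Vn_conv_prob (g_alt \<alpha> C D \<theta>)", OF conv])
    fix b assume b: "Vn_conv_prob (g_alt \<alpha> C D \<theta>) b"
    show "b = Vf (tilt (par \<alpha>) (tlt \<theta>))"
      using b conv unfolding Vn_conv_prob_def sample_g_alt[OF pos]
      by (intro Vn_limit_unique[OF pos_lawD(1)[OF Q(5)] pos_lawD(2)[OF Q(5)]]) auto
  qed
qed

text \<open>The upper bound uses that no covariance with the projection at
  \<open>t0 \<alpha>\<close> exceeds \<open>vv \<alpha>\<close>, the lower bound that this value is
  reached at \<open>t0 \<alpha>\<close>; the remainder is quadratic in \<theta>.\<close>

lemma bV_expansion:
  assumes pos: "\<And>x. 0 \<le> tlt \<theta> x" and \<theta>: "0 \<le> \<theta>" and C: "0 \<le> C"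
  shows "\<bar>bV (g_alt \<alpha> C D) \<theta> - 2 * \<theta> * C * vv \<alpha>\<bar> \<le> \<theta>^2 * (\<integral>x. \<bar>score \<alpha> C D x\<bar> \<partial>par \<alpha>)^2"
proof -
  note q = dens_tlt[OF pos]
  define B where "B = \<theta>^2 * (\<integral>x. \<bar>score \<alpha> C D x\<bar> \<partial>par \<alpha>)^2"
  have "(\<integral>x. \<bar>tlt \<theta> x - 1\<bar> \<partial>par \<alpha>) = \<theta> * (\<integral>x. \<bar>score \<alpha> C D x\<bar> \<partial>par \<alpha>)"
    using \<theta> by (simp add: tlt_def abs_mult)
  then have R: "\<bar>Rem \<alpha> (tlt \<theta>) t\<bar> \<le> B" for t
    using abs_Rem_le[OF \<alpha> q, of t] by (simp add: B_def power_mult_distrib)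
  have Phi: "Phi (tilt (par \<alpha>) (tlt \<theta>)) t = 2 * \<theta> * C * cps t + Rem \<alpha> (tlt \<theta>) t" if t: "t \<ge> 1" for t
  proof -
    have "has_bochner_integral (par \<alpha>) (\<lambda>x. ps \<alpha> t x + \<theta> * (score \<alpha> C D x * ps \<alpha> t x)) (0 + \<theta> * (C * cps t))"
      by (intro has_bochner_integral_add has_bochner_integral_mult_right has_bochner_integral_ps score_ps_integral \<alpha> t)
    moreover have "(\<lambda>x. ps \<alpha> t x + \<theta> * (score \<alpha> C D x * ps \<alpha> t x)) = (\<lambda>x. tlt \<theta> x * ps \<alpha> t x)"
      by (auto simp: tlt_def algebra_simps)
    ultimately have "(\<integral>x. tlt \<theta> x * ps \<alpha> t x \<partial>par \<alpha>) = \<theta> * (C * cps t)" by (simp add: has_bochner_integral_iff)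
    then show ?thesis using Phi_tilt[OF \<alpha> q t] by simp
  qed
  have "Vf (tilt (par \<alpha>) (tlt \<theta>)) \<le> 2 * \<theta> * C * vv \<alpha> + B"
  proof (rule Vf_le)
    fix t :: real assume t: "1 \<le> t"
    have "\<bar>2 * \<theta> * C * cps t\<bar> = 2 * \<theta> * C * \<bar>cps t\<bar>" using \<theta> C by (simp add: abs_mult)
    also have "\<dots> \<le> 2 * \<theta> * C * vv \<alpha>" using \<theta> C abs_cps_le[OF t] by (intro mult_left_mono) auto
    finally show "\<bar>Phi (tilt (par \<alpha>) (tlt \<theta>)) t\<bar> \<le> 2 * \<theta> * C * vv \<alpha> + B"
      unfolding Phi[OF t] using R[of t] by linarith
  qed
  moreover have "2 * \<theta> * C * vv \<alpha> - B \<le> Vf (tilt (par \<alpha>) (tlt \<theta>))"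
    using abs_Phi_le_Vf[OF densD(5)[OF \<alpha> q] t0_powr(1)[OF \<alpha>]] R[of "t0 \<alpha>"]
    unfolding Phi[OF t0_powr(1)[OF \<alpha>]] cps_t0 by linarith
  ultimately show ?thesis unfolding Vn_conv_prob_g_alt(2)[OF pos] B_def[symmetric] by linarith
qed

text \<open>\<open>entropy_taylor\<close> integrated: the linear term has mean 0 and the quadratic
  one gives the second moment of the score. The bound 1/2 keeps the increment in the range of that
  estimate.\<close>

lemma ent_tlt:
  assumes pos: "\<And>x. 1 / 2 \<le> tlt \<theta> x" and \<theta>: "0 \<le> \<theta>"
  shows "integrable (par \<alpha>) (\<lambda>x. tlt \<theta> x * ln (tlt \<theta> x))"
    "\<bar>ent (par \<alpha>) (tlt \<theta>) - \<theta>^2 / 2 * (C^2 * vv \<alpha> + D^2 / \<alpha>^2)\<bar> \<le> \<theta>^3 * (\<integral>x. \<bar>score \<alpha> C D x\<bar>^3 \<partial>par \<alpha>)"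
proof -
  define f where "f x = \<theta> * score \<alpha> C D x + \<theta>^2 / 2 * (score \<alpha> C D x)^2" for x
  note I = score_integral score2_integral
  have f: "has_bochner_integral (par \<alpha>) f (\<theta> * 0 + \<theta>^2 / 2 * (C^2 * vv \<alpha> + D^2 / \<alpha>^2))"
    unfolding f_def by (intro has_bochner_integral_add has_bochner_integral_mult_right I)
  have b: "\<bar>tlt \<theta> x * ln (tlt \<theta> x) - f x\<bar> \<le> \<theta>^3 * \<bar>score \<alpha> C D x\<bar>^3" for x
  proof -
    have "- 1 / 2 \<le> \<theta> * score \<alpha> C D x" using pos[of x] by (simp add: tlt_def)
    from entropy_taylor[OF this] show ?thesis
      using \<theta> by (simp add: tlt_def f_def power_mult_distrib abs_mult algebra_simps)
  qed
  have i3: "integrable (par \<alpha>) (\<lambda>x. \<theta>^3 * \<bar>score \<alpha> C D x\<bar>^3)" using score3_integrable by simp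
  have id: "integrable (par \<alpha>) (\<lambda>x. tlt \<theta> x * ln (tlt \<theta> x) - f x)"
  proof (rule Bochner_Integration.integrable_bound[OF i3])
    show "(\<lambda>x. tlt \<theta> x * ln (tlt \<theta> x) - f x) \<in> borel_measurable (par \<alpha>)"
      unfolding tlt_def f_def by measurable
    show "AE x in par \<alpha>. norm (tlt \<theta> x * ln (tlt \<theta> x) - f x) \<le> norm (\<theta>^3 * \<bar>score \<alpha> C D x\<bar>^3)"
      using b \<theta> by (intro AE_I2) simp
  qed
  have iF: "integrable (par \<alpha>) f" using f by (simp add: has_bochner_integral_iff)
  show i: "integrable (par \<alpha>) (\<lambda>x. tlt \<theta> x * ln (tlt \<theta> x))"
    using Bochner_Integration.integrable_add[OF id iF] by simp
  have eq: "ent (par \<alpha>) (tlt \<theta>) - \<theta>^2 / 2 * (C^2 * vv \<alpha> + D^2 / \<alpha>^2) = (\<integral>x. tlt \<theta> x * ln (tlt \<theta> x) - f x \<partial>par \<alpha>)"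
    using i iF f by (simp add: ent_def has_bochner_integral_iff)
  have "\<bar>ent (par \<alpha>) (tlt \<theta>) - \<theta>^2 / 2 * (C^2 * vv \<alpha> + D^2 / \<alpha>^2)\<bar> \<le> (\<integral>x. \<bar>tlt \<theta> x * ln (tlt \<theta> x) - f x\<bar> \<partial>par \<alpha>)"
    unfolding eq by (rule integral_abs_bound)
  also have "\<dots> \<le> (\<integral>x. \<theta>^3 * \<bar>score \<alpha> C D x\<bar>^3 \<partial>par \<alpha>)" using id i3 b by (intro integral_mono) auto
  finally show "\<bar>ent (par \<alpha>) (tlt \<theta>) - \<theta>^2 / 2 * (C^2 * vv \<alpha> + D^2 / \<alpha>^2)\<bar> \<le> \<theta>^3 * (\<integral>x. \<bar>score \<alpha> C D x\<bar>^3 \<partial>par \<alpha>)" by simp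
qed

text \<open>The null parameter enters only through \<open>lam * L - ln lam\<close>, where
  \<open>L\<close> is the mean of the logarithm under the alternative; the minimum is at
  \<open>1 / L\<close>, the population form of the maximum likelihood estimate. The condition on
  \<open>\<theta> * D / \<alpha>\<close> says that \<open>L\<close> is positive.\<close>

lemma KL_eq:
  assumes pos: "\<And>x. 1 / 2 \<le> tlt \<theta> x" and \<theta>: "0 \<le> \<theta>" and y: "- 1 < \<theta> * D / \<alpha>"
  shows "KL (g_alt \<alpha> C D) \<theta> = ent (par \<alpha>) (tlt \<theta>) + ln (1 + \<theta> * D / \<alpha>) - \<theta> * D / \<alpha>"
proof -
  define R where "R = ent (par \<alpha>) (tlt \<theta>)"
  define L where "L = (1 + \<theta> * D / \<alpha>) / \<alpha>"
  have L: "L > 0" using y \<alpha> by (simp add: L_def)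
  have R: "has_bochner_integral (par \<alpha>) (\<lambda>x. tlt \<theta> x * ln (tlt \<theta> x)) R"
    using ent_tlt(1)[OF pos \<theta>] by (simp add: has_bochner_integral_iff R_def ent_def)
  have one: "has_bochner_integral (par \<alpha>) (tlt \<theta>) 1"
  proof -
    have "0 \<le> tlt \<theta> x" for x using pos[of x] by linarith
    from dens_tlt[OF this] show ?thesis by (simp add: dens_def)
  qed
  have lnL: "has_bochner_integral (par \<alpha>) (\<lambda>x. tlt \<theta> x * ln x) L"
  proof -
    have "has_bochner_integral (par \<alpha>) (\<lambda>x. ln x + \<theta> * (score \<alpha> C D x * ln x)) (1 / \<alpha> + \<theta> * (D / \<alpha>^2))"
      by (intro has_bochner_integral_add has_bochner_integral_mult_right has_bochner_integral_par_ln score_ln_integral \<alpha>)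
    moreover have "(\<lambda>x. ln x + \<theta> * (score \<alpha> C D x * ln x)) = (\<lambda>x. tlt \<theta> x * ln x)" by (auto simp: tlt_def algebra_simps)
    moreover have "1 / \<alpha> + \<theta> * (D / \<alpha>^2) = L" using \<alpha> by (simp add: L_def field_simps power2_eq_square)
    ultimately show ?thesis by simp
  qed
  have val: "(LINT x:{1..}|lborel. ln (g_alt \<alpha> C D \<theta> x / (lam * x powr (- lam - 1))) * g_alt \<alpha> C D \<theta> x)
     = R + ln \<alpha> - ln lam + (lam - \<alpha>) * L" if lam: "lam > 0" for lam
  proof -
    have F: "has_bochner_integral (par \<alpha>) (\<lambda>x. tlt \<theta> x * ln (tlt \<theta> x) + ((ln \<alpha> - ln lam) * tlt \<theta> x + (lam - \<alpha>) * (tlt \<theta> x * ln x)))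
      (R + ((ln \<alpha> - ln lam) * 1 + (lam - \<alpha>) * L))"
      by (intro has_bochner_integral_add has_bochner_integral_mult_right R one lnL)
    have "has_bochner_integral lborel (\<lambda>x. pareto_dens \<alpha> x * (tlt \<theta> x * ln (tlt \<theta> x) + ((ln \<alpha> - ln lam) * tlt \<theta> x + (lam - \<alpha>) * (tlt \<theta> x * ln x))))
      (R + ((ln \<alpha> - ln lam) * 1 + (lam - \<alpha>) * L))"
      using F by (subst (asm) has_bochner_integral_par_iff[OF \<alpha>]) (simp_all add: tlt_def)
    moreover have "pareto_dens \<alpha> x * (tlt \<theta> x * ln (tlt \<theta> x) + ((ln \<alpha> - ln lam) * tlt \<theta> x + (lam - \<alpha>) * (tlt \<theta> x * ln x)))
      = indicator {1..} x *\<^sub>R (ln (g_alt \<alpha> C D \<theta> x / (lam * x powr (- lam - 1))) * g_alt \<alpha> C D \<theta> x)" for x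
    proof (cases "1 \<le> x")
      case True
      have t: "tlt \<theta> x > 0" using pos[of x] by simp
      have g: "g_alt \<alpha> C D \<theta> x = \<alpha> * x powr (- \<alpha> - 1) * tlt \<theta> x"
        using True by (simp add: g_alt_eq[OF \<alpha>] pareto_dens_def tlt_def)
      have "g_alt \<alpha> C D \<theta> x / (lam * x powr (- lam - 1)) = \<alpha> / lam * x powr (lam - \<alpha>) * tlt \<theta> x"
      proof -
        have "x powr (- \<alpha> - 1) = x powr (lam - \<alpha>) * x powr (- lam - 1)" by (simp add: powr_add[symmetric])
        then show ?thesis unfolding g using True lam by simp
      qed
      also have "ln \<dots> = ln \<alpha> - ln lam + (lam - \<alpha>) * ln x + ln (tlt \<theta> x)"
        using True \<alpha> lam t by (subst ln_mult_pos, simp, simp, subst ln_mult_pos, simp, simp, subst ln_divide_pos) (auto simp: ln_powr)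
      finally have lng: "ln (g_alt \<alpha> C D \<theta> x / (lam * x powr (- lam - 1))) = ln \<alpha> - ln lam + (lam - \<alpha>) * ln x + ln (tlt \<theta> x)" .
      show ?thesis unfolding lng unfolding g using True by (simp add: pareto_dens_def algebra_simps)
    qed (simp add: pareto_dens_def)
    ultimately have "(\<integral>x. indicator {1..} x *\<^sub>R (ln (g_alt \<alpha> C D \<theta> x / (lam * x powr (- lam - 1))) * g_alt \<alpha> C D \<theta> x) \<partial>lborel)
       = R + ((ln \<alpha> - ln lam) * 1 + (lam - \<alpha>) * L)"
      by (simp add: has_bochner_integral_iff)
    then show ?thesis by (simp add: set_lebesgue_integral_def)
  qed
  have m: "R + ln \<alpha> - ln (1 / L) + (1 / L - \<alpha>) * L = R + ln (1 + \<theta> * D / \<alpha>) - \<theta> * D / \<alpha>"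
  proof -
    have "ln L = ln (1 + \<theta> * D / \<alpha>) - ln \<alpha>" unfolding L_def using y \<alpha> by (intro ln_divide_pos) auto
    moreover have "ln (1 / L) = - ln L" using L by (simp add: ln_divide_pos)
    moreover have "(1 / L - \<alpha>) * L = 1 - \<alpha> * L" using L by (simp add: left_diff_distrib)
    moreover have "\<alpha> * L = 1 + \<theta> * D / \<alpha>" using \<alpha> by (simp add: L_def)
    ultimately show ?thesis by linarith
  qed
  have "KL (g_alt \<alpha> C D) \<theta> = R + ln \<alpha> - ln (1 / L) + (1 / L - \<alpha>) * L"
    unfolding KL_def
  proof (rule cInf_eq_minimum)
    show "R + ln \<alpha> - ln (1 / L) + (1 / L - \<alpha>) * L \<in> (\<lambda>lam. LINT x:{1..}|lborel. ln (g_alt \<alpha> C D \<theta> x / (lam * x powr (- lam - 1))) * g_alt \<alpha> C D \<theta> x) ` {0<..}"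
      using L by (intro image_eqI[of _ _ "1 / L"] val[symmetric]) auto
    fix z assume "z \<in> (\<lambda>lam. LINT x:{1..}|lborel. ln (g_alt \<alpha> C D \<theta> x / (lam * x powr (- lam - 1))) * g_alt \<alpha> C D \<theta> x) ` {0<..}"
    then obtain lam where lam: "lam > 0" "z = R + ln \<alpha> - ln lam + (lam - \<alpha>) * L" using val by auto
    \<comment> \<open>Minimality reduces to the tangent bound for the logarithm at 1, which is sharp
      at \<open>lam * L = 1\<close>.\<close>
    have "ln (lam * L) \<le> lam * L - 1" using lam L by (intro ln_le_minus_one) auto
    moreover have "ln (lam * L) = ln lam + ln L" using lam L by (intro ln_mult_pos) auto
    moreover have "ln (1 / L) = - ln L" using L by (simp add: ln_divide_pos)
    moreover have "(1 / L - \<alpha>) * L = 1 - \<alpha> * L" "(lam - \<alpha>) * L = lam * L - \<alpha> * L" using L by (simp_all add: left_diff_distrib)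
    ultimately show "R + ln \<alpha> - ln (1 / L) + (1 / L - \<alpha>) * L \<le> z" unfolding lam(2) by linarith
  qed
  then show ?thesis unfolding m unfolding R_def .
qed

end

section \<open>Assembling the local efficiency\<close>

lemma ln_second_order: "((\<lambda>\<theta>. (ln (1 + \<theta> * k) - \<theta> * k) / \<theta>^2) \<longlongrightarrow> - (k^2) / 2) (at_right (0::real))"
  by (real_asymp simp: power2_eq_square)

text \<open>\<open>bV\<close> is a definite description and \<open>ld_f\<close> a
  \<open>lim\<close>; the first conjunct certifies that, for small \<theta>, the limits behind both
  exist, so that the slope in the second one has its intended meaning.\<close>

theorem theorem4:
  fixes \<alpha> C D :: real
  assumes "\<alpha> > 0" and "C > 0"
    and dens: "\<exists>\<theta>0>0. \<forall>\<theta>\<in>{0..\<theta>0}. \<forall>x\<ge>1. g_alt \<alpha> C D \<theta> x \<ge> 0"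
    and "set_integrable lborel {1..} (\<lambda>x. x powr (\<alpha> + 1) * (h_alt \<alpha> C D x)\<^sup>2)"
  shows "(\<forall>\<^sub>F \<theta> in at_right 0. (\<exists>b. Vn_conv_prob (g_alt \<alpha> C D \<theta>) b) \<and>
                                 convergent (ld_seq (bV (g_alt \<alpha> C D) \<theta>)))
         \<and> ((\<lambda>\<theta>. cV (g_alt \<alpha> C D) \<theta> / (2 * KL (g_alt \<alpha> C D) \<theta>)) \<longlongrightarrow> 1) (at_right 0)"
proof -
  note \<alpha> = assms(1) and C = assms(2)
  note v = vv_pos[OF \<alpha>]
  define b where "b = bV (g_alt \<alpha> C D)"
  obtain \<theta>0 where \<theta>0: "\<theta>0 > 0" "\<And>\<theta> x. 0 \<le> \<theta> \<Longrightarrow> \<theta> \<le> \<theta>0 \<Longrightarrow> 1 \<le> x \<Longrightarrow> 0 \<le> g_alt \<alpha> C D \<theta> x"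
    using dens by auto
  \<comment> \<open>Nonnegativity of the density at the doubled parameter
    \<open>2 * \<theta>\<close> is exactly this lower bound at \<theta>.\<close>
  have half: "1 / 2 \<le> tlt \<alpha> C D \<theta> x" if "0 \<le> \<theta>" "\<theta> \<le> \<theta>0 / 2" for \<theta> x
  proof (cases "1 \<le> x")
    case True
    have "0 \<le> pareto_dens \<alpha> x * (1 + 2 * \<theta> * score \<alpha> C D x)"
      using \<theta>0(2)[of "2 * \<theta>" x] that True by (simp add: g_alt_eq[OF \<alpha>])
    moreover have "pareto_dens \<alpha> x > 0" using True \<alpha> by (simp add: pareto_dens_def)
    ultimately have "0 \<le> 1 + 2 * \<theta> * score \<alpha> C D x" by (simp add: zero_le_mult_iff)
    then show ?thesis by (simp add: tlt_def[OF \<alpha>])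
  next
    case False
    then show ?thesis by (simp add: tlt_def[OF \<alpha>] score_def)
  qed
  have pos: "0 \<le> tlt \<alpha> C D \<theta> x" if "0 \<le> \<theta>" "\<theta> \<le> \<theta>0 / 2" for \<theta> x
    using half[OF that, of x] by linarith
  have small: "\<forall>\<^sub>F \<theta> in at_right 0. 0 < \<theta> \<and> \<theta> \<le> \<theta>0 / 2"
    using \<theta>0(1) by (intro eventually_small) auto
  have id0: "((\<lambda>\<theta>. \<theta>) \<longlongrightarrow> 0) (at_right (0::real))" by (rule tendsto_ident_at)

  have lim_b: "((\<lambda>\<theta>. b \<theta> / \<theta>) \<longlongrightarrow> 2 * C * vv \<alpha>) (at_right 0)"
  proof (rule LIM_zero_cancel, rule Lim_null_comparison)
    define B where "B = (\<integral>x. \<bar>score \<alpha> C D x\<bar> \<partial>par \<alpha>)^2"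
    show "\<forall>\<^sub>F \<theta> in at_right 0. norm (b \<theta> / \<theta> - 2 * C * vv \<alpha>) \<le> \<theta> * B"
      using small
    proof eventually_elim
      case (elim \<theta>)
      have "\<bar>b \<theta> - 2 * \<theta> * C * vv \<alpha>\<bar> \<le> \<theta>^2 * B"
        unfolding b_def B_def using elim C by (intro bV_expansion[OF \<alpha>] pos) auto
      then have "\<bar>b \<theta> - 2 * \<theta> * C * vv \<alpha>\<bar> / \<theta> \<le> \<theta> * B"
        using elim by (simp add: pos_divide_le_eq power2_eq_square mult_ac)
      moreover have "b \<theta> / \<theta> - 2 * C * vv \<alpha> = (b \<theta> - 2 * \<theta> * C * vv \<alpha>) / \<theta>"
        using elim by (simp add: field_simps)
      ultimately show ?case using elim by (simp add: abs_divide)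
    qed
    show "((\<lambda>\<theta>. \<theta> * B) \<longlongrightarrow> 0) (at_right 0)" using tendsto_mult_right[OF id0, of B] by simp
  qed
  have "0 < 2 * C * vv \<alpha>" using C v by simp
  from order_tendstoD(1)[OF lim_b this] have b_pos: "\<forall>\<^sub>F \<theta> in at_right 0. 0 < b \<theta>"
    using small by eventually_elim (simp add: zero_less_divide_iff)
  have b0: "(b \<longlongrightarrow> 0) (at_right 0)"
  proof (rule Lim_transform_eventually)
    show "((\<lambda>\<theta>. b \<theta> / \<theta> * \<theta>) \<longlongrightarrow> 0) (at_right 0)" using tendsto_mult[OF lim_b id0] by simp
    show "\<forall>\<^sub>F \<theta> in at_right 0. b \<theta> / \<theta> * \<theta> = b \<theta>" using small by eventually_elim simp
  qed
  \<comment> \<open>Positivity matters here: the asymptotics of the rate function are known only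
    along positive levels.\<close>
  have "filterlim b (at_right 0) (at_right 0)"
    unfolding filterlim_at using b0 b_pos by (auto elim: eventually_mono)
  from filterlim_compose[OF Jf_asymp[OF \<alpha>] this]
  have lim_J: "((\<lambda>\<theta>. Jf \<alpha> (b \<theta>) / (b \<theta>)^2) \<longlongrightarrow> 1 / (8 * vv \<alpha>)) (at_right 0)" .

  obtain s1 where s1: "s1 > 0" "\<And>t. 0 < t \<Longrightarrow> t < s1 \<Longrightarrow> ld_seq t \<longlonglongrightarrow> Jf \<alpha> t"
    using ld_seq_limit[OF \<alpha>] by blast
  have ld: "\<forall>\<^sub>F \<theta> in at_right 0. ld_seq (b \<theta>) \<longlonglongrightarrow> Jf \<alpha> (b \<theta>)"
    using b_pos order_tendstoD(2)[OF b0 s1(1)] by eventually_elim (rule s1(2))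

  have lim_KL: "((\<lambda>\<theta>. KL (g_alt \<alpha> C D) \<theta> / \<theta>^2) \<longlongrightarrow> C^2 * vv \<alpha> / 2) (at_right 0)"
  proof -
    define S where "S = C^2 * vv \<alpha> + D^2 / \<alpha>^2"
    define M where "M = (\<integral>x. \<bar>score \<alpha> C D x\<bar>^3 \<partial>par \<alpha>)"
    have "((\<lambda>\<theta>. ent (par \<alpha>) (tlt \<alpha> C D \<theta>) / \<theta>^2) \<longlongrightarrow> S / 2) (at_right 0)"
    proof (rule LIM_zero_cancel, rule Lim_null_comparison)
      show "\<forall>\<^sub>F \<theta> in at_right 0. norm (ent (par \<alpha>) (tlt \<alpha> C D \<theta>) / \<theta>^2 - S / 2) \<le> \<theta> * M"
        using small
      proof eventually_elim
        case (elim \<theta>)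
        have "\<bar>ent (par \<alpha>) (tlt \<alpha> C D \<theta>) - \<theta>^2 / 2 * S\<bar> \<le> \<theta>^3 * M"
          unfolding S_def M_def using elim by (intro ent_tlt(2)[OF \<alpha>] half) auto
        then have "\<bar>ent (par \<alpha>) (tlt \<alpha> C D \<theta>) - \<theta>^2 / 2 * S\<bar> / \<theta>^2 \<le> \<theta> * M"
          using elim by (simp add: pos_divide_le_eq power2_eq_square power3_eq_cube mult_ac)
        moreover have "ent (par \<alpha>) (tlt \<alpha> C D \<theta>) / \<theta>^2 - S / 2 = (ent (par \<alpha>) (tlt \<alpha> C D \<theta>) - \<theta>^2 / 2 * S) / \<theta>^2"
          using elim by (simp add: diff_divide_distrib)
        ultimately show ?case by (simp add: abs_divide)
      qed
      show "((\<lambda>\<theta>. \<theta> * M) \<longlongrightarrow> 0) (at_right 0)" using tendsto_mult_right[OF id0, of M] by simp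
    qed
    \<comment> \<open>The second-order term of the logarithm, contributed by the optimal null
      parameter, cancels \<open>D^2 / \<alpha>^2\<close> in \<open>S\<close>.\<close>
    from tendsto_add[OF this ln_second_order[of "D / \<alpha>"]]
    have "((\<lambda>\<theta>. ent (par \<alpha>) (tlt \<alpha> C D \<theta>) / \<theta>^2 + (ln (1 + \<theta> * (D / \<alpha>)) - \<theta> * (D / \<alpha>)) / \<theta>^2)
        \<longlongrightarrow> C^2 * vv \<alpha> / 2) (at_right 0)"
      by (simp add: S_def power_divide add_divide_distrib)
    moreover have "((\<lambda>\<theta>. \<theta> * D / \<alpha>) \<longlongrightarrow> 0 * D / \<alpha>) (at_right 0)"
      using \<alpha> by (intro tendsto_intros) auto
    then have "\<forall>\<^sub>F \<theta> in at_right 0. - 1 < \<theta> * D / \<alpha>"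
      by (rule order_tendstoD(1)) simp
    then have "\<forall>\<^sub>F \<theta> in at_right 0. ent (par \<alpha>) (tlt \<alpha> C D \<theta>) / \<theta>^2 + (ln (1 + \<theta> * (D / \<alpha>)) - \<theta> * (D / \<alpha>)) / \<theta>^2
        = KL (g_alt \<alpha> C D) \<theta> / \<theta>^2"
      using small
    proof eventually_elim
      case (elim \<theta>)
      have "KL (g_alt \<alpha> C D) \<theta> = ent (par \<alpha>) (tlt \<alpha> C D \<theta>) + ln (1 + \<theta> * D / \<alpha>) - \<theta> * D / \<alpha>"
        using elim by (intro KL_eq[OF \<alpha>] half) auto
      then show ?case by (simp add: diff_divide_distrib add_divide_distrib)
    qed
    ultimately show ?thesis by (rule Lim_transform_eventually)
  qed

  \<comment> \<open>The efficiency is split into three factors with known limits; the powers of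
    \<open>b \<theta>\<close> and \<theta> cancel, as both are eventually nonzero.\<close>
  have "((\<lambda>\<theta>. Jf \<alpha> (b \<theta>) / (b \<theta>)^2 * (b \<theta> / \<theta>)^2 / (KL (g_alt \<alpha> C D) \<theta> / \<theta>^2))
      \<longlongrightarrow> 1 / (8 * vv \<alpha>) * (2 * C * vv \<alpha>)^2 / (C^2 * vv \<alpha> / 2)) (at_right 0)"
    using C v by (intro tendsto_divide tendsto_mult tendsto_power lim_J lim_b lim_KL) auto
  moreover have "1 / (8 * vv \<alpha>) * (2 * C * vv \<alpha>)^2 / (C^2 * vv \<alpha> / 2) = 1"
    using C v by (simp add: power2_eq_square field_simps)
  ultimately have lim: "((\<lambda>\<theta>. Jf \<alpha> (b \<theta>) / (b \<theta>)^2 * (b \<theta> / \<theta>)^2 / (KL (g_alt \<alpha> C D) \<theta> / \<theta>^2)) \<longlongrightarrow> 1) (at_right 0)"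
    by simp
  have "((\<lambda>\<theta>. cV (g_alt \<alpha> C D) \<theta> / (2 * KL (g_alt \<alpha> C D) \<theta>)) \<longlongrightarrow> 1) (at_right 0)"
  proof (rule Lim_transform_eventually[OF lim])
    show "\<forall>\<^sub>F \<theta> in at_right 0. Jf \<alpha> (b \<theta>) / (b \<theta>)^2 * (b \<theta> / \<theta>)^2 / (KL (g_alt \<alpha> C D) \<theta> / \<theta>^2)
        = cV (g_alt \<alpha> C D) \<theta> / (2 * KL (g_alt \<alpha> C D) \<theta>)"
      using ld b_pos small
    proof eventually_elim
      case (elim \<theta>)
      have "cV (g_alt \<alpha> C D) \<theta> = 2 * Jf \<alpha> (b \<theta>)"
        unfolding cV_def ld_f_def b_def[symmetric] using limI[OF elim(1)] by simp
      then show ?case using elim(2,3) by (simp add: power_divide)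
    qed
  qed
  moreover have "\<forall>\<^sub>F \<theta> in at_right 0. (\<exists>b. Vn_conv_prob (g_alt \<alpha> C D \<theta>) b) \<and> convergent (ld_seq (bV (g_alt \<alpha> C D) \<theta>))"
    using ld small
  proof eventually_elim
    case (elim \<theta>)
    have "Vn_conv_prob (g_alt \<alpha> C D \<theta>) (Vf (tilt (par \<alpha>) (tlt \<alpha> C D \<theta>)))"
      using elim by (intro Vn_conv_prob_g_alt(1)[OF \<alpha>] pos) auto
    then show ?case using elim(1) unfolding b_def by (auto simp: convergent_def)
  qed
  ultimately show ?thesis by blast
qed

end
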